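(* Let $m,n\ge1$ and $1\le i\le m$. The map induced by the exact functor $\nabla_{m;i}^{n}$ on Grothendieck groups $K^0(\mathcal{A}_{m+n-1})\to K^0(\mathcal{A}_{m,n})$ is given, for $1\le j\le m+n-1$, by $$[\nabla_{m;i}^n (S_j^{m+n-1})]=\begin{cases}\sum_{k=1}^{n} [S_{j,k}^{m,n}]&\text{ if } 1\leq j \leq i-1,\\ [S_{i,j-i+1}^{m,n}]&\text{ if } i\leq j\leq i+n-1,\\ \sum_{k=1}^{n} [S_{j-n+1,k}^{m,n}]&\text{ if } i+n \leq j \leq m+n-1.\end{cases}$$ Consequently, letting $(e^n_j)_{1\le j\le n}$ be the basis of $\operatorname{Hom}(K^0(\mathcal{A}_n),\mathbb{Z})$ dual to $([S_j^n])_{1\le j\le n}$, and identifying $[S^{m,n}_{j,k}]$ with $[S^m_j]\otimes[S^n_k]$, the linear dual $\circ_{m;i}^{n}$ of this map is given by $$\circ_{m;i}^{n}(e^m_j \otimes e^n_k) =\begin{cases} e^{m+n-1}_{j}&\text{ if }i>j,\\ e^{m+n-1}_{i+k-1}&\text{ if }i=j,\\ e^{m+n-1}_{j+n-1}&\text{ if }i<j,\end{cases}$$ that is, it is the composition map $\circ_i:\operatorname{Dias}(m)\otimes\operatorname{Dias}(n)\to\operatorname{Dias}(m+n-1)$ of the Diassociative operad in its usual basis.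
   Context: Fix a field $k$. For $n\ge 1$ let $A_n$ be the path algebra over $k$ of the quiver $\overrightarrow{\mathbb{A}}_n: 1\to 2\to\cdots\to n$, and let $\mathcal{A}_n$ be the category of finite-dimensional right $A_n$-modules, identified with representations of the quiver (so that the projective module $P_j$ has dimension $1$ exactly at the vertices $\ell\ge j$). $\mathcal{A}_{m,n}$ is the category of finite-dimensional right modules over $A_m\otimes_k A_n$, i.e. representations of the product quiver $\overrightarrow{\mathbb{A}}_m\times\overrightarrow{\mathbb{A}}_n$ with all commutation relations. $S_j^n$ is the simple $\overrightarrow{\mathbb{A}}_n$-module at vertex $j$, $S_{j,k}^{m,n}$ the simple module at vertex $(j,k)$ of $\overrightarrow{\mathbb{A}}_m\times\overrightarrow{\mathbb{A}}_n$, and $[M]$ the class of $M$ in the Grothendieck group. A module over a product with first factor $\overrightarrow{\mathbb{A}}_a^{op}$ is a module with a left $A_a$-action commuting with the right actions of the other factors (arrows in that factor are reversed). A module over a product quiver is standard with support $\mathsf{S}$ (a set of vertices) if, up to isomorphism, it is $k$ at each vertex of $\mathsf{S}$, $0$ elsewhere, with identity maps along arrows between two vertices of $\mathsf{S}$. For $1\le i\le m$ and $n\ge1$ let $\mathsf{S}_{m;i}^{n}$ be the set of triples $(\gamma,\mu,\nu)\in[1,m+n-1]\times[1,m]\times[1,n]$ such that ($\mu\le i-1$ and $\gamma\le\mu$) or ($\mu=i$ and $\gamma\le i+\nu-1$) or ($\mu\ge i+1$ and $\gamma\le \mu+n-1$). Let $M_{m;i}^{n}$ be the standard $\overrightarrow{\mathbb{A}}_{m+n-1}^{op}\times\overrightarrow{\mathbb{A}}_m\times\overrightarrow{\mathbb{A}}_n$-module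 with support $\mathsf{S}_{m;i}^{n}$ (it is projective in each of the three directions), and let $\nabla_{m;i}^{n}=\;?\otimes_{A_{m+n-1}}M_{m;i}^{n}:\mathcal{A}_{m+n-1}\to\mathcal{A}_{m,n}$. The Diassociative operad: $\operatorname{Dias}(n)$ is the free abelian group with basis $e^n_1,\dots,e^n_n$, and for $1\le i\le m$ the composition $\circ_i:\operatorname{Dias}(m)\otimes\operatorname{Dias}(n)\to\operatorname{Dias}(m+n-1)$ sends $e^m_j\otimes e^n_k$ to $e^{m+n-1}_j$ if $i>j$, to $e^{m+n-1}_{i+k-1}$ if $i=j$, and to $e^{m+n-1}_{j+n-1}$ if $i<j$. *)

theory Defs
  imports "HOL-Algebra.Free_Abelian_Groups" "Jordan_Normal_Form.Missing_VectorSpace"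
begin

section \<open>Abelian groups given by generators and relations\<close>

text \<open>Abelian groups are written as (multiplicative) HOL-Algebra monoid records.\<close>

definition pres_group :: "'a set \<Rightarrow> ('a \<Rightarrow>\<^sub>0 int) set \<Rightarrow> ('a \<Rightarrow>\<^sub>0 int) set monoid" where
  "pres_group S R = free_Abelian_group S Mod generate (free_Abelian_group S) R"

definition pres_class :: "'a set \<Rightarrow> ('a \<Rightarrow>\<^sub>0 int) set \<Rightarrow> 'a \<Rightarrow> ('a \<Rightarrow>\<^sub>0 int) set" where
  "pres_class S R s = generate (free_Abelian_group S) R #>\<^bsub>free_Abelian_group S\<^esub> frag_of s"

text \<open>The extension by linearity of a map on generators, first to the free group, then to
  cosets. The latter is meaningful only if the relations are respected, in which case
  the image of every coset is a singleton.\<close>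

definition lin_ext :: "('b, 'c) monoid_scheme \<Rightarrow> ('a \<Rightarrow> 'b) \<Rightarrow> ('a \<Rightarrow>\<^sub>0 int) \<Rightarrow> 'b" where
  "lin_ext H f x =
     finprod H (\<lambda>a. f a [^]\<^bsub>H\<^esub> Poly_Mapping.lookup x a) (Poly_Mapping.keys x)"

definition pres_lift :: "('b, 'c) monoid_scheme \<Rightarrow> ('a \<Rightarrow> 'b) \<Rightarrow> ('a \<Rightarrow>\<^sub>0 int) set \<Rightarrow> 'b" where
  "pres_lift H f X = the_elem (lin_ext H f ` X)"

definition Z_basis :: "('b, 'c) monoid_scheme \<Rightarrow> ('a \<Rightarrow> 'b) \<Rightarrow> 'a set \<Rightarrow> bool" where
  "Z_basis G b I \<longleftrightarrow> b \<in> I \<rightarrow> carrier G \<and> lin_ext G b \<in> iso (free_Abelian_group I) G"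

subsection \<open>Tensor products over the integers\<close>

definition tensor_rels ::
  "('a, 'c) monoid_scheme \<Rightarrow> ('b, 'd) monoid_scheme \<Rightarrow> ('a \<times> 'b \<Rightarrow>\<^sub>0 int) set" where
  "tensor_rels G H =
     {frag_of (x \<otimes>\<^bsub>G\<^esub> x', y) - frag_of (x, y) - frag_of (x', y) | x x' y.
        x \<in> carrier G \<and> x' \<in> carrier G \<and> y \<in> carrier H} \<union>
     {frag_of (x, y \<otimes>\<^bsub>H\<^esub> y') - frag_of (x, y) - frag_of (x, y') | x y y'.
        x \<in> carrier G \<and> y \<in> carrier H \<and> y' \<in> carrier H}"

definition tensor_group ::
  "('a, 'c) monoid_scheme \<Rightarrow> ('b, 'd) monoid_scheme \<Rightarrow> ('a \<times> 'b \<Rightarrow>\<^sub>0 int) set monoid" where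
  "tensor_group G H = pres_group (carrier G \<times> carrier H) (tensor_rels G H)"

definition tens ::
  "('a, 'c) monoid_scheme \<Rightarrow> ('b, 'd) monoid_scheme \<Rightarrow> 'a \<Rightarrow> 'b \<Rightarrow> ('a \<times> 'b \<Rightarrow>\<^sub>0 int) set" where
  "tens G H x y = pres_class (carrier G \<times> carrier H) (tensor_rels G H) (x, y)"

definition tensor_group_map ::
  "('a, 'c) monoid_scheme \<Rightarrow> ('b, 'd) monoid_scheme \<Rightarrow> ('e \<Rightarrow> 'a) \<Rightarrow> ('f \<Rightarrow> 'b) \<Rightarrow>
   ('e \<times> 'f \<Rightarrow>\<^sub>0 int) set \<Rightarrow> ('a \<times> 'b \<Rightarrow>\<^sub>0 int) set" where
  "tensor_group_map G H f g =
     pres_lift (tensor_group G H) (\<lambda>(x, y). tens G H (f x) (g y))"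

subsection \<open>Integral duals\<close>

text \<open>Homomorphisms are made extensional, so that equality of functionals is equality of functions.\<close>

definition dual_group :: "('a, 'c) monoid_scheme \<Rightarrow> ('a \<Rightarrow> int) monoid" where
  "dual_group G =
     \<lparr>carrier = hom G integer_group \<inter> extensional (carrier G),
      monoid.mult = (\<lambda>f g. \<lambda>x\<in>carrier G. f x + g x),
      one = (\<lambda>x\<in>carrier G. 0)\<rparr>"

definition dual_map :: "('a, 'c) monoid_scheme \<Rightarrow> ('a \<Rightarrow> 'b) \<Rightarrow> ('b \<Rightarrow> int) \<Rightarrow> 'a \<Rightarrow> int" where
  "dual_map G \<phi> f = (\<lambda>x\<in>carrier G. f (\<phi> x))"

definition dual_basis ::
  "('a, 'c) monoid_scheme \<Rightarrow> ('i \<Rightarrow> 'a) \<Rightarrow> 'i set \<Rightarrow> 'i \<Rightarrow> 'a \<Rightarrow> int" where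
  "dual_basis G b I j =
     (THE f. f \<in> carrier (dual_group G) \<and> (\<forall>l\<in>I. f (b l) = (if l = j then 1 else 0)))"


section \<open>Quivers with commutation relations and their representations\<close>

text \<open>Quivers without parallel arrows. An element \<open>(a, b, c, d)\<close> of \<open>squares\<close> is the relation
  that the paths \<open>a \<rightarrow> b \<rightarrow> d\<close> and \<open>a \<rightarrow> c \<rightarrow> d\<close> agree.\<close>

record 'v quiver =
  vertices :: "'v set"
  arrows :: "('v \<times> 'v) set"
  squares :: "('v \<times> 'v \<times> 'v \<times> 'v) set"

definition path_quiver :: "nat \<Rightarrow> nat quiver" where
  "path_quiver n =
     \<lparr>vertices = {1..n}, arrows = {(a, a + 1) | a. 1 \<le> a \<and> a < n}, squares = {}\<rparr>"

definition op_quiver :: "'v quiver \<Rightarrow> 'v quiver" where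
  "op_quiver Q =
     \<lparr>vertices = vertices Q, arrows = {(b, a) | a b. (a, b) \<in> arrows Q},
      squares = {(d, b, c, a) | a b c d. (a, b, c, d) \<in> squares Q}\<rparr>"

definition prod_quiver :: "'v quiver \<Rightarrow> 'w quiver \<Rightarrow> ('v \<times> 'w) quiver" where
  "prod_quiver Q R =
     \<lparr>vertices = vertices Q \<times> vertices R,
      arrows = {((a, u), (b, u)) | a b u. (a, b) \<in> arrows Q \<and> u \<in> vertices R} \<union>
               {((a, u), (a, v)) | a u v. a \<in> vertices Q \<and> (u, v) \<in> arrows R},
      squares = {((a, u), (b, u), (c, u), (d, u)) | a b c d u.
                   (a, b, c, d) \<in> squares Q \<and> u \<in> vertices R} \<union>
                {((a, u), (a, v), (a, w), (a, z)) | a u v w z.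
                   a \<in> vertices Q \<and> (u, v, w, z) \<in> squares R} \<union>
                {((a, u), (b, u), (a, v), (b, v)) | a b u v.
                   (a, b) \<in> arrows Q \<and> (u, v) \<in> arrows R}\<rparr>"

text \<open>Right modules over the path algebra of \<open>Q\<close> modulo its relations: arrows act covariantly.\<close>

record ('v, 'k, 'u) rep =
  sp :: "'v \<Rightarrow> ('k, 'u) module"
  ar :: "'v \<Rightarrow> 'v \<Rightarrow> 'u \<Rightarrow> 'u"

definition fd_rep :: "('k, 'r) ring_scheme \<Rightarrow> 'v quiver \<Rightarrow> ('v, 'k, 'u) rep \<Rightarrow> bool" where
  "fd_rep K Q X \<longleftrightarrow>
     (\<forall>a\<in>vertices Q. vectorspace K (sp X a) \<and> vectorspace.fin_dim K (sp X a)) \<and>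
     (\<forall>(a, b)\<in>arrows Q. ar X a b \<in> module_hom K (sp X a) (sp X b)) \<and>
     (\<forall>(a, b, c, d)\<in>squares Q. \<forall>x\<in>carrier (sp X a).
        ar X b d (ar X a b x) = ar X c d (ar X a c x))"

definition rep_hom ::
  "('k, 'r) ring_scheme \<Rightarrow> 'v quiver \<Rightarrow> ('v, 'k, 'u) rep \<Rightarrow> ('v, 'k, 'w) rep \<Rightarrow>
   ('v \<Rightarrow> 'u \<Rightarrow> 'w) \<Rightarrow> bool" where
  "rep_hom K Q X Y f \<longleftrightarrow>
     (\<forall>a\<in>vertices Q. f a \<in> module_hom K (sp X a) (sp Y a)) \<and>
     (\<forall>(a, b)\<in>arrows Q. \<forall>x\<in>carrier (sp X a). f b (ar X a b x) = ar Y a b (f a x))"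

definition rep_iso ::
  "('k, 'r) ring_scheme \<Rightarrow> 'v quiver \<Rightarrow> ('v, 'k, 'u) rep \<Rightarrow> ('v, 'k, 'w) rep \<Rightarrow> bool" where
  "rep_iso K Q X Y \<longleftrightarrow>
     (\<exists>f. rep_hom K Q X Y f \<and>
          (\<forall>a\<in>vertices Q. bij_betw (f a) (carrier (sp X a)) (carrier (sp Y a))))"

definition short_exact ::
  "('k, 'r) ring_scheme \<Rightarrow> 'v quiver \<Rightarrow> ('v, 'k, 'u) rep \<Rightarrow> ('v, 'k, 'u) rep \<Rightarrow>
   ('v, 'k, 'u) rep \<Rightarrow> ('v \<Rightarrow> 'u \<Rightarrow> 'u) \<Rightarrow> ('v \<Rightarrow> 'u \<Rightarrow> 'u) \<Rightarrow> bool" where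
  "short_exact K Q X Y Z f g \<longleftrightarrow>
     fd_rep K Q X \<and> fd_rep K Q Y \<and> fd_rep K Q Z \<and>
     rep_hom K Q X Y f \<and> rep_hom K Q Y Z g \<and>
     (\<forall>a\<in>vertices Q.
        inj_on (f a) (carrier (sp X a)) \<and>
        f a ` carrier (sp X a) = {y \<in> carrier (sp Y a). g a y = \<zero>\<^bsub>sp Z a\<^esub>} \<and>
        g a ` carrier (sp Y a) = carrier (sp Z a))"

text \<open>\<open>Fo\<close> and \<open>Fm X Y\<close> are the actions on objects and on morphisms from \<open>X\<close> to \<open>Y\<close>. Morphisms matter
  only on carriers, whence the pointwise form of the functor laws.\<close>

definition exact_functor ::
  "('k, 'r) ring_scheme \<Rightarrow> 'v quiver \<Rightarrow> 'w quiver \<Rightarrow>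
   (('v, 'k, 'a) rep \<Rightarrow> ('w, 'k, 'b) rep) \<Rightarrow>
   (('v, 'k, 'a) rep \<Rightarrow> ('v, 'k, 'a) rep \<Rightarrow> ('v \<Rightarrow> 'a \<Rightarrow> 'a) \<Rightarrow> ('w \<Rightarrow> 'b \<Rightarrow> 'b)) \<Rightarrow> bool" where
  "exact_functor K Q R Fo Fm \<longleftrightarrow>
     (\<forall>X. fd_rep K Q X \<longrightarrow> fd_rep K R (Fo X)) \<and>
     (\<forall>X Y f. fd_rep K Q X \<and> fd_rep K Q Y \<and> rep_hom K Q X Y f \<longrightarrow>
        rep_hom K R (Fo X) (Fo Y) (Fm X Y f)) \<and>
     (\<forall>X f. fd_rep K Q X \<and> rep_hom K Q X X f \<and>
        (\<forall>a\<in>vertices Q. \<forall>x\<in>carrier (sp X a). f a x = x) \<longrightarrow>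
        (\<forall>w\<in>vertices R. \<forall>t\<in>carrier (sp (Fo X) w). Fm X X f w t = t)) \<and>
     (\<forall>X Y Z f g h. fd_rep K Q X \<and> fd_rep K Q Y \<and> fd_rep K Q Z \<and>
        rep_hom K Q X Y f \<and> rep_hom K Q Y Z g \<and> rep_hom K Q X Z h \<and>
        (\<forall>a\<in>vertices Q. \<forall>x\<in>carrier (sp X a). h a x = g a (f a x)) \<longrightarrow>
        (\<forall>w\<in>vertices R. \<forall>t\<in>carrier (sp (Fo X) w).
           Fm X Z h w t = Fm Y Z g w (Fm X Y f w t))) \<and>
     (\<forall>X Y Z f g. short_exact K Q X Y Z f g \<longrightarrow>
        short_exact K R (Fo X) (Fo Y) (Fo Z) (Fm X Y f) (Fm Y Z g))"

subsection \<open>Standard modules\<close>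

definition line_space :: "('k, 'r) ring_scheme \<Rightarrow> ('k, 'k) module" where
  "line_space K =
     \<lparr>carrier = carrier K, monoid.mult = (\<otimes>\<^bsub>K\<^esub>), one = \<one>\<^bsub>K\<^esub>,
      ring.zero = \<zero>\<^bsub>K\<^esub>, ring.add = (\<oplus>\<^bsub>K\<^esub>), smult = (\<otimes>\<^bsub>K\<^esub>)\<rparr>"

definition standard_rep :: "('k, 'r) ring_scheme \<Rightarrow> 'v set \<Rightarrow> ('v, 'k, 'k) rep" where
  "standard_rep K S =
     \<lparr>sp = (\<lambda>a. if a \<in> S then line_space K else (line_space K)\<lparr>carrier := {\<zero>\<^bsub>K\<^esub>}\<rparr>),
      ar = (\<lambda>a b x. if a \<in> S \<and> b \<in> S then x else \<zero>\<^bsub>K\<^esub>)\<rparr>"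

subsection \<open>Grothendieck groups\<close>

text \<open>Every finite-dimensional space is isomorphic to a space of functions \<open>nat \<Rightarrow> 'k\<close>, so that
  the modules with carriers in this type form a category equivalent to that of all
  finite-dimensional modules. The class of a module over any carrier type is that of an
  isomorphic module from this universe.\<close>

definition K0_gens ::
  "('k, 'r) ring_scheme \<Rightarrow> 'v quiver \<Rightarrow> ('v, 'k, nat \<Rightarrow> 'k) rep set" where
  "K0_gens K Q = {X. fd_rep K Q X}"

definition K0_rels ::
  "('k, 'r) ring_scheme \<Rightarrow> 'v quiver \<Rightarrow> (('v, 'k, nat \<Rightarrow> 'k) rep \<Rightarrow>\<^sub>0 int) set" where
  "K0_rels K Q =
     {frag_of Y - frag_of X - frag_of Z | X Y Z f g. short_exact K Q X Y Z f g}"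

definition K0 ::
  "('k, 'r) ring_scheme \<Rightarrow> 'v quiver \<Rightarrow> (('v, 'k, nat \<Rightarrow> 'k) rep \<Rightarrow>\<^sub>0 int) set monoid" where
  "K0 K Q = pres_group (K0_gens K Q) (K0_rels K Q)"

definition K0_class ::
  "('k, 'r) ring_scheme \<Rightarrow> 'v quiver \<Rightarrow> ('v, 'k, 'u) rep \<Rightarrow>
   (('v, 'k, nat \<Rightarrow> 'k) rep \<Rightarrow>\<^sub>0 int) set" where
  "K0_class K Q X =
     pres_class (K0_gens K Q) (K0_rels K Q) (SOME Y. fd_rep K Q Y \<and> rep_iso K Q Y X)"

definition K0_map ::
  "('k, 'r) ring_scheme \<Rightarrow> 'w quiver \<Rightarrow>
   (('v, 'k, nat \<Rightarrow> 'k) rep \<Rightarrow> ('w, 'k, 'b) rep) \<Rightarrow>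
   (('v, 'k, nat \<Rightarrow> 'k) rep \<Rightarrow>\<^sub>0 int) set \<Rightarrow> (('w, 'k, nat \<Rightarrow> 'k) rep \<Rightarrow>\<^sub>0 int) set" where
  "K0_map K R F = pres_lift (K0 K R) (\<lambda>X. K0_class K R (F X))"


section \<open>Tensor products of modules with bimodules\<close>

text \<open>Let \<open>X\<close> be a right module over \<open>Q\<close> and \<open>M\<close> a module over \<open>op Q \<times> R\<close>, i.e. with a left action
  of \<open>Q\<close>. The component at a vertex \<open>w\<close> of \<open>R\<close> of the tensor product over (the path algebra of) \<open>Q\<close>
  is generated by the symbols \<open>x \<otimes> y\<close> with \<open>x\<close> in \<open>X\<^sub>a\<close> and \<open>y\<close> in \<open>M\<^sub>(\<^sub>a\<^sub>,\<^sub>w\<^sub>)\<close> (products of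
  components at different vertices vanish, the idempotents being orthogonal), subject to
  biadditivity and balancedness over scalars and over arrows.\<close>

definition rep_tensor_gens ::
  "'v quiver \<Rightarrow> ('v, 'k, 'u) rep \<Rightarrow> ('v \<times> 'w, 'k, 'b) rep \<Rightarrow> 'w \<Rightarrow> ('v \<times> 'u \<times> 'b) set" where
  "rep_tensor_gens Q X M w =
     {(a, x, y). a \<in> vertices Q \<and> x \<in> carrier (sp X a) \<and> y \<in> carrier (sp M (a, w))}"

definition rep_tensor_rels ::
  "('k, 'r) ring_scheme \<Rightarrow> 'v quiver \<Rightarrow> ('v, 'k, 'u) rep \<Rightarrow> ('v \<times> 'w, 'k, 'b) rep \<Rightarrow> 'w \<Rightarrow>
   ('v \<times> 'u \<times> 'b \<Rightarrow>\<^sub>0 int) set" where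
  "rep_tensor_rels K Q X M w =
     {frag_of (a, x \<oplus>\<^bsub>sp X a\<^esub> x', y) - frag_of (a, x, y) - frag_of (a, x', y) | a x x' y.
        a \<in> vertices Q \<and> x \<in> carrier (sp X a) \<and> x' \<in> carrier (sp X a) \<and>
        y \<in> carrier (sp M (a, w))} \<union>
     {frag_of (a, x, y \<oplus>\<^bsub>sp M (a, w)\<^esub> y') - frag_of (a, x, y) - frag_of (a, x, y') | a x y y'.
        a \<in> vertices Q \<and> x \<in> carrier (sp X a) \<and>
        y \<in> carrier (sp M (a, w)) \<and> y' \<in> carrier (sp M (a, w))} \<union>
     {frag_of (a, c \<odot>\<^bsub>sp X a\<^esub> x, y) - frag_of (a, x, c \<odot>\<^bsub>sp M (a, w)\<^esub> y) | a c x y.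
        a \<in> vertices Q \<and> c \<in> carrier K \<and> x \<in> carrier (sp X a) \<and> y \<in> carrier (sp M (a, w))} \<union>
     {frag_of (b, ar X a b x, y) - frag_of (a, x, ar M (b, w) (a, w) y) | a b x y.
        (a, b) \<in> arrows Q \<and> x \<in> carrier (sp X a) \<and> y \<in> carrier (sp M (b, w))}"

definition rep_tens ::
  "('k, 'r) ring_scheme \<Rightarrow> 'v quiver \<Rightarrow> ('v, 'k, 'u) rep \<Rightarrow> ('v \<times> 'w, 'k, 'b) rep \<Rightarrow> 'w \<Rightarrow>
   'v \<times> 'u \<times> 'b \<Rightarrow> ('v \<times> 'u \<times> 'b \<Rightarrow>\<^sub>0 int) set" where
  "rep_tens K Q X M w = pres_class (rep_tensor_gens Q X M w) (rep_tensor_rels K Q X M w)"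

definition rep_tensor_group ::
  "('k, 'r) ring_scheme \<Rightarrow> 'v quiver \<Rightarrow> ('v, 'k, 'u) rep \<Rightarrow> ('v \<times> 'w, 'k, 'b) rep \<Rightarrow> 'w \<Rightarrow>
   ('v \<times> 'u \<times> 'b \<Rightarrow>\<^sub>0 int) set monoid" where
  "rep_tensor_group K Q X M w = pres_group (rep_tensor_gens Q X M w) (rep_tensor_rels K Q X M w)"

text \<open>The ring fields \<open>mult\<close> and \<open>one\<close> of a module record play no role.\<close>

definition rep_tensor ::
  "('k, 'r) ring_scheme \<Rightarrow> 'v quiver \<Rightarrow> ('v \<times> 'w, 'k, 'b) rep \<Rightarrow> ('v, 'k, 'u) rep \<Rightarrow>
   ('w, 'k, ('v \<times> 'u \<times> 'b \<Rightarrow>\<^sub>0 int) set) rep" where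
  "rep_tensor K Q M X =
     \<lparr>sp = (\<lambda>w.
        \<lparr>carrier = carrier (rep_tensor_group K Q X M w),
         monoid.mult = (\<lambda>s t. undefined), one = undefined,
         ring.zero = \<one>\<^bsub>rep_tensor_group K Q X M w\<^esub>,
         ring.add = (\<otimes>\<^bsub>rep_tensor_group K Q X M w\<^esub>),
         smult = (\<lambda>c. pres_lift (rep_tensor_group K Q X M w)
                    (\<lambda>(a, x, y). rep_tens K Q X M w (a, c \<odot>\<^bsub>sp X a\<^esub> x, y)))\<rparr>),
      ar = (\<lambda>u w. pres_lift (rep_tensor_group K Q X M w)
                    (\<lambda>(a, x, y). rep_tens K Q X M w (a, x, ar M (a, u) (a, w) y)))\<rparr>"

definition rep_tensor_map ::
  "('k, 'r) ring_scheme \<Rightarrow> 'v quiver \<Rightarrow> ('v \<times> 'w, 'k, 'b) rep \<Rightarrow> ('v, 'k, 'u) rep \<Rightarrow>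
   ('v, 'k, 'u) rep \<Rightarrow> ('v \<Rightarrow> 'u \<Rightarrow> 'u) \<Rightarrow>
   'w \<Rightarrow> ('v \<times> 'u \<times> 'b \<Rightarrow>\<^sub>0 int) set \<Rightarrow> ('v \<times> 'u \<times> 'b \<Rightarrow>\<^sub>0 int) set" where
  "rep_tensor_map K Q M X Y f w =
     pres_lift (rep_tensor_group K Q Y M w) (\<lambda>(a, x, y). rep_tens K Q Y M w (a, f a x, y))"


section \<open>The functors and their duals\<close>

abbreviation grid_quiver :: "nat \<Rightarrow> nat \<Rightarrow> (nat \<times> nat) quiver" where
  "grid_quiver m n \<equiv> prod_quiver (path_quiver m) (path_quiver n)"

definition nabla_support :: "nat \<Rightarrow> nat \<Rightarrow> nat \<Rightarrow> (nat \<times> nat \<times> nat) set" where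
  "nabla_support m n i =
     {(\<gamma>, \<mu>, \<nu>). \<gamma> \<in> {1..m + n - 1} \<and> \<mu> \<in> {1..m} \<and> \<nu> \<in> {1..n} \<and>
        (\<mu> \<le> i - 1 \<and> \<gamma> \<le> \<mu> \<or> \<mu> = i \<and> \<gamma> \<le> i + \<nu> - 1 \<or> \<mu> \<ge> i + 1 \<and> \<gamma> \<le> \<mu> + n - 1)}"

definition nabla_bimodule ::
  "('k, 'r) ring_scheme \<Rightarrow> nat \<Rightarrow> nat \<Rightarrow> nat \<Rightarrow> (nat \<times> nat \<times> nat, 'k, 'k) rep" where
  "nabla_bimodule K m n i = standard_rep K (nabla_support m n i)"

definition nabla ::
  "('k, 'r) ring_scheme \<Rightarrow> nat \<Rightarrow> nat \<Rightarrow> nat \<Rightarrow> (nat, 'k, 'u) rep \<Rightarrow>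
   (nat \<times> nat, 'k, (nat \<times> 'u \<times> 'k \<Rightarrow>\<^sub>0 int) set) rep" where
  "nabla K m n i = rep_tensor K (path_quiver (m + n - 1)) (nabla_bimodule K m n i)"

definition nabla_map ::
  "('k, 'r) ring_scheme \<Rightarrow> nat \<Rightarrow> nat \<Rightarrow> nat \<Rightarrow> (nat, 'k, 'u) rep \<Rightarrow> (nat, 'k, 'u) rep \<Rightarrow>
   (nat \<Rightarrow> 'u \<Rightarrow> 'u) \<Rightarrow>
   nat \<times> nat \<Rightarrow> (nat \<times> 'u \<times> 'k \<Rightarrow>\<^sub>0 int) set \<Rightarrow> (nat \<times> 'u \<times> 'k \<Rightarrow>\<^sub>0 int) set" where
  "nabla_map K m n i = rep_tensor_map K (path_quiver (m + n - 1)) (nabla_bimodule K m n i)"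

abbreviation K0_path ::
  "('k, 'r) ring_scheme \<Rightarrow> nat \<Rightarrow> ((nat, 'k, nat \<Rightarrow> 'k) rep \<Rightarrow>\<^sub>0 int) set monoid" where
  "K0_path K n \<equiv> K0 K (path_quiver n)"

abbreviation K0_grid ::
  "('k, 'r) ring_scheme \<Rightarrow> nat \<Rightarrow> nat \<Rightarrow>
   ((nat \<times> nat, 'k, nat \<Rightarrow> 'k) rep \<Rightarrow>\<^sub>0 int) set monoid" where
  "K0_grid K m n \<equiv> K0 K (grid_quiver m n)"

abbreviation simple_path_class ::
  "('k, 'r) ring_scheme \<Rightarrow> nat \<Rightarrow> nat \<Rightarrow> ((nat, 'k, nat \<Rightarrow> 'k) rep \<Rightarrow>\<^sub>0 int) set" where
  "simple_path_class K n j \<equiv> K0_class K (path_quiver n) (standard_rep K {j})"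

abbreviation simple_grid_class ::
  "('k, 'r) ring_scheme \<Rightarrow> nat \<Rightarrow> nat \<Rightarrow> nat \<times> nat \<Rightarrow>
   ((nat \<times> nat, 'k, nat \<Rightarrow> 'k) rep \<Rightarrow>\<^sub>0 int) set" where
  "simple_grid_class K m n v \<equiv> K0_class K (grid_quiver m n) (standard_rep K {v})"

abbreviation nabla_K0 ::
  "('k, 'r) ring_scheme \<Rightarrow> nat \<Rightarrow> nat \<Rightarrow> nat \<Rightarrow>
   ((nat, 'k, nat \<Rightarrow> 'k) rep \<Rightarrow>\<^sub>0 int) set \<Rightarrow> ((nat \<times> nat, 'k, nat \<Rightarrow> 'k) rep \<Rightarrow>\<^sub>0 int) set" where
  "nabla_K0 K m n i \<equiv> K0_map K (grid_quiver m n) (nabla K m n i)"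

text \<open>The identification of \<open>K\<^sup>0(\<A>\<^sub>m) \<otimes> K\<^sup>0(\<A>\<^sub>n)\<close> with \<open>K\<^sup>0(\<A>\<^sub>m\<^sub>,\<^sub>n)\<close>, and the resulting canonical map
  from the tensor product of the duals to the dual of \<open>K\<^sup>0(\<A>\<^sub>m\<^sub>,\<^sub>n)\<close>.\<close>

definition K0_tensor_ident ::
  "('k, 'r) ring_scheme \<Rightarrow> nat \<Rightarrow> nat \<Rightarrow>
   (((nat, 'k, nat \<Rightarrow> 'k) rep \<Rightarrow>\<^sub>0 int) set \<times> ((nat, 'k, nat \<Rightarrow> 'k) rep \<Rightarrow>\<^sub>0 int) set \<Rightarrow>\<^sub>0 int) set \<Rightarrow>
   ((nat \<times> nat, 'k, nat \<Rightarrow> 'k) rep \<Rightarrow>\<^sub>0 int) set" where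
  "K0_tensor_ident K m n =
     (THE h. h \<in> hom (tensor_group (K0_path K m) (K0_path K n)) (K0_grid K m n) \<and>
        h \<in> extensional (carrier (tensor_group (K0_path K m) (K0_path K n))) \<and>
        (\<forall>j\<in>{1..m}. \<forall>k\<in>{1..n}.
           h (tens (K0_path K m) (K0_path K n) (simple_path_class K m j) (simple_path_class K n k)) =
           simple_grid_class K m n (j, k)))"

definition dual_tensor_ident ::
  "('k, 'r) ring_scheme \<Rightarrow> nat \<Rightarrow> nat \<Rightarrow>
   ((((nat, 'k, nat \<Rightarrow> 'k) rep \<Rightarrow>\<^sub>0 int) set \<Rightarrow> int) \<times>
    (((nat, 'k, nat \<Rightarrow> 'k) rep \<Rightarrow>\<^sub>0 int) set \<Rightarrow> int) \<Rightarrow>\<^sub>0 int) set \<Rightarrow>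
   ((nat \<times> nat, 'k, nat \<Rightarrow> 'k) rep \<Rightarrow>\<^sub>0 int) set \<Rightarrow> int" where
  "dual_tensor_ident K m n =
     pres_lift (dual_group (K0_grid K m n))
       (\<lambda>(f, g). \<lambda>z\<in>carrier (K0_grid K m n).
          pres_lift integer_group (\<lambda>(x, y). f x * g y)
            (inv_into (carrier (tensor_group (K0_path K m) (K0_path K n))) (K0_tensor_ident K m n) z))"

definition circ ::
  "('k, 'r) ring_scheme \<Rightarrow> nat \<Rightarrow> nat \<Rightarrow> nat \<Rightarrow>
   ((((nat, 'k, nat \<Rightarrow> 'k) rep \<Rightarrow>\<^sub>0 int) set \<Rightarrow> int) \<times>
    (((nat, 'k, nat \<Rightarrow> 'k) rep \<Rightarrow>\<^sub>0 int) set \<Rightarrow> int) \<Rightarrow>\<^sub>0 int) set \<Rightarrow>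
   ((nat, 'k, nat \<Rightarrow> 'k) rep \<Rightarrow>\<^sub>0 int) set \<Rightarrow> int" where
  "circ K m n i t =
     dual_map (K0_path K (m + n - 1)) (nabla_K0 K m n i) (dual_tensor_ident K m n t)"

definition dual_simple ::
  "('k, 'r) ring_scheme \<Rightarrow> nat \<Rightarrow> nat \<Rightarrow> ((nat, 'k, nat \<Rightarrow> 'k) rep \<Rightarrow>\<^sub>0 int) set \<Rightarrow> int" where
  "dual_simple K n = dual_basis (K0_path K n) (simple_path_class K n) {1..n}"


section \<open>The Diassociative operad\<close>

definition Dias :: "nat \<Rightarrow> (nat \<Rightarrow>\<^sub>0 int) monoid" where
  "Dias n = free_Abelian_group {1..n}"

text \<open>The usual basis of \<open>Dias n\<close> is \<open>frag_of j\<close> for \<open>1 \<le> j \<le> n\<close>.\<close>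

definition Dias_comp_basis :: "nat \<Rightarrow> nat \<Rightarrow> nat \<Rightarrow> nat \<Rightarrow> nat \<Rightarrow>\<^sub>0 int" where
  "Dias_comp_basis n i j k =
     (if i > j then frag_of j else if i = j then frag_of (i + k - 1) else frag_of (j + n - 1))"

definition Dias_comp :: "nat \<Rightarrow> nat \<Rightarrow> nat \<Rightarrow> ((nat \<Rightarrow>\<^sub>0 int) \<times> (nat \<Rightarrow>\<^sub>0 int) \<Rightarrow>\<^sub>0 int) set \<Rightarrow> nat \<Rightarrow>\<^sub>0 int"
  where
  "Dias_comp m n i =
     pres_lift (Dias (m + n - 1))
       (\<lambda>(x, y). lin_ext (Dias (m + n - 1))
          (\<lambda>j. lin_ext (Dias (m + n - 1)) (Dias_comp_basis n i j) y) x)"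

definition Dias_to_dual ::
  "('k, 'r) ring_scheme \<Rightarrow> nat \<Rightarrow> (nat \<Rightarrow>\<^sub>0 int) \<Rightarrow> ((nat, 'k, nat \<Rightarrow> 'k) rep \<Rightarrow>\<^sub>0 int) set \<Rightarrow> int" where
  "Dias_to_dual K n = lin_ext (dual_group (K0_path K n)) (dual_simple K n)"

end

theory Submission
  imports Defs
begin

text \<open>The whole statement rests on one function. For a vertex \<open>w = (\<mu>, \<nu>)\<close> of the grid put \<open>g w = \<mu>\<close> if
\<open>\<mu> < i\<close>, \<open>g w = i + \<nu> - 1\<close> if \<open>\<mu> = i\<close>, and \<open>g w = \<mu> + n - 1\<close> if \<open>\<mu> > i\<close> (\<open>nabla_index\<close>). It is monotone along
arrows, and the support of the bimodule is \<open>{(\<gamma>, w). \<gamma> \<le> g w}\<close>. Hence the column of the bimodule over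
\<open>w\<close> is the projective left module generated at \<open>g w\<close>, and tensoring \<open>X\<close> with it evaluates \<open>X\<close> at \<open>g w\<close>:
the class of \<open>x \<otimes> y\<close> with \<open>x\<close> at the vertex \<open>a\<close> is sent to \<open>y\<close> times the image of \<open>x\<close> along the path
from \<open>a\<close> to \<open>g w\<close>. This bijection (\<open>contract_bij\<close>) is linear and natural in both \<open>w\<close> and \<open>X\<close>, so the
functor is isomorphic to the pullback of representations along \<open>g\<close>. Exactness is then pointwise
(\<open>tensor_exact\<close>), and the dimension of the image of \<open>X\<close> at \<open>w\<close> is the dimension of \<open>X\<close> at \<open>g w\<close>.

On the side of Grothendieck groups, the class of a representation of an acyclic quiver is the sum of
the classes of the simple modules weighted by its dimension vector (\<open>K0_class_dimvec\<close>), because every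
representation can be taken apart vertex by vertex, starting from the last vertex of its support.
Since dimensions are additive, the simple classes form a basis (\<open>Z_basis_K0\<close>). Every identity between
classes thus becomes an identity between dimension vectors. In particular the image of \<open>[S\<^sub>j]\<close> is the
sum of \<open>[S\<^sub>w]\<close> over the fibre of \<open>g\<close> over \<open>j\<close> (\<open>nabla_simple\<close>), and listing this fibre gives the three
cases of the formula.

Dually, the functional dual to \<open>[S\<^sub>(\<^sub>j\<^sub>,\<^sub>k\<^sub>)]\<close> composed with the induced map takes the value 1 on \<open>[S\<^sub>l]\<close>
exactly if \<open>g (j, k) = l\<close>, so that it is the dual basis vector with index \<open>g (j, k)\<close> (\<open>circ_basis\<close>). The
index rule of the diassociative composition is the same function \<open>g\<close>, which identifies the two
compositions on a basis of the tensor product. The remaining work is to see that bases of free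
abelian groups induce bases of their duals and tensor products, so that all the identifications
involved exist and are isomorphisms.\<close>

section \<open>Abelian groups by generators and relations\<close>

text \<open>Summing over a larger set than the support makes it possible to treat two arguments at once.\<close>

lemma lin_ext_superset:
  assumes "comm_group H" "f \<in> S \<rightarrow> carrier H" "finite T" "Poly_Mapping.keys x \<subseteq> T" "T \<subseteq> S"
  shows "lin_ext H f x = finprod H (\<lambda>a. f a [^]\<^bsub>H\<^esub> Poly_Mapping.lookup x a) T"
proof -
  interpret H: comm_group H by fact
  have *: "f a [^]\<^bsub>H\<^esub> k \<in> carrier H" if "a \<in> S" for a and k :: int
    using assms(2) that by auto
  show ?thesis
    unfolding lin_ext_def
    by (rule H.finprod_mono_neutral_cong_left[OF assms(3,4)])
       (use * assms(4,5) in \<open>auto simp: in_keys_iff\<close>)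
qed

lemma lin_ext_hom:
  assumes "comm_group H" "f \<in> S \<rightarrow> carrier H"
  shows "lin_ext H f \<in> hom (free_Abelian_group S) H"
proof (rule homI)
  interpret H: comm_group H by fact
  have *: "f a [^]\<^bsub>H\<^esub> k \<in> carrier H" if "a \<in> S" for a and k :: int
    using assms(2) that by auto
  show "lin_ext H f x \<in> carrier H" if "x \<in> carrier (free_Abelian_group S)" for x
    unfolding lin_ext_def using * that by (intro H.finprod_closed) auto
  fix x y assume x: "x \<in> carrier (free_Abelian_group S)" and y: "y \<in> carrier (free_Abelian_group S)"
  define T where "T = Poly_Mapping.keys x \<union> Poly_Mapping.keys y"
  have T: "finite T" "T \<subseteq> S" using x y by (auto simp: T_def)
  have k: "Poly_Mapping.keys x \<subseteq> T" "Poly_Mapping.keys y \<subseteq> T" "Poly_Mapping.keys (x + y) \<subseteq> T"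
    using keys_add[of x y] by (auto simp: T_def)
  have "lin_ext H f (x + y) = finprod H (\<lambda>a. f a [^]\<^bsub>H\<^esub> Poly_Mapping.lookup (x + y) a) T"
    by (rule lin_ext_superset[OF assms T(1) k(3) T(2)])
  also have "\<dots> = finprod H (\<lambda>a. f a [^]\<^bsub>H\<^esub> Poly_Mapping.lookup x a \<otimes>\<^bsub>H\<^esub> f a [^]\<^bsub>H\<^esub> Poly_Mapping.lookup y a) T"
    by (rule H.finprod_cong') (use * T(2) assms(2) in \<open>auto simp: lookup_add intro!: H.int_pow_mult\<close>)
  also have "\<dots> = lin_ext H f x \<otimes>\<^bsub>H\<^esub> lin_ext H f y"
    unfolding lin_ext_superset[OF assms T(1) k(1) T(2)] lin_ext_superset[OF assms T(1) k(2) T(2)]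
    by (rule H.finprod_multf) (use * T(2) in auto)
  finally show "lin_ext H f (x \<otimes>\<^bsub>free_Abelian_group S\<^esub> y) = lin_ext H f x \<otimes>\<^bsub>H\<^esub> lin_ext H f y"
    by simp
qed

lemma lin_ext_frag_of:
  assumes "comm_group H" "f a \<in> carrier H"
  shows "lin_ext H f (frag_of a) = f a"
proof -
  interpret H: comm_group H by fact
  show ?thesis using assms(2) by (simp add: lin_ext_def H.int_pow_1)
qed

lemma free_hom_diff:
  assumes h: "h \<in> hom (free_Abelian_group S) H" and H: "group H"
    and k: "Poly_Mapping.keys x \<subseteq> S" "Poly_Mapping.keys y \<subseteq> S"
  shows "h (x - y) = h x \<otimes>\<^bsub>H\<^esub> inv\<^bsub>H\<^esub> h y"
proof -
  interpret h: group_hom "free_Abelian_group S" H h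
    by (intro group_hom.intro group_hom_axioms.intro h H group_free_Abelian_group)
  have "h (x \<otimes>\<^bsub>free_Abelian_group S\<^esub> (- y)) = h x \<otimes>\<^bsub>H\<^esub> h (- y)"
    using k by (intro h.hom_mult) auto
  moreover have "h (- y) = inv\<^bsub>H\<^esub> h y"
    using h.hom_inv[of y] k by simp
  ultimately show ?thesis by simp
qed

lemma lin_ext_diff:
  assumes "comm_group H" "f \<in> S \<rightarrow> carrier H" "Poly_Mapping.keys x \<subseteq> S" "Poly_Mapping.keys y \<subseteq> S"
  shows "lin_ext H f (x - y) = lin_ext H f x \<otimes>\<^bsub>H\<^esub> inv\<^bsub>H\<^esub> lin_ext H f y"
  by (rule free_hom_diff[OF lin_ext_hom]) (use assms in \<open>auto simp: comm_group_def\<close>)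

lemma lin_ext_add_rel:
  assumes "comm_group H" "f \<in> S \<rightarrow> carrier H" "{a, b, c} \<subseteq> S" "f a = f b \<otimes>\<^bsub>H\<^esub> f c"
  shows "lin_ext H f (frag_of a - frag_of b - frag_of c) = \<one>\<^bsub>H\<^esub>"
proof -
  interpret H: comm_group H by fact
  have "Poly_Mapping.keys (frag_of a - frag_of b) \<subseteq> S"
    using assms(3) keys_diff[of "frag_of a" "frag_of b"] by auto
  then have "lin_ext H f (frag_of a - frag_of b - frag_of c) = (f a \<otimes>\<^bsub>H\<^esub> inv\<^bsub>H\<^esub> f b) \<otimes>\<^bsub>H\<^esub> inv\<^bsub>H\<^esub> f c"
    using assms(2,3) by (simp add: lin_ext_diff[OF assms(1,2)] lin_ext_frag_of[OF assms(1)] Pi_iff)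
  also have "\<dots> = \<one>\<^bsub>H\<^esub>"
  proof -
    have "f b \<in> carrier H" "f c \<in> carrier H" using assms(2,3) by auto
    then show ?thesis using assms(4)
      by (metis H.comm_inv_char H.inv_closed H.inv_solve_right H.m_closed H.m_comm H.r_inv)
  qed
  finally show ?thesis .
qed

lemma lin_ext_eq_rel:
  assumes "comm_group H" "f \<in> S \<rightarrow> carrier H" "{a, b} \<subseteq> S" "f a = f b"
  shows "lin_ext H f (frag_of a - frag_of b) = \<one>\<^bsub>H\<^esub>"
proof -
  interpret H: comm_group H by fact
  show ?thesis
    using assms(2-4) by (simp add: lin_ext_diff[OF assms(1,2)] lin_ext_frag_of[OF assms(1)] Pi_iff)
qed

lemma free_hom_eq:
  assumes "h \<in> hom (free_Abelian_group S) H" "h' \<in> hom (free_Abelian_group S) H" "group H"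
    and "\<And>s. s \<in> S \<Longrightarrow> h (frag_of s) = h' (frag_of s)" and "Poly_Mapping.keys x \<subseteq> S"
  shows "h x = h' x"
proof -
  interpret h: group_hom "free_Abelian_group S" H h
    by (intro group_hom.intro group_hom_axioms.intro) (use assms in auto)
  interpret h': group_hom "free_Abelian_group S" H h'
    by (intro group_hom.intro group_hom_axioms.intro) (use assms in auto)
  show ?thesis
  proof (rule free_Abelian_group_induct[OF assms(5)])
    show "h 0 = h' 0" using h.hom_one h'.hom_one by simp
  next
    fix x y assume k: "Poly_Mapping.keys x \<subseteq> S" "Poly_Mapping.keys y \<subseteq> S" and e: "h x = h' x" "h y = h' y"
    show "h (x - y) = h' (x - y)"
      by (simp add: e free_hom_diff[OF assms(1,3) k] free_hom_diff[OF assms(2,3) k])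
  qed (use assms in auto)
qed

lemma lin_ext_mult:
  assumes H: "comm_group H" and f: "f \<in> S \<rightarrow> carrier H" and f': "f' \<in> S \<rightarrow> carrier H"
    and x: "Poly_Mapping.keys x \<subseteq> S"
  shows "lin_ext H (\<lambda>a. f a \<otimes>\<^bsub>H\<^esub> f' a) x = lin_ext H f x \<otimes>\<^bsub>H\<^esub> lin_ext H f' x"
proof -
  interpret H: comm_group H by fact
  note c = hom_in_carrier[OF lin_ext_hom[OF H f]] hom_in_carrier[OF lin_ext_hom[OF H f']]
  have ff: "(\<lambda>a. f a \<otimes>\<^bsub>H\<^esub> f' a) \<in> S \<rightarrow> carrier H" using f f' by auto
  show ?thesis
  proof (rule free_hom_eq[OF lin_ext_hom[OF H ff] _ H.is_group _ x])
    show "(\<lambda>x. lin_ext H f x \<otimes>\<^bsub>H\<^esub> lin_ext H f' x) \<in> hom (free_Abelian_group S) H"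
    proof (rule homI)
      fix x y assume xy: "x \<in> carrier (free_Abelian_group S)" "y \<in> carrier (free_Abelian_group S)"
      show "lin_ext H f (x \<otimes>\<^bsub>free_Abelian_group S\<^esub> y) \<otimes>\<^bsub>H\<^esub> lin_ext H f' (x \<otimes>\<^bsub>free_Abelian_group S\<^esub> y) =
          lin_ext H f x \<otimes>\<^bsub>H\<^esub> lin_ext H f' x \<otimes>\<^bsub>H\<^esub> (lin_ext H f y \<otimes>\<^bsub>H\<^esub> lin_ext H f' y)"
        unfolding hom_mult[OF lin_ext_hom[OF H f] xy] hom_mult[OF lin_ext_hom[OF H f'] xy]
        using c[OF xy(1)] c[OF xy(2)] by (simp add: H.m_ac)
    qed (use c in \<open>simp del: carrier_free_Abelian_group_iff\<close>)
    fix s assume "s \<in> S"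
    then show "lin_ext H (\<lambda>a. f a \<otimes>\<^bsub>H\<^esub> f' a) (frag_of s) = lin_ext H f (frag_of s) \<otimes>\<^bsub>H\<^esub> lin_ext H f' (frag_of s)"
      using funcset_mem[OF f] funcset_mem[OF f'] by (simp add: lin_ext_frag_of[OF H])
  qed
qed

lemma lin_ext_sum_frag_of:
  assumes H: "comm_group H" and f: "f \<in> S \<rightarrow> carrier H" and fin: "finite S"
  shows "lin_ext H f (\<Sum>a\<in>S. frag_of a) = finprod H f S"
proof -
  interpret H: comm_group H by fact
  have k: "Poly_Mapping.keys (\<Sum>a\<in>S. frag_of a) \<subseteq> S"
    using keys_sum[of frag_of S] by auto
  have l: "Poly_Mapping.lookup (\<Sum>a\<in>S. frag_of a) b = 1" if "b \<in> S" for b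
    using fin that by (simp add: lookup_sum)
  show ?thesis
    unfolding lin_ext_superset[OF H f fin k order_refl]
    by (rule H.finprod_cong') (use f l in \<open>auto simp: H.int_pow_1 Pi_iff\<close>)
qed

lemma lookup_sum_frag_of:
  assumes "finite S"
  shows "Poly_Mapping.lookup (\<Sum>a\<in>S. frag_of a) b = (if b \<in> S then 1 else 0)"
  using assms by (simp add: lookup_sum)

subsection \<open>Presentations\<close>

lemma rel_normal:
  assumes "R \<subseteq> carrier (free_Abelian_group S)"
  shows "generate (free_Abelian_group S) R \<lhd> free_Abelian_group S"
  by (rule comm_group.subgroup_imp_normal[OF abelian_free_Abelian_group
        group.generate_is_subgroup[OF group_free_Abelian_group assms]])

lemma pres_group_comm:
  assumes "R \<subseteq> carrier (free_Abelian_group S)"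
  shows "comm_group (pres_group S R)"
  unfolding pres_group_def
  by (rule comm_group.abelian_FactGroup[OF abelian_free_Abelian_group
        group.generate_is_subgroup[OF group_free_Abelian_group assms]])

definition pres_proj :: "'a set \<Rightarrow> ('a \<Rightarrow>\<^sub>0 int) set \<Rightarrow> ('a \<Rightarrow>\<^sub>0 int) \<Rightarrow> ('a \<Rightarrow>\<^sub>0 int) set" where
  "pres_proj S R x = generate (free_Abelian_group S) R #>\<^bsub>free_Abelian_group S\<^esub> x"

lemma pres_proj_frag_of: "pres_proj S R (frag_of s) = pres_class S R s"
  by (simp add: pres_proj_def pres_class_def)

lemma pres_proj_hom:
  assumes "R \<subseteq> carrier (free_Abelian_group S)"
  shows "pres_proj S R \<in> hom (free_Abelian_group S) (pres_group S R)"
  unfolding pres_proj_def pres_group_def by (rule normal.r_coset_hom_Mod[OF rel_normal[OF assms]])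

lemma pres_group_carrier:
  "carrier (pres_group S R) = pres_proj S R ` carrier (free_Abelian_group S)"
  unfolding pres_group_def FactGroup_def RCOSETS_def pres_proj_def by auto

lemma pres_class_closed:
  assumes "R \<subseteq> carrier (free_Abelian_group S)" "s \<in> S"
  shows "pres_class S R s \<in> carrier (pres_group S R)"
  using assms(2) by (auto simp: pres_group_carrier simp flip: pres_proj_frag_of)

lemma pres_proj_rel:
  assumes "R \<subseteq> carrier (free_Abelian_group S)" "r \<in> R"
  shows "pres_proj S R r = \<one>\<^bsub>pres_group S R\<^esub>"
proof -
  interpret N: normal "generate (free_Abelian_group S) R" "free_Abelian_group S"
    by (rule rel_normal[OF assms(1)])
  show ?thesis
    unfolding pres_proj_def pres_group_def FactGroup_def
    using generate.incl[OF assms(2)] N.rcos_const by (auto simp: assms)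
qed

text \<open>The relations in this development all have the shape \<open>a = b + c\<close> or \<open>a = b\<close>; this rule and the next
turn them into equations between classes.\<close>

lemma pres_class_add_rel:
  assumes R: "R \<subseteq> carrier (free_Abelian_group S)" and r: "frag_of a - frag_of b - frag_of c \<in> R"
    and S: "{a, b, c} \<subseteq> S"
  shows "pres_class S R a = pres_class S R b \<otimes>\<^bsub>pres_group S R\<^esub> pres_class S R c"
proof -
  interpret P: comm_group "pres_group S R" by (rule pres_group_comm[OF R])
  note h = hom_mult[OF pres_proj_hom[OF R]]
  have k: "Poly_Mapping.keys (frag_of a - frag_of b - frag_of c) \<subseteq> S" using subsetD[OF R r] by simp
  have "pres_proj S R (frag_of a) =
      pres_proj S R ((frag_of a - frag_of b - frag_of c) + (frag_of b + frag_of c))"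
    by (rule arg_cong[where f = "pres_proj S R"]) simp
  also have "\<dots> = pres_proj S R (frag_of a - frag_of b - frag_of c) \<otimes>\<^bsub>pres_group S R\<^esub> pres_proj S R (frag_of b + frag_of c)"
    using h[of "frag_of a - frag_of b - frag_of c" "frag_of b + frag_of c"] k S keys_add[of "frag_of b" "frag_of c"]
    by auto
  also have "pres_proj S R (frag_of b + frag_of c) = pres_class S R b \<otimes>\<^bsub>pres_group S R\<^esub> pres_class S R c"
    using h[of "frag_of b" "frag_of c"] S by (simp add: pres_proj_frag_of)
  finally show ?thesis
    using S pres_class_closed[OF R] by (simp add: pres_proj_rel[OF R r] pres_proj_frag_of)
qed

lemma pres_class_eq_rel:
  assumes R: "R \<subseteq> carrier (free_Abelian_group S)" and r: "frag_of a - frag_of b \<in> R"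
    and S: "{a, b} \<subseteq> S"
  shows "pres_class S R a = pres_class S R b"
proof -
  interpret P: comm_group "pres_group S R" by (rule pres_group_comm[OF R])
  note h = hom_mult[OF pres_proj_hom[OF R]]
  have k: "Poly_Mapping.keys (frag_of a - frag_of b) \<subseteq> S" using subsetD[OF R r] by simp
  have "pres_proj S R (frag_of a) = pres_proj S R ((frag_of a - frag_of b) + frag_of b)" by simp
  also have "\<dots> = pres_proj S R (frag_of a - frag_of b) \<otimes>\<^bsub>pres_group S R\<^esub> pres_proj S R (frag_of b)"
    using h[of "frag_of a - frag_of b" "frag_of b"] k S by auto
  finally show ?thesis
    using S pres_class_closed[OF R] by (simp add: pres_proj_rel[OF R r] pres_proj_frag_of)
qed

lemma pres_hom_eq:
  assumes "R \<subseteq> carrier (free_Abelian_group S)" "group H"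
    and "h \<in> hom (pres_group S R) H" "h' \<in> hom (pres_group S R) H"
    and "\<And>s. s \<in> S \<Longrightarrow> h (pres_class S R s) = h' (pres_class S R s)"
    and "x \<in> carrier (pres_group S R)"
  shows "h x = h' x"
proof -
  obtain u where u: "Poly_Mapping.keys u \<subseteq> S" "x = pres_proj S R u"
    using assms(6) by (auto simp: pres_group_carrier)
  have "(h \<circ> pres_proj S R) u = (h' \<circ> pres_proj S R) u"
    by (rule free_hom_eq[where S = S and H = H])
       (use assms u hom_compose[OF pres_proj_hom[OF assms(1)] assms(3)]
          hom_compose[OF pres_proj_hom[OF assms(1)] assms(4)] in
        \<open>simp_all add: pres_proj_frag_of o_def\<close>)
  then show ?thesis using u by simp
qed

text \<open>Induction on the construction of an element of a presented group, used to prove that a set of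
classes spans.\<close>

lemma pres_subgroup:
  assumes R: "R \<subseteq> carrier (free_Abelian_group S)"
    and T: "subgroup T (pres_group S R)" and c: "\<And>s. s \<in> S \<Longrightarrow> pres_class S R s \<in> T"
    and x: "x \<in> carrier (pres_group S R)"
  shows "x \<in> T"
proof -
  interpret P: comm_group "pres_group S R" by (rule pres_group_comm[OF R])
  interpret T: subgroup T "pres_group S R" by (rule T)
  interpret h: group_hom "free_Abelian_group S" "pres_group S R" "pres_proj S R"
    by (intro group_hom.intro group_hom_axioms.intro pres_proj_hom R) (auto simp: P.is_group)
  obtain u where u: "Poly_Mapping.keys u \<subseteq> S" "x = pres_proj S R u"
    using x by (auto simp: pres_group_carrier)
  have "pres_proj S R u \<in> T"
  proof (rule free_Abelian_group_induct[OF u(1)])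
    show "pres_proj S R 0 \<in> T" using h.hom_one by simp
  next
    fix x y assume k: "Poly_Mapping.keys x \<subseteq> S" "Poly_Mapping.keys y \<subseteq> S"
      and e: "pres_proj S R x \<in> T" "pres_proj S R y \<in> T"
    show "pres_proj S R (x - y) \<in> T"
      using e by (simp add: free_hom_diff[OF pres_proj_hom[OF R] P.is_group k])
  qed (auto simp: pres_proj_frag_of c)
  then show ?thesis using u by simp
qed

text \<open>The kernel of the linear extension is a subgroup containing the relations, hence contains all their
consequences. The extension is therefore constant on each coset, and the image of a coset is the
singleton expected by \<open>the_elem\<close>.\<close>

lemma pres_lift_proj:
  assumes R: "R \<subseteq> carrier (free_Abelian_group S)" and H: "comm_group H" and f: "f \<in> S \<rightarrow> carrier H"
    and r: "\<And>r. r \<in> R \<Longrightarrow> lin_ext H f r = \<one>\<^bsub>H\<^esub>" and x: "Poly_Mapping.keys x \<subseteq> S"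
  shows "pres_lift H f (pres_proj S R x) = lin_ext H f x"
proof -
  interpret H: comm_group H by fact
  interpret h: group_hom "free_Abelian_group S" H "lin_ext H f"
    by (intro group_hom.intro group_hom_axioms.intro lin_ext_hom) (use H f H.is_group in auto)
  have sub: "generate (free_Abelian_group S) R \<subseteq> kernel (free_Abelian_group S) H (lin_ext H f)"
    by (rule h.G.generate_subgroup_incl[OF _ h.subgroup_kernel])
       (use R r in \<open>unfold kernel_def, blast\<close>)
  have one: "0 \<in> generate (free_Abelian_group S) R"
    using generate.one[of "free_Abelian_group S" R] by simp
  have "lin_ext H f ` pres_proj S R x = {lin_ext H f x}"
  proof (intro equalityI subsetI)
    fix y assume "y \<in> lin_ext H f ` pres_proj S R x"
    then obtain g where g: "g \<in> generate (free_Abelian_group S) R"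
      "y = lin_ext H f (g \<otimes>\<^bsub>free_Abelian_group S\<^esub> x)"
      by (auto simp: pres_proj_def r_coset_def)
    have "g \<in> carrier (free_Abelian_group S)" "lin_ext H f g = \<one>\<^bsub>H\<^esub>"
      using sub g(1) by (auto simp: kernel_def)
    then show "y \<in> {lin_ext H f x}"
      using g(2) x h.hom_mult[of g x] h.hom_closed[of x] by auto
  next
    fix y assume "y \<in> {lin_ext H f x}"
    then show "y \<in> lin_ext H f ` pres_proj S R x"
      using one by (force simp: pres_proj_def r_coset_def)
  qed
  then show ?thesis by (simp add: pres_lift_def)
qed

lemma pres_lift_class:
  assumes "R \<subseteq> carrier (free_Abelian_group S)" "comm_group H" "f \<in> S \<rightarrow> carrier H"
    and "\<And>r. r \<in> R \<Longrightarrow> lin_ext H f r = \<one>\<^bsub>H\<^esub>" and "s \<in> S"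
  shows "pres_lift H f (pres_class S R s) = f s"
  using pres_lift_proj[OF assms(1-4), of "frag_of s"] assms(5)
    lin_ext_frag_of[OF assms(2), of f s, OF funcset_mem[OF assms(3,5)]]
  by (simp add: pres_proj_frag_of)

lemma pres_lift_hom:
  assumes "R \<subseteq> carrier (free_Abelian_group S)" "comm_group H" "f \<in> S \<rightarrow> carrier H"
    and "\<And>r. r \<in> R \<Longrightarrow> lin_ext H f r = \<one>\<^bsub>H\<^esub>"
  shows "pres_lift H f \<in> hom (pres_group S R) H"
proof (rule homI)
  note l = pres_lift_proj[OF assms]
  note h = lin_ext_hom[OF assms(2,3)]
  show "pres_lift H f x \<in> carrier H" if "x \<in> carrier (pres_group S R)" for x
    using that hom_in_carrier[OF h] by (auto simp: pres_group_carrier l)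
  fix x y assume "x \<in> carrier (pres_group S R)" "y \<in> carrier (pres_group S R)"
  then obtain u v where uv: "Poly_Mapping.keys u \<subseteq> S" "x = pres_proj S R u"
    "Poly_Mapping.keys v \<subseteq> S" "y = pres_proj S R v"
    by (auto simp: pres_group_carrier)
  then have "x \<otimes>\<^bsub>pres_group S R\<^esub> y = pres_proj S R (u + v)"
    using hom_mult[OF pres_proj_hom[OF assms(1)], of u v] by auto
  moreover have "Poly_Mapping.keys (u + v) \<subseteq> S" using uv keys_add[of u v] by auto
  ultimately show "pres_lift H f (x \<otimes>\<^bsub>pres_group S R\<^esub> y) = pres_lift H f x \<otimes>\<^bsub>H\<^esub> pres_lift H f y"
    using uv hom_mult[OF h, of u v] by (simp add: l)
qed

section \<open>Bases, duals and tensor products\<close>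

lemma integer_group_comm: "comm_group integer_group"
  by (rule group.group_comm_groupI) auto

lemma hom_preimage_subgroup:
  assumes "h \<in> hom G H" "group G" "group H" "subgroup T H"
  shows "subgroup {x \<in> carrier G. h x \<in> T} G"
proof -
  interpret h: group_hom G H h by (intro group_hom.intro group_hom_axioms.intro assms)
  interpret T: subgroup T H by fact
  show ?thesis
    by (rule h.G.subgroupI) (use h.hom_one T.one_closed in \<open>auto\<close>)
qed

lemma lin_ext_image_subgroup:
  assumes "comm_group G" "b \<in> I \<rightarrow> carrier G"
  shows "subgroup (lin_ext G b ` carrier (free_Abelian_group I)) G"
proof -
  interpret h: group_hom "free_Abelian_group I" G "lin_ext G b"
    by (intro group_hom.intro group_hom_axioms.intro lin_ext_hom group_free_Abelian_group assms
          comm_group.axioms(2))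
  show ?thesis by (rule h.img_is_subgroup)
qed

lemma lin_ext_image_basis:
  assumes "comm_group G" "b \<in> I \<rightarrow> carrier G" "i \<in> I"
  shows "b i \<in> lin_ext G b ` carrier (free_Abelian_group I)"
  by (rule image_eqI[of _ _ "frag_of i"])
     (use lin_ext_frag_of[OF assms(1), of b i] assms(2,3) in \<open>auto simp: Pi_iff\<close>)

lemma lookup_hom: "(\<lambda>u. Poly_Mapping.lookup u i) \<in> hom (free_Abelian_group I) integer_group"
  by (rule homI) (auto simp: lookup_add)

lemma hom_lin_ext:
  assumes G: "comm_group G" and H: "comm_group H" and b: "b \<in> I \<rightarrow> carrier G"
    and h: "h \<in> hom G H" and u: "Poly_Mapping.keys u \<subseteq> I"
  shows "h (lin_ext G b u) = lin_ext H (h \<circ> b) u"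
proof -
  have hb: "h \<circ> b \<in> I \<rightarrow> carrier H" using b h by (auto simp: hom_def)
  have "(h \<circ> lin_ext G b) u = lin_ext H (h \<circ> b) u"
  proof (rule free_hom_eq[OF hom_compose[OF lin_ext_hom[OF G b] h] lin_ext_hom[OF H hb] _ _ u])
    show "Group.group H" using H by (simp add: comm_group_def)
    fix s assume "s \<in> I"
    then show "(h \<circ> lin_ext G b) (frag_of s) = lin_ext H (h \<circ> b) (frag_of s)"
      using funcset_mem[OF b] funcset_mem[OF hb] by (simp add: lin_ext_frag_of[OF G] lin_ext_frag_of[OF H, of "h \<circ> b"])
  qed
  then show ?thesis by simp
qed

text \<open>Independence is tested with coordinate functionals: such a functional composed with the linear
extension reads off a coefficient. In a quotient group this is far easier than deciding which
combinations of generators are consequences of the relations.\<close>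

lemma Z_basisI:
  assumes G: "comm_group G" and b: "b \<in> I \<rightarrow> carrier G"
    and span: "carrier G \<subseteq> lin_ext G b ` carrier (free_Abelian_group I)"
    and coord: "\<And>i. i \<in> I \<Longrightarrow> \<exists>c\<in>hom G integer_group. \<forall>j\<in>I. c (b j) = (if j = i then 1 else 0)"
  shows "Z_basis G b I"
proof -
  note h = lin_ext_hom[OF G b]
  have inj: "u = v" if uv: "Poly_Mapping.keys u \<subseteq> I" "Poly_Mapping.keys v \<subseteq> I"
    and e: "lin_ext G b u = lin_ext G b v" for u v
  proof (rule poly_mapping_eqI)
    fix i
    show "Poly_Mapping.lookup u i = Poly_Mapping.lookup v i"
    proof (cases "i \<in> I")
      case False
      then have "i \<notin> Poly_Mapping.keys u" "i \<notin> Poly_Mapping.keys v" using uv by auto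
      then show ?thesis by (simp add: in_keys_iff)
    next
      case True
      then obtain c where c: "c \<in> hom G integer_group" "\<And>j. j \<in> I \<Longrightarrow> c (b j) = (if j = i then 1 else 0)"
        using coord by meson
      have "(c \<circ> lin_ext G b) w = Poly_Mapping.lookup w i" if w: "Poly_Mapping.keys w \<subseteq> I" for w
      proof (rule free_hom_eq[OF hom_compose[OF h c(1)] lookup_hom _ _ w])
        fix s assume "s \<in> I"
        then show "(c \<circ> lin_ext G b) (frag_of s) = Poly_Mapping.lookup (frag_of s) i"
          using funcset_mem[OF b] c(2) by (simp add: lin_ext_frag_of[OF G])
      qed simp
      then show ?thesis using e uv by (metis comp_apply)
    qed
  qed
  have "bij_betw (lin_ext G b) (carrier (free_Abelian_group I)) (carrier G)"
    unfolding bij_betw_def inj_on_def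
  proof (intro conjI ballI impI equalityI)
    show "u = v" if "u \<in> carrier (free_Abelian_group I)" "v \<in> carrier (free_Abelian_group I)"
      "lin_ext G b u = lin_ext G b v" for u v
      using inj that by simp
    show "lin_ext G b ` carrier (free_Abelian_group I) \<subseteq> carrier G"
      using hom_in_carrier[OF h] by blast
  qed (rule span)
  then show ?thesis using h b by (simp add: Z_basis_def iso_def)
qed

lemma Z_basis_span:
  assumes "Z_basis G b I" "x \<in> carrier G"
  obtains u where "Poly_Mapping.keys u \<subseteq> I" "x = lin_ext G b u"
proof -
  have "x \<in> lin_ext G b ` carrier (free_Abelian_group I)"
    using assms by (simp add: Z_basis_def iso_def bij_betw_def)
  then show ?thesis using that by auto
qed

text \<open>A basis generates, in the form of an induction principle.\<close>

lemma Z_basis_subgroup: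
  assumes G: "comm_group G" and b: "Z_basis G b I" and T: "subgroup T G"
    and bT: "\<And>i. i \<in> I \<Longrightarrow> b i \<in> T" and x: "x \<in> carrier G"
  shows "x \<in> T"
proof -
  interpret G: comm_group G by fact
  interpret T: subgroup T G by fact
  obtain u where u: "Poly_Mapping.keys u \<subseteq> I" "x = lin_ext G b u" using Z_basis_span[OF b x] .
  have "lin_ext G b u \<in> T"
  proof (rule free_Abelian_group_induct[OF u(1)])
    have bc: "b \<in> I \<rightarrow> carrier G" using b by (simp add: Z_basis_def)
    show "lin_ext G b 0 \<in> T" by (simp add: lin_ext_def)
    show "lin_ext G b (frag_of i) \<in> T" if "i \<in> I" for i
      using that bT[OF that] funcset_mem[OF bc that] by (simp add: lin_ext_frag_of[OF G])
    show "lin_ext G b (x - y) \<in> T" if "Poly_Mapping.keys x \<subseteq> I" "Poly_Mapping.keys y \<subseteq> I"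
      "lin_ext G b x \<in> T" "lin_ext G b y \<in> T" for x y
      using that by (simp add: lin_ext_diff[OF G bc])
  qed
  then show ?thesis using u by simp
qed

lemma Z_basis_hom_eq:
  assumes G: "comm_group G" and b: "Z_basis G b I" and H: "comm_group H"
    and h: "h \<in> hom G H" "h' \<in> hom G H" and e: "\<And>i. i \<in> I \<Longrightarrow> h (b i) = h' (b i)"
    and x: "x \<in> carrier G"
  shows "h x = h' x"
proof -
  have bc: "b \<in> I \<rightarrow> carrier G" using b by (simp add: Z_basis_def)
  obtain u where u: "Poly_Mapping.keys u \<subseteq> I" "x = lin_ext G b u" using Z_basis_span[OF b x] .
  have hb: "h \<circ> b \<in> I \<rightarrow> carrier H" "h' \<circ> b \<in> I \<rightarrow> carrier H" using bc h by (auto simp: hom_def)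
  have "lin_ext H (h \<circ> b) u = lin_ext H (h' \<circ> b) u"
    by (rule free_hom_eq[OF lin_ext_hom[OF H hb(1)] lin_ext_hom[OF H hb(2)] _ _ u(1)])
       (use H e funcset_mem[OF hb(1)] funcset_mem[OF hb(2)] in
         \<open>auto simp: comm_group_def lin_ext_frag_of[OF H]\<close>)
  then show ?thesis
    using hom_lin_ext[OF G H bc h(1) u(1)] hom_lin_ext[OF G H bc h(2) u(1)] u(2) by simp
qed

lemma Z_basis_hom_exists:
  assumes G: "comm_group G" and b: "Z_basis G b I" and H: "comm_group H" and f: "f \<in> I \<rightarrow> carrier H"
  shows "\<exists>h \<in> hom G H \<inter> extensional (carrier G). \<forall>i\<in>I. h (b i) = f i"
proof -
  have bc: "b \<in> I \<rightarrow> carrier G" and iso: "lin_ext G b \<in> iso (free_Abelian_group I) G"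
    using b by (auto simp: Z_basis_def)
  define r where "r = inv_into (carrier (free_Abelian_group I)) (lin_ext G b)"
  have r: "r \<in> iso G (free_Abelian_group I)"
    unfolding r_def by (rule group.iso_set_sym[OF group_free_Abelian_group iso])
  have rb: "r (b i) = frag_of i" if "i \<in> I" for i
  proof -
    have "lin_ext G b (frag_of i) = b i"
      using that bc by (intro lin_ext_frag_of[OF G]) auto
    moreover have "inj_on (lin_ext G b) (carrier (free_Abelian_group I))"
      using iso by (simp add: iso_def bij_betw_def)
    ultimately show ?thesis using that unfolding r_def by (metis frag_of_in_free_Abelian_group inv_into_f_f)
  qed
  interpret G: comm_group G by fact
  have "lin_ext H f \<circ> r \<in> hom G H"
    by (rule hom_compose[OF _ lin_ext_hom[OF H f]]) (use r in \<open>simp add: iso_def\<close>)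
  then have "restrict (lin_ext H f \<circ> r) (carrier G) \<in> hom G H \<inter> extensional (carrier G)"
    by (auto simp: hom_def)
  moreover have "restrict (lin_ext H f \<circ> r) (carrier G) (b i) = f i" if "i \<in> I" for i
    using that funcset_mem[OF bc that] funcset_mem[OF f that] by (simp add: rb lin_ext_frag_of[OF H])
  ultimately show ?thesis by (intro bexI ballI)
qed

lemma Z_basis_unique_hom:
  assumes G: "comm_group G" and b: "Z_basis G b I" and H: "comm_group H" and f: "f \<in> I \<rightarrow> carrier H"
  shows "\<exists>!h. h \<in> hom G H \<and> h \<in> extensional (carrier G) \<and> (\<forall>i\<in>I. h (b i) = f i)"
proof -
  obtain h where h: "h \<in> hom G H \<inter> extensional (carrier G)" "\<forall>i\<in>I. h (b i) = f i"
    using Z_basis_hom_exists[OF G b H f] by (elim bexE)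
  show ?thesis
  proof (rule ex1I[of _ h])
    show "h \<in> hom G H \<and> h \<in> extensional (carrier G) \<and> (\<forall>i\<in>I. h (b i) = f i)" using h by simp
    fix h' assume h': "h' \<in> hom G H \<and> h' \<in> extensional (carrier G) \<and> (\<forall>i\<in>I. h' (b i) = f i)"
    show "h' = h"
    proof (rule extensionalityI[where A = "carrier G"])
      fix x assume x: "x \<in> carrier G"
      show "h' x = h x"
        by (rule Z_basis_hom_eq[OF G b H _ _ _ x]) (use h h' in auto)
    qed (use h h' in auto)
  qed
qed

text \<open>The inverse is the homomorphism that sends the second basis back to the first; both composites fix
a basis.\<close>

lemma Z_basis_iso:
  assumes G: "comm_group G" and b: "Z_basis G b I" and H: "comm_group H" and c: "Z_basis H c I"
    and h: "h \<in> hom G H" and e: "\<And>i. i \<in> I \<Longrightarrow> h (b i) = c i"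
  shows "h \<in> iso G H"
proof -
  have bc: "b \<in> I \<rightarrow> carrier G" and cc: "c \<in> I \<rightarrow> carrier H"
    using b c by (auto simp: Z_basis_def)
  obtain h' where h': "h' \<in> hom H G" "\<And>i. i \<in> I \<Longrightarrow> h' (c i) = b i"
    using Z_basis_hom_exists[OF H c G bc] by auto
  have id: "(\<lambda>x. x) \<in> hom L L" for L :: "('z, 'y) monoid_scheme" by (simp add: hom_def)
  have 1: "h' (h x) = x" if x: "x \<in> carrier G" for x
  proof -
    have "(h' \<circ> h) x = (\<lambda>x. x) x"
      by (rule Z_basis_hom_eq[OF G b G hom_compose[OF h h'(1)] id _ x]) (simp add: e h'(2))
    then show ?thesis by simp
  qed
  have 2: "h (h' y) = y" if y: "y \<in> carrier H" for y
  proof -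
    have "(h \<circ> h') y = (\<lambda>x. x) y"
      by (rule Z_basis_hom_eq[OF H c H hom_compose[OF h'(1) h] id _ y]) (simp add: e h'(2))
    then show ?thesis by simp
  qed
  have "bij_betw h (carrier G) (carrier H)"
    by (rule bij_betwI[where g = h'])
       (use hom_in_carrier[OF h] hom_in_carrier[OF h'(1)] 1 2 in blast)+
  then show ?thesis using h by (simp add: iso_def)
qed

lemma Z_basis_free: "Z_basis (free_Abelian_group I) frag_of I"
proof (rule Z_basisI[OF abelian_free_Abelian_group])
  show "frag_of \<in> I \<rightarrow> carrier (free_Abelian_group I)" by simp
  show "carrier (free_Abelian_group I) \<subseteq> lin_ext (free_Abelian_group I) frag_of ` carrier (free_Abelian_group I)"
  proof
    fix x assume "x \<in> carrier (free_Abelian_group I)"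
    moreover have "lin_ext (free_Abelian_group I) frag_of x = x" if "Poly_Mapping.keys x \<subseteq> I"
      using free_hom_eq[OF lin_ext_hom[OF abelian_free_Abelian_group, of frag_of I I], of "\<lambda>x. x"] that
      by (simp add: lin_ext_frag_of abelian_free_Abelian_group hom_def)
    ultimately show "x \<in> lin_ext (free_Abelian_group I) frag_of ` carrier (free_Abelian_group I)"
      by (metis carrier_free_Abelian_group_iff image_eqI)
  qed
  fix i assume "i \<in> I"
  show "\<exists>c\<in>hom (free_Abelian_group I) integer_group. \<forall>j\<in>I. c (frag_of j) = (if j = i then 1 else 0)"
    by (rule bexI[OF _ lookup_hom[of i I]]) auto
qed

subsection \<open>Duals\<close>

lemma dual_group_comm:
  assumes G: "comm_group G"
  shows "comm_group (dual_group G)"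
proof -
  interpret G: comm_group G by fact
  have mult: "f \<otimes>\<^bsub>dual_group G\<^esub> g = (\<lambda>x\<in>carrier G. f x + g x)" for f g
    by (simp add: dual_group_def)
  have one: "\<one>\<^bsub>dual_group G\<^esub> = (\<lambda>x\<in>carrier G. 0)" by (simp add: dual_group_def)
  have car: "f \<in> carrier (dual_group G) \<longleftrightarrow>
      f \<in> extensional (carrier G) \<and> (\<forall>x\<in>carrier G. \<forall>y\<in>carrier G. f (x \<otimes>\<^bsub>G\<^esub> y) = f x + f y)" for f
    by (auto simp: dual_group_def hom_def)
  show ?thesis
  proof (rule comm_groupI)
    fix f assume f: "f \<in> carrier (dual_group G)"
    show "\<exists>g\<in>carrier (dual_group G). g \<otimes>\<^bsub>dual_group G\<^esub> f = \<one>\<^bsub>dual_group G\<^esub>"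
      by (rule bexI[of _ "\<lambda>x\<in>carrier G. - f x"]) (use f in \<open>auto simp: car mult one intro!: restrict_ext\<close>)
    show "\<one>\<^bsub>dual_group G\<^esub> \<otimes>\<^bsub>dual_group G\<^esub> f = f"
      using f by (auto simp: car mult one intro!: extensionalityI[where A = "carrier G"])
  qed (auto simp: car mult one intro!: restrict_ext)
qed

lemma dual_groupD:
  "f \<in> carrier (dual_group G) \<Longrightarrow> f \<in> hom G integer_group"
  "f \<in> carrier (dual_group G) \<Longrightarrow> f \<in> extensional (carrier G)"
  by (auto simp: dual_group_def)

text \<open>Evaluation at a basis vector is a coordinate functional for the dual basis.\<close>

lemma dual_eval_hom:
  assumes "x \<in> carrier G"
  shows "(\<lambda>f. f x) \<in> hom (dual_group G) integer_group"
  by (rule homI) (use assms in \<open>auto simp: dual_group_def\<close>)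

lemma dual_eqI:
  assumes "f \<in> carrier (dual_group G)" "g \<in> carrier (dual_group G)" "comm_group G" "Z_basis G b I"
    and "\<And>i. i \<in> I \<Longrightarrow> f (b i) = g (b i)"
  shows "f = g"
proof (rule extensionalityI[where A = "carrier G"])
  fix x assume "x \<in> carrier G"
  then show "f x = g x"
    using Z_basis_hom_eq[OF assms(3,4) integer_group_comm dual_groupD(1)[OF assms(1)]
        dual_groupD(1)[OF assms(2)] assms(5)] by simp
qed (use dual_groupD(2)[OF assms(1)] dual_groupD(2)[OF assms(2)] in auto)

lemma dual_basis_char:
  assumes G: "comm_group G" and b: "Z_basis G b I" and j: "j \<in> I"
  shows "dual_basis G b I j \<in> carrier (dual_group G)"
    and "l \<in> I \<Longrightarrow> dual_basis G b I j (b l) = (if l = j then 1 else 0)"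
proof -
  obtain f where f: "f \<in> hom G integer_group \<inter> extensional (carrier G)"
    "\<forall>l\<in>I. f (b l) = (if l = j then 1 else 0)"
    using Z_basis_hom_exists[OF G b integer_group_comm, of "\<lambda>l. if l = j then 1 else 0"] by auto
  then have f': "f \<in> carrier (dual_group G)" by (simp add: dual_group_def)
  have "dual_basis G b I j = f"
    unfolding dual_basis_def
    by (rule the_equality) (use f f' in \<open>auto intro!: dual_eqI[OF _ _ G b]\<close>)
  then show "dual_basis G b I j \<in> carrier (dual_group G)"
    "l \<in> I \<Longrightarrow> dual_basis G b I j (b l) = (if l = j then 1 else 0)"
    using f f' by auto
qed

text \<open>Finiteness is what makes the dual basis span: a functional \<open>f\<close> is the combination of the dual basis
vectors with the coefficients \<open>f (b i)\<close>.\<close>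

lemma Z_basis_dual:
  assumes G: "comm_group G" and b: "Z_basis G b I" and fin: "finite I"
  shows "Z_basis (dual_group G) (dual_basis G b I) I"
proof (rule Z_basisI[OF dual_group_comm[OF G]])
  note D = dual_group_comm[OF G]
  have bc: "b \<in> I \<rightarrow> carrier G" using b by (auto simp: Z_basis_def)
  show e: "dual_basis G b I \<in> I \<rightarrow> carrier (dual_group G)" using dual_basis_char(1)[OF G b] by auto
  show "carrier (dual_group G) \<subseteq> lin_ext (dual_group G) (dual_basis G b I) ` carrier (free_Abelian_group I)"
  proof
    fix f assume f: "f \<in> carrier (dual_group G)"
    define u where "u = (\<Sum>i\<in>I. frag_cmul (f (b i)) (frag_of i))"
    have u: "u \<in> carrier (free_Abelian_group I)"
      unfolding u_def
      by (rule sum_closed_free_Abelian_group) (auto dest!: subsetD[OF keys_cmul])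
    have lu: "Poly_Mapping.lookup u j = f (b j)" if "j \<in> I" for j
      unfolding u_def using that fin by (simp add: lookup_sum if_distrib cong: if_cong)
    have "lin_ext (dual_group G) (dual_basis G b I) u = f"
    proof (rule dual_eqI[OF hom_in_carrier[OF lin_ext_hom[OF D e] u] f G b])
      fix j assume j: "j \<in> I"
      have "((\<lambda>f. f (b j)) \<circ> lin_ext (dual_group G) (dual_basis G b I)) u = Poly_Mapping.lookup u j"
      proof (rule free_hom_eq[OF hom_compose[OF lin_ext_hom[OF D e] dual_eval_hom] lookup_hom])
        show "b j \<in> carrier G" using j bc by auto
        fix s assume s: "s \<in> I"
        show "((\<lambda>f. f (b j)) \<circ> lin_ext (dual_group G) (dual_basis G b I)) (frag_of s) =
          Poly_Mapping.lookup (frag_of s) j"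
          using s j by (simp add: lin_ext_frag_of[OF D] dual_basis_char[OF G b])
      qed (use u in auto)
      then show "lin_ext (dual_group G) (dual_basis G b I) u (b j) = f (b j)" using lu[OF j] by simp
    qed
    then show "f \<in> lin_ext (dual_group G) (dual_basis G b I) ` carrier (free_Abelian_group I)"
      using u by auto
  qed
  fix i assume i: "i \<in> I"
  show "\<exists>c\<in>hom (dual_group G) integer_group. \<forall>j\<in>I. c (dual_basis G b I j) = (if j = i then 1 else 0)"
    by (rule bexI[OF _ dual_eval_hom[of "b i"]])
       (use i bc in \<open>auto simp: dual_basis_char[OF G b]\<close>)
qed

lemma dual_basis_lin_ext:
  assumes G: "comm_group G" and b: "Z_basis G b I" and j: "j \<in> I" and u: "Poly_Mapping.keys u \<subseteq> I"
  shows "dual_basis G b I j (lin_ext G b u) = Poly_Mapping.lookup u j"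
proof -
  have bc: "b \<in> I \<rightarrow> carrier G" using b by (simp add: Z_basis_def)
  have "(dual_basis G b I j \<circ> lin_ext G b) u = Poly_Mapping.lookup u j"
  proof (rule free_hom_eq[OF hom_compose[OF lin_ext_hom[OF G bc] dual_groupD(1)[OF dual_basis_char(1)[OF G b j]]]
        lookup_hom _ _ u])
    fix s assume s: "s \<in> I"
    show "(dual_basis G b I j \<circ> lin_ext G b) (frag_of s) = Poly_Mapping.lookup (frag_of s) j"
      using dual_basis_char(2)[OF G b j s] lin_ext_frag_of[OF G, of b s] funcset_mem[OF bc s]
      by simp
  qed simp
  then show ?thesis by simp
qed

lemma dual_map_hom:
  assumes "group G" "\<phi> \<in> hom G H"
  shows "dual_map G \<phi> \<in> hom (dual_group H) (dual_group G)"
proof -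
  interpret G: Group.group G by fact
  show ?thesis
  proof (rule homI)
    fix f assume f: "f \<in> carrier (dual_group H)"
    have "f \<circ> \<phi> \<in> hom G integer_group" by (rule hom_compose[OF assms(2) dual_groupD(1)[OF f]])
    then show "dual_map G \<phi> f \<in> carrier (dual_group G)"
      by (auto simp: dual_map_def dual_group_def hom_def)
  next
    fix f g
    show "dual_map G \<phi> (f \<otimes>\<^bsub>dual_group H\<^esub> g) = dual_map G \<phi> f \<otimes>\<^bsub>dual_group G\<^esub> dual_map G \<phi> g"
      using hom_in_carrier[OF assms(2)] by (auto simp: dual_map_def dual_group_def intro!: restrict_ext)
  qed
qed

subsection \<open>Tensor products\<close>

text \<open>Stated with homomorphisms in each argument, so that composition lemmas for homomorphisms apply.\<close>

definition biadditive ::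
  "('a, 'c) monoid_scheme \<Rightarrow> ('b, 'd) monoid_scheme \<Rightarrow> ('e, 'f) monoid_scheme \<Rightarrow> ('a \<times> 'b \<Rightarrow> 'e) \<Rightarrow> bool" where
  "biadditive G H L f \<longleftrightarrow>
     (\<forall>y\<in>carrier H. (\<lambda>x. f (x, y)) \<in> hom G L) \<and> (\<forall>x\<in>carrier G. (\<lambda>y. f (x, y)) \<in> hom H L)"

lemma tensor_rels_carrier:
  assumes "comm_group G" "comm_group H"
  shows "tensor_rels G H \<subseteq> carrier (free_Abelian_group (carrier G \<times> carrier H))"
proof -
  interpret G: comm_group G by fact
  interpret H: comm_group H by fact
  have *: "Poly_Mapping.keys (frag_of a - frag_of b - frag_of c) \<subseteq> {a, b, c}" for a b c
    using keys_diff[of "frag_of a - frag_of b" "frag_of c"] keys_diff[of "frag_of a" "frag_of b"] by auto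
  show ?thesis
  proof
    fix r assume "r \<in> tensor_rels G H"
    then obtain a b c where "r = frag_of a - frag_of b - frag_of c"
      and "{a, b, c} \<subseteq> carrier G \<times> carrier H"
      unfolding tensor_rels_def by fastforce
    then show "r \<in> carrier (free_Abelian_group (carrier G \<times> carrier H))"
      using order_trans[OF *[of a b c]] by (simp only: carrier_free_Abelian_group_iff)
  qed
qed

lemma tensor_group_comm:
  assumes "comm_group G" "comm_group H"
  shows "comm_group (tensor_group G H)"
  unfolding tensor_group_def by (rule pres_group_comm[OF tensor_rels_carrier[OF assms]])

lemma tens_biadditive:
  assumes "comm_group G" "comm_group H"
  shows "biadditive G H (tensor_group G H) (\<lambda>(x, y). tens G H x y)"
proof -
  interpret G: comm_group G by fact
  interpret H: comm_group H by fact
  note R = tensor_rels_carrier[OF assms]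
  have r1: "frag_of (x \<otimes>\<^bsub>G\<^esub> x', y) - frag_of (x, y) - frag_of (x', y) \<in> tensor_rels G H"
    if "x \<in> carrier G" "x' \<in> carrier G" "y \<in> carrier H" for x x' y
    unfolding tensor_rels_def by (rule UnI1) (use that in blast)
  have r2: "frag_of (x, y \<otimes>\<^bsub>H\<^esub> y') - frag_of (x, y) - frag_of (x, y') \<in> tensor_rels G H"
    if "x \<in> carrier G" "y \<in> carrier H" "y' \<in> carrier H" for x y y'
    unfolding tensor_rels_def by (rule UnI2) (use that in blast)
  show ?thesis
    unfolding biadditive_def split_conv tens_def tensor_group_def
    by (intro conjI ballI homI pres_class_closed[OF R] pres_class_add_rel[OF R] r1 r2) auto
qed

lemma tensor_lift:
  assumes G: "comm_group G" and H: "comm_group H" and L: "comm_group L" and f: "biadditive G H L f"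
  shows "pres_lift L f \<in> hom (tensor_group G H) L"
    and "x \<in> carrier G \<Longrightarrow> y \<in> carrier H \<Longrightarrow> pres_lift L f (tens G H x y) = f (x, y)"
proof -
  interpret G: comm_group G by fact
  interpret H: comm_group H by fact
  have fc: "f \<in> carrier G \<times> carrier H \<rightarrow> carrier L"
    using f by (auto simp: biadditive_def hom_def)
  have f1: "f (x \<otimes>\<^bsub>G\<^esub> x', y) = f (x, y) \<otimes>\<^bsub>L\<^esub> f (x', y)"
    if "x \<in> carrier G" "x' \<in> carrier G" "y \<in> carrier H" for x x' y
    using f that by (simp add: biadditive_def hom_def)
  have f2: "f (x, y \<otimes>\<^bsub>H\<^esub> y') = f (x, y) \<otimes>\<^bsub>L\<^esub> f (x, y')"
    if "x \<in> carrier G" "y \<in> carrier H" "y' \<in> carrier H" for x y y'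
    using f that by (simp add: biadditive_def hom_def)
  have r: "lin_ext L f r = \<one>\<^bsub>L\<^esub>" if "r \<in> tensor_rels G H" for r
    using that unfolding tensor_rels_def
    by (elim UnE; clarify; intro lin_ext_add_rel[OF L fc]) (simp_all add: f1 f2)
  note R = tensor_rels_carrier[OF G H]
  show "pres_lift L f \<in> hom (tensor_group G H) L"
    unfolding tensor_group_def by (rule pres_lift_hom[OF R L fc r])
  show "x \<in> carrier G \<Longrightarrow> y \<in> carrier H \<Longrightarrow> pres_lift L f (tens G H x y) = f (x, y)"
    unfolding tens_def by (rule pres_lift_class[OF R L fc r]) auto
qed

text \<open>Spanning is proved in one argument at a time: for fixed \<open>b i\<close> the \<open>y\<close> with \<open>b i \<otimes> y\<close> in the span form a
subgroup containing every \<open>c j\<close>, and then the same is done for the first argument. The coordinates are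
products of coordinates of the factors.\<close>

lemma Z_basis_tensor:
  assumes G: "comm_group G" and b: "Z_basis G b I" and H: "comm_group H" and c: "Z_basis H c J"
  shows "Z_basis (tensor_group G H) (\<lambda>(i, j). tens G H (b i) (c j)) (I \<times> J)"
proof (rule Z_basisI[OF tensor_group_comm[OF G H]])
  let ?T = "tensor_group G H" and ?bc = "\<lambda>(i, j). tens G H (b i) (c j)"
  note T = tensor_group_comm[OF G H]
  interpret G: comm_group G by fact
  interpret H: comm_group H by fact
  interpret T: comm_group ?T by fact
  have bc: "b \<in> I \<rightarrow> carrier G" "c \<in> J \<rightarrow> carrier H" using b c by (auto simp: Z_basis_def)
  have bi1: "(\<lambda>x. tens G H x y) \<in> hom G ?T" if "y \<in> carrier H" for y
    using tens_biadditive[OF G H] that by (simp add: biadditive_def)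
  have bi2: "(\<lambda>y. tens G H x y) \<in> hom H ?T" if "x \<in> carrier G" for x
    using tens_biadditive[OF G H] that by (simp add: biadditive_def)
  have tc: "tens G H x y \<in> carrier ?T" if "x \<in> carrier G" "y \<in> carrier H" for x y
    using hom_in_carrier[OF bi1] that by simp
  show e: "?bc \<in> I \<times> J \<rightarrow> carrier ?T"
    using tc bc by auto
  define Im where "Im = lin_ext ?T ?bc ` carrier (free_Abelian_group (I \<times> J))"
  have Im: "subgroup Im ?T" unfolding Im_def by (rule lin_ext_image_subgroup[OF T e])
  have 1: "tens G H (b i) (c j) \<in> Im" if "i \<in> I" "j \<in> J" for i j
  proof -
    have "(i, j) \<in> I \<times> J" using that by simp
    from lin_ext_image_basis[OF T e this] show ?thesis by (simp add: Im_def)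
  qed
  have 2: "tens G H (b i) y \<in> Im" if i: "i \<in> I" and y: "y \<in> carrier H" for i y
  proof -
    have bi: "b i \<in> carrier G" using bc i by auto
    have "subgroup {y \<in> carrier H. tens G H (b i) y \<in> Im} H"
      by (rule hom_preimage_subgroup[OF bi2[OF bi] H.is_group T.is_group Im])
    then have "y \<in> {y \<in> carrier H. tens G H (b i) y \<in> Im}"
      by (rule Z_basis_subgroup[OF H c]) (use 1 i y bc in auto)
    then show ?thesis by simp
  qed
  have 3: "tens G H x y \<in> Im" if x: "x \<in> carrier G" and y: "y \<in> carrier H" for x y
  proof -
    have "subgroup {x \<in> carrier G. tens G H x y \<in> Im} G"
      by (rule hom_preimage_subgroup[OF bi1[OF y] G.is_group T.is_group Im])
    then have "x \<in> {x \<in> carrier G. tens G H x y \<in> Im}"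
      by (rule Z_basis_subgroup[OF G b]) (use 2 x y bc in auto)
    then show ?thesis by simp
  qed
  show "carrier ?T \<subseteq> lin_ext ?T ?bc ` carrier (free_Abelian_group (I \<times> J))"
  proof
    fix t assume t: "t \<in> carrier ?T"
    have "t \<in> Im"
      by (rule pres_subgroup[OF tensor_rels_carrier[OF G H]])
         (use Im t 3 in \<open>auto simp: tensor_group_def tens_def\<close>)
    then show "t \<in> lin_ext ?T ?bc ` carrier (free_Abelian_group (I \<times> J))" by (simp add: Im_def)
  qed
  fix p assume "p \<in> I \<times> J"
  then obtain i j where p: "p = (i, j)" "i \<in> I" "j \<in> J" by auto
  obtain f where f: "f \<in> hom G integer_group" "\<And>l. l \<in> I \<Longrightarrow> f (b l) = (if l = i then 1 else 0)"
    using Z_basis_hom_exists[OF G b integer_group_comm, of "\<lambda>l. if l = i then 1 else 0"] by auto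
  obtain g where g: "g \<in> hom H integer_group" "\<And>l. l \<in> J \<Longrightarrow> g (c l) = (if l = j then 1 else 0)"
    using Z_basis_hom_exists[OF H c integer_group_comm, of "\<lambda>l. if l = j then 1 else 0"] by auto
  have fg: "biadditive G H integer_group (\<lambda>(x, y). f x * g y)"
    using f(1) g(1) by (auto simp: biadditive_def hom_def algebra_simps)
  show "\<exists>c\<in>hom ?T integer_group. \<forall>q\<in>I \<times> J. c (?bc q) = (if q = p then 1 else 0)"
    by (rule bexI[OF _ tensor_lift(1)[OF G H integer_group_comm fg]])
       (use f(2) g(2) p bc in \<open>auto simp: tensor_lift(2)[OF G H integer_group_comm fg] Pi_iff\<close>)
qed

lemma tensor_group_map_hom:
  assumes G: "comm_group G" and H: "comm_group H" and G': "comm_group G'" and H': "comm_group H'"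
    and f: "f \<in> hom G G'" and h: "h \<in> hom H H'"
  shows "tensor_group_map G' H' f h \<in> hom (tensor_group G H) (tensor_group G' H')"
    and "x \<in> carrier G \<Longrightarrow> y \<in> carrier H \<Longrightarrow>
      tensor_group_map G' H' f h (tens G H x y) = tens G' H' (f x) (h y)"
proof -
  note bi = tens_biadditive[OF G' H', unfolded biadditive_def split_conv]
  have 1: "(\<lambda>x. tens G' H' (f x) (h y)) \<in> hom G (tensor_group G' H')" if "y \<in> carrier H" for y
    using hom_compose[OF f bspec[OF conjunct1[OF bi] hom_in_carrier[OF h that]]] by (simp add: o_def)
  have 2: "(\<lambda>y. tens G' H' (f x) (h y)) \<in> hom H (tensor_group G' H')" if "x \<in> carrier G" for x
    using hom_compose[OF h bspec[OF conjunct2[OF bi] hom_in_carrier[OF f that]]] by (simp add: o_def)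
  have "biadditive G H (tensor_group G' H') (\<lambda>(x, y). tens G' H' (f x) (h y))"
    using 1 2 by (simp add: biadditive_def)
  note L = tensor_lift[OF G H tensor_group_comm[OF G' H'] this, folded tensor_group_map_def]
  show "tensor_group_map G' H' f h \<in> hom (tensor_group G H) (tensor_group G' H')" by (rule L(1))
  show "x \<in> carrier G \<Longrightarrow> y \<in> carrier H \<Longrightarrow>
      tensor_group_map G' H' f h (tens G H x y) = tens G' H' (f x) (h y)" using L(2)[of x y] by simp
qed

text \<open>The map in question sends \<open>f \<otimes> g\<close> to the functional with value \<open>f (b i) * g (c j)\<close> on \<open>d (i, j)\<close>. A
functional is determined by its values on a basis, so that biadditivity, and the effect on dual
bases, follow from this formula without further reference to the inverse of \<open>t\<close>.\<close>

lemma dual_tensor_iso: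
  assumes G: "comm_group G" and b: "Z_basis G b I" and finI: "finite I"
    and H: "comm_group H" and c: "Z_basis H c J" and finJ: "finite J"
    and L: "comm_group L" and d: "Z_basis L d (I \<times> J)"
    and t: "t \<in> iso (tensor_group G H) L"
    and td: "\<And>i j. i \<in> I \<Longrightarrow> j \<in> J \<Longrightarrow> t (tens G H (b i) (c j)) = d (i, j)"
  defines "D \<equiv> pres_lift (dual_group L) (\<lambda>(f, g). \<lambda>z\<in>carrier L.
      pres_lift integer_group (\<lambda>(x, y). f x * g y) (inv_into (carrier (tensor_group G H)) t z))"
  shows "D \<in> iso (tensor_group (dual_group G) (dual_group H)) (dual_group L)"
    and "i \<in> I \<Longrightarrow> j \<in> J \<Longrightarrow>
      D (tens (dual_group G) (dual_group H) (dual_basis G b I i) (dual_basis H c J j)) =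
      dual_basis L d (I \<times> J) (i, j)"
proof -
  let ?T = "tensor_group G H"
  let ?F = "\<lambda>(f, g). \<lambda>z\<in>carrier L. pres_lift integer_group (\<lambda>(x, y). f x * g y) (inv_into (carrier ?T) t z)"
  note T = tensor_group_comm[OF G H]
  note dG = dual_group_comm[OF G] and dH = dual_group_comm[OF H] and dL = dual_group_comm[OF L]
  interpret L: comm_group L by (rule L)
  have bc: "b i \<in> carrier G" if "i \<in> I" for i using b that by (auto simp: Z_basis_def)
  have cc: "c j \<in> carrier H" if "j \<in> J" for j using c that by (auto simp: Z_basis_def)
  have dc: "d p \<in> carrier L" if "p \<in> I \<times> J" for p using d that by (auto simp: Z_basis_def)
  have tc: "tens G H (b i) (c j) \<in> carrier ?T" if "i \<in> I" "j \<in> J" for i j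
  proof -
    have "(\<lambda>(i, j). tens G H (b i) (c j)) \<in> I \<times> J \<rightarrow> carrier ?T"
      using Z_basis_tensor[OF G b H c] by (simp add: Z_basis_def)
    from funcset_mem[OF this, of "(i, j)"] show ?thesis using that by simp
  qed
  have r: "inv_into (carrier ?T) t \<in> hom L ?T"
    using group.iso_set_sym[OF comm_group.axioms(2)[OF T] t] by (simp add: iso_def)
  have rd: "inv_into (carrier ?T) t (d (i, j)) = tens G H (b i) (c j)" if "i \<in> I" "j \<in> J" for i j
    using inv_into_f_f[OF _ tc[OF that], of t] t td[OF that] by (simp add: iso_def bij_betw_def)
  have bi: "biadditive G H integer_group (\<lambda>(x, y). f x * g y)"
    if "f \<in> carrier (dual_group G)" "g \<in> carrier (dual_group H)" for f g
    using dual_groupD(1)[OF that(1)] dual_groupD(1)[OF that(2)]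
    by (simp add: biadditive_def hom_def algebra_simps)
  have Fc: "?F (f, g) \<in> carrier (dual_group L)"
    if fg: "f \<in> carrier (dual_group G)" "g \<in> carrier (dual_group H)" for f g
  proof -
    have "pres_lift integer_group (\<lambda>(x, y). f x * g y) \<circ> inv_into (carrier ?T) t \<in> hom L integer_group"
      by (rule hom_compose[OF r tensor_lift(1)[OF G H integer_group_comm bi[OF fg]]])
    then show ?thesis by (simp add: dual_group_def hom_def)
  qed
  have Fv: "?F (f, g) (d (i, j)) = f (b i) * g (c j)"
    if "f \<in> carrier (dual_group G)" "g \<in> carrier (dual_group H)" "i \<in> I" "j \<in> J" for f g i j
    using tensor_lift(2)[OF G H integer_group_comm bi[OF that(1,2)] bc[OF that(3)] cc[OF that(4)]]
      dc[of "(i, j)"] that by (simp add: rd)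
  have mult: "(f \<otimes>\<^bsub>dual_group A\<^esub> g) x = f x + g x" if "x \<in> carrier A"
    for f g x and A :: "('z, 'y) monoid_scheme" using that by (simp add: dual_group_def)
  have biF: "biadditive (dual_group G) (dual_group H) (dual_group L) ?F"
    unfolding biadditive_def
  proof (intro conjI ballI homI Fc)
    fix g f f' assume g: "g \<in> carrier (dual_group H)" and f: "f \<in> carrier (dual_group G)" "f' \<in> carrier (dual_group G)"
    interpret dG: comm_group "dual_group G" by (rule dG)
    interpret dL: comm_group "dual_group L" by (rule dL)
    show "?F (f \<otimes>\<^bsub>dual_group G\<^esub> f', g) = ?F (f, g) \<otimes>\<^bsub>dual_group L\<^esub> ?F (f', g)"
    proof (rule dual_eqI[OF Fc[OF dG.m_closed[OF f] g] dL.m_closed[OF Fc[OF f(1) g] Fc[OF f(2) g]] L d])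
      fix p assume "p \<in> I \<times> J"
      then obtain i j where p: "p = (i, j)" "i \<in> I" "j \<in> J" by auto
      show "?F (f \<otimes>\<^bsub>dual_group G\<^esub> f', g) (d p) = (?F (f, g) \<otimes>\<^bsub>dual_group L\<^esub> ?F (f', g)) (d p)"
        using Fv[OF dG.m_closed[OF f] g p(2,3)] Fv[OF f(1) g p(2,3)] Fv[OF f(2) g p(2,3)]
          mult[OF dc, of p] mult[OF bc[OF p(2)], of f f'] p by (simp add: distrib_right)
    qed
  next
    fix f g g' assume f: "f \<in> carrier (dual_group G)" and g: "g \<in> carrier (dual_group H)" "g' \<in> carrier (dual_group H)"
    interpret dH: comm_group "dual_group H" by (rule dH)
    interpret dL: comm_group "dual_group L" by (rule dL)
    show "?F (f, g \<otimes>\<^bsub>dual_group H\<^esub> g') = ?F (f, g) \<otimes>\<^bsub>dual_group L\<^esub> ?F (f, g')"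
    proof (rule dual_eqI[OF Fc[OF f dH.m_closed[OF g]] dL.m_closed[OF Fc[OF f g(1)] Fc[OF f g(2)]] L d])
      fix p assume "p \<in> I \<times> J"
      then obtain i j where p: "p = (i, j)" "i \<in> I" "j \<in> J" by auto
      show "?F (f, g \<otimes>\<^bsub>dual_group H\<^esub> g') (d p) = (?F (f, g) \<otimes>\<^bsub>dual_group L\<^esub> ?F (f, g')) (d p)"
        using Fv[OF f dH.m_closed[OF g] p(2,3)] Fv[OF f g(1) p(2,3)] Fv[OF f g(2) p(2,3)]
          mult[OF dc, of p] mult[OF cc[OF p(3)], of g g'] p by (simp add: distrib_left)
    qed
  qed
  note Dl = tensor_lift[OF dG dH dL biF, folded D_def]
  have De: "D (tens (dual_group G) (dual_group H) (dual_basis G b I i) (dual_basis H c J j)) =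
      dual_basis L d (I \<times> J) (i, j)" if ij: "i \<in> I" "j \<in> J" for i j
  proof -
    note e = dual_basis_char(1)[OF G b ij(1)] and e' = dual_basis_char(1)[OF H c ij(2)]
    have p: "(i, j) \<in> I \<times> J" using ij by simp
    have "?F (dual_basis G b I i, dual_basis H c J j) = dual_basis L d (I \<times> J) (i, j)"
    proof (rule dual_eqI[OF Fc[OF e e'] dual_basis_char(1)[OF L d p] L d])
      fix q assume q: "q \<in> I \<times> J"
      then obtain k l where kl: "q = (k, l)" "k \<in> I" "l \<in> J" by auto
      show "?F (dual_basis G b I i, dual_basis H c J j) (d q) = dual_basis L d (I \<times> J) (i, j) (d q)"
        using Fv[OF e e' kl(2,3)] dual_basis_char(2)[OF G b ij(1) kl(2)] dual_basis_char(2)[OF H c ij(2) kl(3)]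
          dual_basis_char(2)[OF L d p q] kl(1) by simp
    qed
    then show ?thesis using Dl(2)[OF e e'] by simp
  qed
  show "i \<in> I \<Longrightarrow> j \<in> J \<Longrightarrow>
      D (tens (dual_group G) (dual_group H) (dual_basis G b I i) (dual_basis H c J j)) =
      dual_basis L d (I \<times> J) (i, j)" by (rule De)
  show "D \<in> iso (tensor_group (dual_group G) (dual_group H)) (dual_group L)"
    by (rule Z_basis_iso[OF tensor_group_comm[OF dG dH]
          Z_basis_tensor[OF dG Z_basis_dual[OF G b finI] dH Z_basis_dual[OF H c finJ]] dL
          Z_basis_dual[OF L d finite_cartesian_product[OF finI finJ]] Dl(1)])
       (use De in auto)
qed

section \<open>Finite-dimensional vector spaces\<close>

lemma vectorspaceD:
  assumes "vectorspace K V"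
  shows "abelian_group V" "\<zero>\<^bsub>V\<^esub> \<in> carrier V"
    "x \<in> carrier V \<Longrightarrow> y \<in> carrier V \<Longrightarrow> x \<oplus>\<^bsub>V\<^esub> y \<in> carrier V"
    "c \<in> carrier K \<Longrightarrow> x \<in> carrier V \<Longrightarrow> c \<odot>\<^bsub>V\<^esub> x \<in> carrier V"
proof -
  interpret vectorspace K V by fact
  show "abelian_group V" by (rule abelian_group_axioms)
  show "\<zero>\<^bsub>V\<^esub> \<in> carrier V"
    "x \<in> carrier V \<Longrightarrow> y \<in> carrier V \<Longrightarrow> x \<oplus>\<^bsub>V\<^esub> y \<in> carrier V"
    "c \<in> carrier K \<Longrightarrow> x \<in> carrier V \<Longrightarrow> c \<odot>\<^bsub>V\<^esub> x \<in> carrier V"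
    by auto
qed

lemma vectorspace_zero:
  assumes "vectorspace K V"
  shows "\<zero>\<^bsub>V\<^esub> \<oplus>\<^bsub>V\<^esub> \<zero>\<^bsub>V\<^esub> = \<zero>\<^bsub>V\<^esub>" "c \<in> carrier K \<Longrightarrow> c \<odot>\<^bsub>V\<^esub> \<zero>\<^bsub>V\<^esub> = \<zero>\<^bsub>V\<^esub>"
proof -
  interpret vectorspace K V by fact
  show "\<zero>\<^bsub>V\<^esub> \<oplus>\<^bsub>V\<^esub> \<zero>\<^bsub>V\<^esub> = \<zero>\<^bsub>V\<^esub>" "c \<in> carrier K \<Longrightarrow> c \<odot>\<^bsub>V\<^esub> \<zero>\<^bsub>V\<^esub> = \<zero>\<^bsub>V\<^esub>" by auto
qed

lemma vectorspace_smult: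
  assumes "vectorspace K V"
  shows "c \<in> carrier K \<Longrightarrow> x \<in> carrier V \<Longrightarrow> y \<in> carrier V \<Longrightarrow>
      c \<odot>\<^bsub>V\<^esub> (x \<oplus>\<^bsub>V\<^esub> y) = c \<odot>\<^bsub>V\<^esub> x \<oplus>\<^bsub>V\<^esub> c \<odot>\<^bsub>V\<^esub> y"
    and "c \<in> carrier K \<Longrightarrow> k \<in> carrier K \<Longrightarrow> x \<in> carrier V \<Longrightarrow>
      c \<odot>\<^bsub>V\<^esub> (k \<odot>\<^bsub>V\<^esub> x) = k \<odot>\<^bsub>V\<^esub> (c \<odot>\<^bsub>V\<^esub> x)"
    and "c \<in> carrier K \<Longrightarrow> k \<in> carrier K \<Longrightarrow> x \<in> carrier V \<Longrightarrow>
      (c \<otimes>\<^bsub>K\<^esub> k) \<odot>\<^bsub>V\<^esub> x = c \<odot>\<^bsub>V\<^esub> (k \<odot>\<^bsub>V\<^esub> x)"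
    and "c \<in> carrier K \<Longrightarrow> k \<in> carrier K \<Longrightarrow> x \<in> carrier V \<Longrightarrow>
      (c \<oplus>\<^bsub>K\<^esub> k) \<odot>\<^bsub>V\<^esub> x = c \<odot>\<^bsub>V\<^esub> x \<oplus>\<^bsub>V\<^esub> k \<odot>\<^bsub>V\<^esub> x"
    and "x \<in> carrier V \<Longrightarrow> \<one>\<^bsub>K\<^esub> \<odot>\<^bsub>V\<^esub> x = x"
    and "x \<in> carrier V \<Longrightarrow> \<zero>\<^bsub>K\<^esub> \<odot>\<^bsub>V\<^esub> x = \<zero>\<^bsub>V\<^esub>"
proof -
  interpret V: vectorspace K V by fact
  show "c \<in> carrier K \<Longrightarrow> x \<in> carrier V \<Longrightarrow> y \<in> carrier V \<Longrightarrow>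
      c \<odot>\<^bsub>V\<^esub> (x \<oplus>\<^bsub>V\<^esub> y) = c \<odot>\<^bsub>V\<^esub> x \<oplus>\<^bsub>V\<^esub> c \<odot>\<^bsub>V\<^esub> y" by (rule V.smult_r_distr)
  show as: "c \<in> carrier K \<Longrightarrow> k \<in> carrier K \<Longrightarrow> x \<in> carrier V \<Longrightarrow>
      (c \<otimes>\<^bsub>K\<^esub> k) \<odot>\<^bsub>V\<^esub> x = c \<odot>\<^bsub>V\<^esub> (k \<odot>\<^bsub>V\<^esub> x)" for c k by (rule V.smult_assoc1)
  show "c \<odot>\<^bsub>V\<^esub> (k \<odot>\<^bsub>V\<^esub> x) = k \<odot>\<^bsub>V\<^esub> (c \<odot>\<^bsub>V\<^esub> x)"
    if "c \<in> carrier K" "k \<in> carrier K" "x \<in> carrier V"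
    using as[OF that] as[OF that(2,1,3)] V.R.m_comm[OF that(1,2)] by simp
  show "c \<in> carrier K \<Longrightarrow> k \<in> carrier K \<Longrightarrow> x \<in> carrier V \<Longrightarrow>
      (c \<oplus>\<^bsub>K\<^esub> k) \<odot>\<^bsub>V\<^esub> x = c \<odot>\<^bsub>V\<^esub> x \<oplus>\<^bsub>V\<^esub> k \<odot>\<^bsub>V\<^esub> x" by (rule V.smult_l_distr)
  show "x \<in> carrier V \<Longrightarrow> \<one>\<^bsub>K\<^esub> \<odot>\<^bsub>V\<^esub> x = x" by (rule V.smult_one)
  show "x \<in> carrier V \<Longrightarrow> \<zero>\<^bsub>K\<^esub> \<odot>\<^bsub>V\<^esub> x = \<zero>\<^bsub>V\<^esub>" by simp
qed

lemma linear_mapI: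
  assumes "vectorspace K V" "vectorspace K W" "T \<in> module_hom K V W"
  shows "linear_map K V W T"
  using assms unfolding linear_map_def mod_hom_def mod_hom_axioms_def vectorspace_def by auto

lemma module_homI:
  assumes "\<And>x. x \<in> carrier V \<Longrightarrow> T x \<in> carrier W"
    and "\<And>x y. x \<in> carrier V \<Longrightarrow> y \<in> carrier V \<Longrightarrow> T (x \<oplus>\<^bsub>V\<^esub> y) = T x \<oplus>\<^bsub>W\<^esub> T y"
    and "\<And>c x. c \<in> carrier K \<Longrightarrow> x \<in> carrier V \<Longrightarrow> T (c \<odot>\<^bsub>V\<^esub> x) = c \<odot>\<^bsub>W\<^esub> T x"
  shows "T \<in> module_hom K V W"
  using assms by (auto simp: module_hom_def)

lemma module_hom_carrier: "T \<in> module_hom K V W \<Longrightarrow> x \<in> carrier V \<Longrightarrow> T x \<in> carrier W"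
  by (auto simp: module_hom_def)

lemma module_hom_zero:
  assumes "vectorspace K V" "vectorspace K W" "T \<in> module_hom K V W"
  shows "T \<zero>\<^bsub>V\<^esub> = \<zero>\<^bsub>W\<^esub>"
proof -
  interpret linear_map K V W T by (rule linear_mapI[OF assms])
  show ?thesis by simp
qed

lemma module_hom_comp:
  "T \<in> module_hom K V W \<Longrightarrow> U \<in> module_hom K W X \<Longrightarrow> (\<lambda>x. U (T x)) \<in> module_hom K V X"
  by (auto simp: module_hom_def Pi_iff)

lemma module_hom_inv:
  assumes "vectorspace K V" "T \<in> module_hom K V W" "bij_betw T (carrier V) (carrier W)"
  shows "inv_into (carrier V) T \<in> module_hom K W V"
proof -
  note V = vectorspaceD[OF assms(1)]
  let ?S = "inv_into (carrier V) T"
  have c: "?S y \<in> carrier V" "T (?S y) = y" if "y \<in> carrier W" for y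
    using assms(3) that by (auto simp: bij_betw_def inv_into_into f_inv_into_f)
  have u: "?S (T x) = x" if "x \<in> carrier V" for x
    using assms(3) that by (auto simp: bij_betw_def)
  show ?thesis
  proof (rule module_homI)
    fix x y assume "x \<in> carrier W" "y \<in> carrier W"
    then show "?S (x \<oplus>\<^bsub>W\<^esub> y) = ?S x \<oplus>\<^bsub>V\<^esub> ?S y"
      using u[of "?S x \<oplus>\<^bsub>V\<^esub> ?S y"] V c module_hom_add[OF assms(2)] by simp
  next
    fix k y assume "k \<in> carrier K" "y \<in> carrier W"
    then show "?S (k \<odot>\<^bsub>W\<^esub> y) = k \<odot>\<^bsub>V\<^esub> ?S y"
      using u[of "k \<odot>\<^bsub>V\<^esub> ?S y"] V c module_hom_smult[OF assms(2)] by simp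
  qed (use c in auto)
qed

text \<open>A tensor product comes with operations but without a proof of the vector space axioms; they are
pulled back along a bijection that respects the operations.\<close>

lemma vectorspace_transport:
  assumes V: "vectorspace K V" and bij: "bij_betw \<theta> (carrier W) (carrier V)"
    and zero: "\<zero>\<^bsub>W\<^esub> \<in> carrier W" "\<theta> \<zero>\<^bsub>W\<^esub> = \<zero>\<^bsub>V\<^esub>"
    and add: "\<And>x y. x \<in> carrier W \<Longrightarrow> y \<in> carrier W \<Longrightarrow> x \<oplus>\<^bsub>W\<^esub> y \<in> carrier W"
      "\<And>x y. x \<in> carrier W \<Longrightarrow> y \<in> carrier W \<Longrightarrow> \<theta> (x \<oplus>\<^bsub>W\<^esub> y) = \<theta> x \<oplus>\<^bsub>V\<^esub> \<theta> y"
    and smult: "\<And>c x. c \<in> carrier K \<Longrightarrow> x \<in> carrier W \<Longrightarrow> c \<odot>\<^bsub>W\<^esub> x \<in> carrier W"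
      "\<And>c x. c \<in> carrier K \<Longrightarrow> x \<in> carrier W \<Longrightarrow> \<theta> (c \<odot>\<^bsub>W\<^esub> x) = c \<odot>\<^bsub>V\<^esub> \<theta> x"
  shows "vectorspace K W"
proof -
  interpret V: vectorspace K V by fact
  have inj: "x = y" if "x \<in> carrier W" "y \<in> carrier W" "\<theta> x = \<theta> y" for x y
    using bij that by (auto simp: bij_betw_def inj_on_def)
  have c: "\<theta> x \<in> carrier V" if "x \<in> carrier W" for x using bij that by (auto simp: bij_betw_def)
  have neg: "\<exists>y\<in>carrier W. x \<oplus>\<^bsub>W\<^esub> y = \<zero>\<^bsub>W\<^esub>" if x: "x \<in> carrier W" for x
  proof -
    have "\<ominus>\<^bsub>V\<^esub> \<theta> x \<in> \<theta> ` carrier W" using bij c[OF x] by (auto simp: bij_betw_def)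
    then obtain y where y: "y \<in> carrier W" "\<theta> y = \<ominus>\<^bsub>V\<^esub> \<theta> x" by auto
    then have "x \<oplus>\<^bsub>W\<^esub> y = \<zero>\<^bsub>W\<^esub>"
      using x c[OF x] by (intro inj) (auto simp: add zero V.M.r_neg)
    then show ?thesis using y by blast
  qed
  show ?thesis
    by (rule vs_criteria[OF V.field_axioms zero(1)])
       (use neg in \<open>auto intro!: inj simp: add zero smult c V.M.a_ac V.smult_assoc1 V.smult_l_distr V.smult_r_distr\<close>)
qed

lemma module_hom_surj_fin_dim:
  assumes "vectorspace K V" "vectorspace K W" "T \<in> module_hom K V W" "T ` carrier V = carrier W"
    and "vectorspace.fin_dim K V"
  shows "vectorspace.fin_dim K W"
proof -
  interpret linear_map K V W T by (rule linear_mapI[OF assms(1-3)])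
  show ?thesis using rank_nullity_main(2) assms by blast
qed

lemma module_iso_dim:
  assumes "vectorspace K V" "vectorspace K W" "T \<in> module_hom K V W" "bij_betw T (carrier V) (carrier W)"
    and "vectorspace.fin_dim K V"
  shows "vectorspace.dim K V = vectorspace.dim K W"
proof -
  interpret linear_map K V W T by (rule linear_mapI[OF assms(1-3)])
  show ?thesis using dim_eq assms by (auto simp: bij_betw_def)
qed

text \<open>Rank-nullity: the kernel of the second map is an isomorphic copy of \<open>X\<close>.\<close>

lemma exact_dim:
  assumes "vectorspace K X" "vectorspace K Y" "vectorspace K Z"
    and f: "f \<in> module_hom K X Y" "inj_on f (carrier X)"
    and g: "g \<in> module_hom K Y Z" "g ` carrier Y = carrier Z"
    and ex: "f ` carrier X = {y \<in> carrier Y. g y = \<zero>\<^bsub>Z\<^esub>}"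
    and fin: "vectorspace.fin_dim K X" "vectorspace.fin_dim K Y"
  shows "vectorspace.dim K Y = vectorspace.dim K X + vectorspace.dim K Z"
proof -
  interpret g: linear_map K Y Z g by (rule linear_mapI[OF assms(2,3) g(1)])
  have ker: "g.kerT = f ` carrier X" using ex by (auto simp: g.ker_def)
  have im: "g.imT = carrier Z" using g(2) by (auto simp: g.im_def)
  have vk: "vectorspace K (Y\<lparr>carrier := f ` carrier X\<rparr>)"
    using g.V.subspace_is_vs[OF g.kerT_is_subspace] ker by simp
  have "f \<in> module_hom K X (Y\<lparr>carrier := f ` carrier X\<rparr>)"
    using f(1) by (auto simp: module_hom_def)
  then have "vectorspace.dim K X = vectorspace.dim K (Y\<lparr>carrier := f ` carrier X\<rparr>)"
    by (rule module_iso_dim[OF assms(1) vk]) (use f fin in \<open>auto simp: bij_betw_def\<close>)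
  then show ?thesis
    using g.rank_nullity_main(1)[OF fin(2)] by (simp add: ker im)
qed

lemma zero_space:
  assumes V: "vectorspace K V"
  shows "vectorspace K (V\<lparr>carrier := {\<zero>\<^bsub>V\<^esub>}\<rparr>)"
    and "vectorspace.fin_dim K (V\<lparr>carrier := {\<zero>\<^bsub>V\<^esub>}\<rparr>)"
    and "vectorspace.dim K (V\<lparr>carrier := {\<zero>\<^bsub>V\<^esub>}\<rparr>) = 0"
proof -
  interpret V: vectorspace K V by fact
  show vs: "vectorspace K (V\<lparr>carrier := {\<zero>\<^bsub>V\<^esub>}\<rparr>)"
    by (rule vs_criteria[OF V.field_axioms]) auto
  interpret Z: vectorspace K "V\<lparr>carrier := {\<zero>\<^bsub>V\<^esub>}\<rparr>" by (rule vs)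
  have "Z.span {} = {\<zero>\<^bsub>V\<^esub>}" using Z.span_empty by simp
  then show "Z.fin_dim" unfolding Z.fin_dim_def by (intro exI[of _ "{}"]) auto
  show "Z.dim = 0" by (rule Z.dim0I) (use Z.span_self[of "\<zero>\<^bsub>V\<^esub>"] Z.span_closed[of "{\<zero>\<^bsub>V\<^esub>}"] in auto)
qed

lemma line_space:
  assumes K: "field K"
  shows "vectorspace K (line_space K)"
    and "vectorspace.fin_dim K (line_space K)"
    and "vectorspace.dim K (line_space K) = 1"
proof -
  interpret K: field K by fact
  have [simp]: "carrier (line_space K) = carrier K" "\<zero>\<^bsub>line_space K\<^esub> = \<zero>\<^bsub>K\<^esub>"
    "(\<oplus>\<^bsub>line_space K\<^esub>) = (\<oplus>\<^bsub>K\<^esub>)" "(\<odot>\<^bsub>line_space K\<^esub>) = (\<otimes>\<^bsub>K\<^esub>)"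
    by (simp_all add: line_space_def)
  show vs: "vectorspace K (line_space K)"
  proof (rule vs_criteria[OF K])
    show "\<forall>v\<in>carrier (line_space K). \<exists>w\<in>carrier (line_space K). v \<oplus>\<^bsub>line_space K\<^esub> w = \<zero>\<^bsub>line_space K\<^esub>"
      using K.r_neg K.a_inv_closed by (metis \<open>carrier (line_space K) = carrier K\<close>
        \<open>(\<oplus>\<^bsub>line_space K\<^esub>) = (\<oplus>\<^bsub>K\<^esub>)\<close> \<open>\<zero>\<^bsub>line_space K\<^esub> = \<zero>\<^bsub>K\<^esub>\<close>)
  qed (auto simp: K.a_ac K.m_ac K.l_distr K.r_distr)
  interpret L: vectorspace K "line_space K" by (rule vs)
  have g: "L.span {\<one>\<^bsub>K\<^esub>} = carrier (line_space K)"
  proof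
    show "L.span {\<one>\<^bsub>K\<^esub>} \<subseteq> carrier (line_space K)" by (rule L.span_is_subset2) simp
    show "carrier (line_space K) \<subseteq> L.span {\<one>\<^bsub>K\<^esub>}"
    proof
      fix x assume x: "x \<in> carrier (line_space K)"
      have "L.lincomb (\<lambda>_. x) {\<one>\<^bsub>K\<^esub>} = x"
        using x by (simp add: L.lincomb_def)
      then show "x \<in> L.span {\<one>\<^bsub>K\<^esub>}"
        using x by (subst L.finite_span) (auto intro!: exI[of _ "\<lambda>_. x"])
    qed
  qed
  show "L.fin_dim" unfolding L.fin_dim_def
    by (rule exI[of _ "{\<one>\<^bsub>K\<^esub>}"]) (use g in auto)
  show "L.dim = 1" by (rule L.dim1I[OF g]) auto
qed

text \<open>The space \<open>k\<^sup>d\<close> inside the type in which the modules of the Grothendieck group live. All these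
spaces are sets of functions on the natural numbers, so that \<open>k\<^sup>d\<close> is literally a subset of \<open>k\<^sup>(\<^sup>d\<^sup>+\<^sup>1\<^sup>)\<close>
and inclusions are identity maps.\<close>

definition coord_space :: "('k, 'r) ring_scheme \<Rightarrow> nat \<Rightarrow> ('k, nat \<Rightarrow> 'k) module" where
  "coord_space K d =
     \<lparr>carrier = {f. (\<forall>i<d. f i \<in> carrier K) \<and> (\<forall>i\<ge>d. f i = \<zero>\<^bsub>K\<^esub>)},
      monoid.mult = (\<lambda>f g. undefined), one = undefined,
      ring.zero = (\<lambda>i. \<zero>\<^bsub>K\<^esub>), ring.add = (\<lambda>f g i. f i \<oplus>\<^bsub>K\<^esub> g i),
      smult = (\<lambda>c f i. c \<otimes>\<^bsub>K\<^esub> f i)\<rparr>"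

lemma coord_space_nth:
  assumes "field K" "f \<in> carrier (coord_space K d)" shows "f i \<in> carrier K"
proof -
  interpret K: field K by fact
  show ?thesis using assms(2) by (cases "i < d") (auto simp: coord_space_def)
qed

lemma coord_space_0: "carrier (coord_space K 0) = {\<zero>\<^bsub>coord_space K 0\<^esub>}"
  by (auto simp: coord_space_def)

lemma coord_space_Suc:
  assumes "field K"
  shows "carrier (coord_space K k) = {y \<in> carrier (coord_space K (Suc k)). y k = \<zero>\<^bsub>K\<^esub>}"
proof -
  interpret K: field K by fact
  have "(\<forall>i\<ge>k. y i = \<zero>\<^bsub>K\<^esub>) \<longleftrightarrow> y k = \<zero>\<^bsub>K\<^esub> \<and> (\<forall>i\<ge>Suc k. y i = \<zero>\<^bsub>K\<^esub>)" for y
    by (auto simp: Suc_le_eq le_eq_less_or_eq[of k])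
  then show ?thesis by (auto simp: coord_space_def All_less_Suc)
qed

text \<open>A vector is built up from the unit vectors by truncating it at growing indices.\<close>

lemma coord_space:
  assumes K: "field K"
  shows "vectorspace K (coord_space K d)" and "vectorspace.fin_dim K (coord_space K d)"
proof -
  interpret K: field K by fact
  have n: "f i \<in> carrier K" if "f \<in> carrier (coord_space K d)" for f i
    by (rule coord_space_nth[OF K that])
  show vs: "vectorspace K (coord_space K d)"
  proof (rule vs_criteria[OF K])
    show "\<forall>v\<in>carrier (coord_space K d). \<exists>w\<in>carrier (coord_space K d).
        v \<oplus>\<^bsub>coord_space K d\<^esub> w = \<zero>\<^bsub>coord_space K d\<^esub>"
    proof
      fix v assume v: "v \<in> carrier (coord_space K d)"
      show "\<exists>w\<in>carrier (coord_space K d). v \<oplus>\<^bsub>coord_space K d\<^esub> w = \<zero>\<^bsub>coord_space K d\<^esub>"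
        by (rule bexI[of _ "\<lambda>i. \<ominus>\<^bsub>K\<^esub> v i"])
           (use v n[OF v] in \<open>auto simp: coord_space_def K.r_neg\<close>)
    qed
  qed (use n in \<open>auto simp: coord_space_def K.a_ac K.m_ac K.l_distr K.r_distr\<close>)
  interpret V: vectorspace K "coord_space K d" by (rule vs)
  define e :: "nat \<Rightarrow> nat \<Rightarrow> 'a" where "e = (\<lambda>j i. if i = j then \<one>\<^bsub>K\<^esub> else \<zero>\<^bsub>K\<^esub>)"
  have e: "e ` {..<d} \<subseteq> carrier (coord_space K d)" by (auto simp: e_def coord_space_def)
  interpret S: submodule K "V.span (e ` {..<d})" "coord_space K d" by (rule V.span_is_submodule[OF e])
  have t: "(\<lambda>i. if i < k then f i else \<zero>\<^bsub>K\<^esub>) \<in> V.span (e ` {..<d})"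
    if f: "f \<in> carrier (coord_space K d)" and "k \<le> d" for f k
    using \<open>k \<le> d\<close>
  proof (induction k)
    case 0
    then show ?case using S.zero_closed by (simp add: coord_space_def)
  next
    case (Suc k)
    have "e k \<in> V.span (e ` {..<d})" using V.in_own_span[OF e] Suc.prems by auto
    then have "f k \<odot>\<^bsub>coord_space K d\<^esub> e k \<in> V.span (e ` {..<d})"
      using n[OF f] by simp
    then have "(\<lambda>i. if i < k then f i else \<zero>\<^bsub>K\<^esub>) \<oplus>\<^bsub>coord_space K d\<^esub> (f k \<odot>\<^bsub>coord_space K d\<^esub> e k)
        \<in> V.span (e ` {..<d})"
      using Suc by simp
    moreover have "(\<lambda>i. if i < k then f i else \<zero>\<^bsub>K\<^esub>) \<oplus>\<^bsub>coord_space K d\<^esub> (f k \<odot>\<^bsub>coord_space K d\<^esub> e k)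
        = (\<lambda>i. if i < Suc k then f i else \<zero>\<^bsub>K\<^esub>)"
      using n[OF f] by (auto simp: coord_space_def e_def fun_eq_iff less_Suc_eq)
    ultimately show ?case by simp
  qed
  have "V.span (e ` {..<d}) = carrier (coord_space K d)"
  proof
    show "carrier (coord_space K d) \<subseteq> V.span (e ` {..<d})"
    proof
      fix f assume f: "f \<in> carrier (coord_space K d)"
      then have "(\<lambda>i. if i < d then f i else \<zero>\<^bsub>K\<^esub>) = f" by (auto simp: coord_space_def fun_eq_iff)
      then show "f \<in> V.span (e ` {..<d})" using t[OF f order_refl] by simp
    qed
  qed (rule V.span_is_subset2[OF e])
  then show "V.fin_dim" unfolding V.fin_dim_def using e by (intro exI[of _ "e ` {..<d}"]) auto
qed

text \<open>Coordinates with respect to a basis, enumerated by an initial segment of the natural numbers.\<close>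

lemma coord_space_iso:
  assumes V: "vectorspace K V" and fin: "vectorspace.fin_dim K V"
  obtains \<phi> where "\<phi> \<in> module_hom K (coord_space K (vectorspace.dim K V)) V"
    and "bij_betw \<phi> (carrier (coord_space K (vectorspace.dim K V))) (carrier V)"
proof -
  interpret V: vectorspace K V by fact
  note K = V.field_axioms
  obtain \<beta> where \<beta>: "finite \<beta>" "V.basis \<beta>" using V.finite_basis_exists[OF fin] by auto
  have \<beta>c: "\<beta> \<subseteq> carrier V" using \<beta>(2) by (simp add: V.basis_def)
  define d where "d = V.dim"
  have "card \<beta> = d" unfolding d_def using V.dim_basis[OF \<beta>] by simp
  then obtain e where e: "bij_betw e {..<d} \<beta>"
    using ex_bij_betw_nat_finite[OF \<beta>(1)] by (auto simp: atLeast0LessThan)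
  let ?C = "coord_space K d"
  define \<phi> where "\<phi> c = (\<Oplus>\<^bsub>V\<^esub>i\<in>{..<d}. c i \<odot>\<^bsub>V\<^esub> e i)" for c
  have ec: "e i \<in> carrier V" if "i < d" for i using e \<beta>c that by (auto simp: bij_betw_def)
  note n = coord_space_nth[OF K]
  have hom: "\<phi> \<in> module_hom K ?C V"
  proof (rule module_homI)
    show "\<phi> x \<in> carrier V" if "x \<in> carrier ?C" for x
      unfolding \<phi>_def using n[OF that] ec by (intro V.M.finsum_closed) auto
    fix x y assume xy: "x \<in> carrier ?C" "y \<in> carrier ?C"
    have add: "x \<oplus>\<^bsub>?C\<^esub> y = (\<lambda>i. x i \<oplus>\<^bsub>K\<^esub> y i)" by (simp add: coord_space_def)
    note nxy = n[OF xy(1)] n[OF xy(2)]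
    have "\<phi> (x \<oplus>\<^bsub>?C\<^esub> y) = (\<Oplus>\<^bsub>V\<^esub>i\<in>{..<d}. x i \<odot>\<^bsub>V\<^esub> e i \<oplus>\<^bsub>V\<^esub> y i \<odot>\<^bsub>V\<^esub> e i)"
      unfolding \<phi>_def add using ec nxy
      by (intro V.M.finsum_cong') (auto simp: V.smult_l_distr)
    also have "\<dots> = \<phi> x \<oplus>\<^bsub>V\<^esub> \<phi> y"
      unfolding \<phi>_def using ec nxy by (intro V.M.finsum_addf) auto
    finally show "\<phi> (x \<oplus>\<^bsub>?C\<^esub> y) = \<phi> x \<oplus>\<^bsub>V\<^esub> \<phi> y" .
  next
    fix c x assume cx: "c \<in> carrier K" "x \<in> carrier ?C"
    have smult: "c \<odot>\<^bsub>?C\<^esub> x = (\<lambda>i. c \<otimes>\<^bsub>K\<^esub> x i)" by (simp add: coord_space_def)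
    have "\<phi> (c \<odot>\<^bsub>?C\<^esub> x) = (\<Oplus>\<^bsub>V\<^esub>i\<in>{..<d}. c \<odot>\<^bsub>V\<^esub> (x i \<odot>\<^bsub>V\<^esub> e i))"
      unfolding \<phi>_def smult using cx(1) ec n[OF cx(2)]
      by (intro V.M.finsum_cong') (auto simp: V.smult_assoc1)
    also have "\<dots> = c \<odot>\<^bsub>V\<^esub> \<phi> x"
      unfolding \<phi>_def using cx(1) ec n[OF cx(2)]
      by (intro V.finsum_smult_ldistr[symmetric]) auto
    finally show "\<phi> (c \<odot>\<^bsub>?C\<^esub> x) = c \<odot>\<^bsub>V\<^esub> \<phi> x" .
  qed
  have lc: "V.lincomb a \<beta> = \<phi> c"
    if "\<And>i. i < d \<Longrightarrow> a (e i) = c i" "a \<in> \<beta> \<rightarrow> carrier K" for a c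
  proof -
    have "V.lincomb a \<beta> = (\<Oplus>\<^bsub>V\<^esub>v\<in>e ` {..<d}. a v \<odot>\<^bsub>V\<^esub> v)"
      using e by (simp add: V.lincomb_def bij_betw_def)
    also have "\<dots> = (\<Oplus>\<^bsub>V\<^esub>i\<in>{..<d}. a (e i) \<odot>\<^bsub>V\<^esub> e i)"
    proof (rule V.M.finsum_reindex)
      show "(\<lambda>v. a v \<odot>\<^bsub>V\<^esub> v) \<in> e ` {..<d} \<rightarrow> carrier V"
        using funcset_mem[OF that(2)] \<beta>c e by (auto simp: bij_betw_def)
    qed (use e in \<open>simp add: bij_betw_def\<close>)
    also have "\<dots> = \<phi> c" unfolding \<phi>_def
    proof (rule V.M.finsum_cong')
      have "a (e i) \<in> carrier K" if "i < d" for i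
        using \<open>a \<in> \<beta> \<rightarrow> carrier K\<close> e that by (auto simp: bij_betw_def)
      then show "(\<lambda>i. c i \<odot>\<^bsub>V\<^esub> e i) \<in> {..<d} \<rightarrow> carrier V" using that(1) ec by auto
    qed (use that(1) in auto)
    finally show ?thesis .
  qed
  note u = V.basis_criterion[OF \<beta>(1) \<beta>c, THEN iffD1, OF \<beta>(2), rule_format]
  define r where "r = inv_into {..<d} e"
  have r: "r (e i) = i" if "i < d" for i unfolding r_def using e that by (simp add: bij_betw_def)
  have inj: "inj_on \<phi> (carrier ?C)"
  proof (rule inj_onI)
    fix x y assume xy: "x \<in> carrier ?C" "y \<in> carrier ?C" "\<phi> x = \<phi> y"
    let ?a = "\<lambda>z. \<lambda>v\<in>\<beta>. z (r v)"
    have a: "?a z \<in> \<beta> \<rightarrow>\<^sub>E carrier K \<and> V.lincomb (?a z) \<beta> = \<phi> z" if "z \<in> carrier ?C" for z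
    proof
      show 1: "?a z \<in> \<beta> \<rightarrow>\<^sub>E carrier K" using n[OF that] by auto
      show "V.lincomb (?a z) \<beta> = \<phi> z"
      proof (rule lc)
        show "?a z (e i) = z i" if "i < d" for i
          using that e by (auto simp: r bij_betw_def)
      qed (use n[OF that] in auto)
    qed
    have ex1: "\<exists>!a. a \<in> \<beta> \<rightarrow>\<^sub>E carrier K \<and> V.lincomb a \<beta> = \<phi> x"
      by (rule u[OF module_hom_carrier[OF hom xy(1)]])
    have "?a x = ?a y"
      by (rule trans[OF the1_equality[OF ex1, OF a[OF xy(1)], symmetric] the1_equality[OF ex1]])
         (use a[OF xy(2)] xy(3) in simp)
    then have axy: "?a x (e i) = ?a y (e i)" for i by simp
    have "x i = y i" if "i < d" for i
    proof -
      have "e i \<in> \<beta>" using that e by (auto simp: bij_betw_def)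
      then show ?thesis using axy[of i] that by (simp add: r)
    qed
    moreover have "x i = y i" if "\<not> i < d" for i using xy that by (simp add: coord_space_def)
    ultimately show "x = y" by blast
  qed
  have surj: "carrier V \<subseteq> \<phi> ` carrier ?C"
  proof
    fix v assume "v \<in> carrier V"
    from ex1_implies_ex[OF u[OF this]]
    obtain a where a: "a \<in> \<beta> \<rightarrow>\<^sub>E carrier K" "V.lincomb a \<beta> = v" by (elim exE conjE)
    define c where "c i = (if i < d then a (e i) else \<zero>\<^bsub>K\<^esub>)" for i
    have ai: "a (e i) \<in> carrier K" if "i < d" for i
      using a(1) e that by (auto simp: bij_betw_def)
    then have "c \<in> carrier ?C" by (simp add: c_def coord_space_def)
    then have "\<phi> c \<in> \<phi> ` carrier ?C" by (rule imageI)
    moreover have "V.lincomb a \<beta> = \<phi> c"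
    proof (rule lc)
      show "a (e i) = c i" if "i < d" for i using that by (simp add: c_def)
      show "a \<in> \<beta> \<rightarrow> carrier K" using a(1) by (simp add: PiE_def)
    qed
    ultimately show "v \<in> \<phi> ` carrier ?C" using a(2) by simp
  qed
  have "bij_betw \<phi> (carrier ?C) (carrier V)"
    unfolding bij_betw_def
  proof (intro conjI equalityI image_subsetI inj surj)
    show "\<phi> x \<in> carrier V" if "x \<in> carrier ?C" for x by (rule module_hom_carrier[OF hom that])
  qed
  then show ?thesis using that[OF hom[unfolded d_def]] by (simp only: d_def)
qed

section \<open>Grothendieck groups of acyclic quivers\<close>

lemma fd_repD:
  assumes "fd_rep K Q X"
  shows "a \<in> vertices Q \<Longrightarrow> vectorspace K (sp X a)"
    and "a \<in> vertices Q \<Longrightarrow> vectorspace.fin_dim K (sp X a)"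
    and "(a, b) \<in> arrows Q \<Longrightarrow> ar X a b \<in> module_hom K (sp X a) (sp X b)"
    and "(a, b, c, d) \<in> squares Q \<Longrightarrow> x \<in> carrier (sp X a) \<Longrightarrow>
      ar X b d (ar X a b x) = ar X c d (ar X a c x)"
  using assms by (auto simp: fd_rep_def)

lemma fd_repI:
  assumes "\<And>a. a \<in> vertices Q \<Longrightarrow> vectorspace K (sp X a)"
    and "\<And>a. a \<in> vertices Q \<Longrightarrow> vectorspace.fin_dim K (sp X a)"
    and "\<And>a b. (a, b) \<in> arrows Q \<Longrightarrow> ar X a b \<in> module_hom K (sp X a) (sp X b)"
    and "\<And>a b c d x. (a, b, c, d) \<in> squares Q \<Longrightarrow> x \<in> carrier (sp X a) \<Longrightarrow>
      ar X b d (ar X a b x) = ar X c d (ar X a c x)"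
  shows "fd_rep K Q X"
  using assms by (auto simp: fd_rep_def)

lemma rep_homD:
  assumes "rep_hom K Q X Y f"
  shows "a \<in> vertices Q \<Longrightarrow> f a \<in> module_hom K (sp X a) (sp Y a)"
    and "(a, b) \<in> arrows Q \<Longrightarrow> x \<in> carrier (sp X a) \<Longrightarrow> f b (ar X a b x) = ar Y a b (f a x)"
  using assms by (auto simp: rep_hom_def)

lemma rep_homI:
  assumes "\<And>a. a \<in> vertices Q \<Longrightarrow> f a \<in> module_hom K (sp X a) (sp Y a)"
    and "\<And>a b x. (a, b) \<in> arrows Q \<Longrightarrow> x \<in> carrier (sp X a) \<Longrightarrow> f b (ar X a b x) = ar Y a b (f a x)"
  shows "rep_hom K Q X Y f"
  using assms by (auto simp: rep_hom_def)

lemma short_exactD: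
  assumes "short_exact K Q X Y Z f g"
  shows "fd_rep K Q X" "fd_rep K Q Y" "fd_rep K Q Z" "rep_hom K Q X Y f" "rep_hom K Q Y Z g"
    and "a \<in> vertices Q \<Longrightarrow> inj_on (f a) (carrier (sp X a))"
    and "a \<in> vertices Q \<Longrightarrow> f a ` carrier (sp X a) = {y \<in> carrier (sp Y a). g a y = \<zero>\<^bsub>sp Z a\<^esub>}"
    and "a \<in> vertices Q \<Longrightarrow> g a ` carrier (sp Y a) = carrier (sp Z a)"
  using assms by (auto simp: short_exact_def)

abbreviation rep_dim :: "('k, 'r) ring_scheme \<Rightarrow> ('v, 'k, 'u) rep \<Rightarrow> 'v \<Rightarrow> nat" where
  "rep_dim K X a \<equiv> vectorspace.dim K (sp X a)"

lemma short_exact_dim: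
  assumes "short_exact K Q X Y Z f g" "a \<in> vertices Q"
  shows "rep_dim K Y a = rep_dim K X a + rep_dim K Z a"
proof -
  note e = short_exactD[OF assms(1)] and a = assms(2)
  show ?thesis
    by (rule exact_dim[OF fd_repD(1)[OF e(1) a] fd_repD(1)[OF e(2) a] fd_repD(1)[OF e(3) a]
          rep_homD(1)[OF e(4) a] e(6)[OF a] rep_homD(1)[OF e(5) a] e(8)[OF a] e(7)[OF a]
          fd_repD(2)[OF e(1) a] fd_repD(2)[OF e(2) a]])
qed

lemma rep_iso_dim:
  assumes "fd_rep K Q X" "fd_rep K Q Y" "rep_iso K Q X Y" "a \<in> vertices Q"
  shows "rep_dim K X a = rep_dim K Y a"
proof -
  obtain f where "rep_hom K Q X Y f" "bij_betw (f a) (carrier (sp X a)) (carrier (sp Y a))"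
    using assms(3,4) by (auto simp: rep_iso_def)
  then show ?thesis
    by (intro module_iso_dim[where T = "f a"] fd_repD[OF assms(1)] fd_repD[OF assms(2)] assms(4)
        rep_homD(1)[of K Q X Y f])
qed

lemma standard_rep_fd:
  assumes K: "field K"
    and sq: "\<And>a b c d. (a, b, c, d) \<in> squares Q \<Longrightarrow> a \<in> S \<Longrightarrow> d \<in> S \<Longrightarrow> b \<in> S \<and> c \<in> S"
  shows "fd_rep K Q (standard_rep K S)"
proof (rule fd_repI)
  interpret K: field K by fact
  note L = line_space[OF K] and Z = zero_space[OF line_space(1)[OF K]]
  have [simp]: "carrier (line_space K) = carrier K" "\<zero>\<^bsub>line_space K\<^esub> = \<zero>\<^bsub>K\<^esub>"
    "(\<oplus>\<^bsub>line_space K\<^esub>) = (\<oplus>\<^bsub>K\<^esub>)" "(\<odot>\<^bsub>line_space K\<^esub>) = (\<otimes>\<^bsub>K\<^esub>)"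
    by (simp_all add: line_space_def)
  show "vectorspace K (sp (standard_rep K S) a)" "vectorspace.fin_dim K (sp (standard_rep K S) a)" for a
    using L Z by (auto simp: standard_rep_def)
  show "ar (standard_rep K S) a b \<in> module_hom K (sp (standard_rep K S) a) (sp (standard_rep K S) b)" for a b
    by (rule module_homI) (auto simp: standard_rep_def split: if_splits)
  fix a b c d x assume "(a, b, c, d) \<in> squares Q" "x \<in> carrier (sp (standard_rep K S) a)"
  then show "ar (standard_rep K S) b d (ar (standard_rep K S) a b x) =
      ar (standard_rep K S) c d (ar (standard_rep K S) a c x)"
    using sq[of a b c d] by (auto simp: standard_rep_def)
qed

lemma standard_rep_dim:
  assumes "field K"
  shows "rep_dim K (standard_rep K S) a = (if a \<in> S then 1 else 0)"
  using line_space(3)[OF assms] zero_space(3)[OF line_space(1)[OF assms]]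
  by (simp add: standard_rep_def line_space_def)

text \<open>Truncation to a set of vertices. Depending on that set it is a subrepresentation, a quotient, or
not a representation at all, since the relations may fail.\<close>

definition restr :: "'v set \<Rightarrow> ('v, 'k, 'u) rep \<Rightarrow> ('v, 'k, 'u) rep" where
  "restr U X =
     \<lparr>sp = (\<lambda>a. if a \<in> U then sp X a else (sp X a)\<lparr>carrier := {\<zero>\<^bsub>sp X a\<^esub>}\<rparr>),
      ar = (\<lambda>a b x. if a \<in> U \<and> b \<in> U then ar X a b x else \<zero>\<^bsub>sp X b\<^esub>)\<rparr>"

text \<open>The semisimple representation with a prescribed dimension vector.\<close>

definition semisimple :: "('k, 'r) ring_scheme \<Rightarrow> ('v \<Rightarrow> nat) \<Rightarrow> ('v, 'k, nat \<Rightarrow> 'k) rep" where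
  "semisimple K d = \<lparr>sp = (\<lambda>a. coord_space K (d a)), ar = (\<lambda>a b x i. \<zero>\<^bsub>K\<^esub>)\<rparr>"

text \<open>The rank function makes the quiver acyclic and provides every nonzero representation with a last
vertex in its support.\<close>

locale ranked_quiver =
  fixes K :: "('k, 'r) ring_scheme" and Q :: "'v quiver" and rk :: "'v \<Rightarrow> nat"
  assumes K: "field K" and fin: "finite (vertices Q)"
    and arrow: "(a, b) \<in> arrows Q \<Longrightarrow> a \<in> vertices Q \<and> b \<in> vertices Q \<and> rk a < rk b"
    and square: "(a, b, c, d) \<in> squares Q \<Longrightarrow>
      (a, b) \<in> arrows Q \<and> (b, d) \<in> arrows Q \<and> (a, c) \<in> arrows Q \<and> (c, d) \<in> arrows Q"
begin

lemma no_square_on_a_cycle: "(a, b, c, a) \<notin> squares Q"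
proof
  assume "(a, b, c, a) \<in> squares Q"
  then have "(a, b) \<in> arrows Q" "(b, a) \<in> arrows Q" using square by blast+
  then show False using arrow[of a b] arrow[of b a] by simp
qed

lemma hom_zero:
  assumes "fd_rep K Q X" "(a, b) \<in> arrows Q" shows "ar X a b \<zero>\<^bsub>sp X a\<^esub> = \<zero>\<^bsub>sp X b\<^esub>"
  by (rule module_hom_zero[of K]) (use assms fd_repD[OF assms(1)] arrow in auto)

lemma restr_fd:
  assumes X: "fd_rep K Q X"
    and U: "\<And>a b c d. (a, b, c, d) \<in> squares Q \<Longrightarrow> a \<in> U \<Longrightarrow> d \<in> U \<Longrightarrow>
      carrier (sp X d) = {\<zero>\<^bsub>sp X d\<^esub>} \<or> b \<in> U \<and> c \<in> U"
  shows "fd_rep K Q (restr U X)"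
proof (rule fd_repI)
  note D = fd_repD[OF X]
  show "vectorspace K (sp (restr U X) a)" "vectorspace.fin_dim K (sp (restr U X) a)"
    if "a \<in> vertices Q" for a
    using D(1,2)[OF that] zero_space[OF D(1)[OF that]] by (auto simp: restr_def)
  fix a b assume ab: "(a, b) \<in> arrows Q"
  have v: "a \<in> vertices Q" "b \<in> vertices Q" using arrow[OF ab] by auto
  interpret A: vectorspace K "sp X a" by (rule D(1)[OF v(1)])
  interpret B: vectorspace K "sp X b" by (rule D(1)[OF v(2)])
  note h = D(3)[OF ab]
  show "ar (restr U X) a b \<in> module_hom K (sp (restr U X) a) (sp (restr U X) b)"
    by (rule module_homI)
       (auto simp: restr_def hom_zero[OF X ab] module_hom_carrier[OF h] module_hom_add[OF h]
          module_hom_smult[OF h] split: if_splits)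
next
  fix a b c d x assume sq: "(a, b, c, d) \<in> squares Q" and x: "x \<in> carrier (sp (restr U X) a)"
  note s = square[OF sq]
  have z: "ar X b d \<zero>\<^bsub>sp X b\<^esub> = \<zero>\<^bsub>sp X d\<^esub>" "ar X c d \<zero>\<^bsub>sp X c\<^esub> = \<zero>\<^bsub>sp X d\<^esub>"
    using hom_zero[OF X] s by auto
  have x': "x \<in> carrier (sp X a)" if "a \<in> U" using x that by (simp add: restr_def)
  show "ar (restr U X) b d (ar (restr U X) a b x) = ar (restr U X) c d (ar (restr U X) a c x)"
  proof (cases "a \<in> U \<and> d \<in> U")
    case True
    have m: "ar X b d y \<in> carrier (sp X d)" if "y \<in> carrier (sp X b)" for y
      using module_hom_carrier[OF fd_repD(3)[OF X]] s that by blast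
    have m': "ar X c d y \<in> carrier (sp X d)" if "y \<in> carrier (sp X c)" for y
      using module_hom_carrier[OF fd_repD(3)[OF X]] s that by blast
    have n: "ar X a b x \<in> carrier (sp X b)" "ar X a c x \<in> carrier (sp X c)"
      using module_hom_carrier[OF fd_repD(3)[OF X]] s x' True by blast+
    show ?thesis
      using U[OF sq] True fd_repD(4)[OF X sq x'] m[OF n(1)] m'[OF n(2)] z
      by (auto simp: restr_def)
  next
    case False
    then show ?thesis using z by (auto simp: restr_def)
  qed
qed

text \<open>If the representation vanishes after \<open>v\<close>, then its space at \<open>v\<close> is a subrepresentation, and the
quotient is obtained by erasing the vertex. No quotient space has to be formed.\<close>

lemma split_vertex:
  assumes X: "fd_rep K Q X" and top: "\<And>b. (v, b) \<in> arrows Q \<Longrightarrow> carrier (sp X b) = {\<zero>\<^bsub>sp X b\<^esub>}"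
  shows "short_exact K Q (restr {v} X) X (restr (- {v}) X)
    (\<lambda>a x. x) (\<lambda>a x. if a = v then \<zero>\<^bsub>sp X a\<^esub> else x)"
proof -
  note D = fd_repD[OF X]
  have 1: "fd_rep K Q (restr {v} X)"
    by (rule restr_fd[OF X]) (use no_square_on_a_cycle in blast)
  have 2: "fd_rep K Q (restr (- {v}) X)"
    by (rule restr_fd[OF X]) (use square top in blast)
  have az: "ar X v b x = \<zero>\<^bsub>sp X b\<^esub>" if "(v, b) \<in> arrows Q" "x \<in> carrier (sp X v)" for b x
    using module_hom_carrier[OF D(3)[OF that(1)] that(2)] top[OF that(1)] by auto
  have 3: "rep_hom K Q (restr {v} X) X (\<lambda>a x. x)"
  proof (rule rep_homI)
    show "(\<lambda>x. x) \<in> module_hom K (sp (restr {v} X) a) (sp X a)" if "a \<in> vertices Q" for a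
      using vectorspaceD(2)[OF D(1)[OF that]] by (intro module_homI) (auto simp: restr_def split: if_splits)
    show "ar (restr {v} X) a b x = ar X a b x"
      if "(a, b) \<in> arrows Q" "x \<in> carrier (sp (restr {v} X) a)" for a b x
      using that az hom_zero[OF X that(1)] by (auto simp: restr_def split: if_splits)
  qed
  have 4: "rep_hom K Q X (restr (- {v}) X) (\<lambda>a x. if a = v then \<zero>\<^bsub>sp X a\<^esub> else x)"
  proof (rule rep_homI)
    show "(\<lambda>x. if a = v then \<zero>\<^bsub>sp X a\<^esub> else x) \<in> module_hom K (sp X a) (sp (restr (- {v}) X) a)"
      if "a \<in> vertices Q" for a
    proof -
      have z: "\<zero>\<^bsub>sp X a\<^esub> \<oplus>\<^bsub>sp X a\<^esub> \<zero>\<^bsub>sp X a\<^esub> = \<zero>\<^bsub>sp X a\<^esub>"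
        "\<And>c. c \<in> carrier K \<Longrightarrow> c \<odot>\<^bsub>sp X a\<^esub> \<zero>\<^bsub>sp X a\<^esub> = \<zero>\<^bsub>sp X a\<^esub>"
        using vectorspace_zero[OF D(1)[OF that]] by simp_all
      show ?thesis by (intro module_homI) (use z in \<open>auto simp: restr_def\<close>)
    qed
    show "(if b = v then \<zero>\<^bsub>sp X b\<^esub> else ar X a b x) =
        ar (restr (- {v}) X) a b (if a = v then \<zero>\<^bsub>sp X a\<^esub> else x)"
      if "(a, b) \<in> arrows Q" "x \<in> carrier (sp X a)" for a b x
      using that az by (auto simp: restr_def)
  qed
  show ?thesis
    unfolding short_exact_def
    using X 1 2 3 4 vectorspaceD(2)[OF D(1)] by (auto simp: restr_def image_def)
qed

lemma semisimple_fd: "fd_rep K Q (semisimple K d)"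
proof -
  interpret K: field K by (rule K)
  show ?thesis
    by (rule fd_repI) (use coord_space[OF K] in \<open>auto simp: semisimple_def module_hom_def coord_space_def\<close>)
qed

lemma semisimple_iso:
  assumes X: "fd_rep K Q X"
    and z: "\<And>a b x. (a, b) \<in> arrows Q \<Longrightarrow> x \<in> carrier (sp X a) \<Longrightarrow> ar X a b x = \<zero>\<^bsub>sp X b\<^esub>"
  shows "rep_iso K Q (semisimple K (rep_dim K X)) X"
proof -
  note D = fd_repD[OF X]
  have "\<exists>\<phi>. \<phi> \<in> module_hom K (coord_space K (rep_dim K X a)) (sp X a) \<and>
      bij_betw \<phi> (carrier (coord_space K (rep_dim K X a))) (carrier (sp X a))" if "a \<in> vertices Q" for a
    using coord_space_iso[OF D(1)[OF that] D(2)[OF that]] by metis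
  then obtain \<phi> where \<phi>: "\<And>a. a \<in> vertices Q \<Longrightarrow> \<phi> a \<in> module_hom K (coord_space K (rep_dim K X a)) (sp X a)"
    "\<And>a. a \<in> vertices Q \<Longrightarrow> bij_betw (\<phi> a) (carrier (coord_space K (rep_dim K X a))) (carrier (sp X a))"
    by metis
  have "rep_hom K Q (semisimple K (rep_dim K X)) X \<phi>"
  proof (rule rep_homI)
    fix a b x assume ab: "(a, b) \<in> arrows Q" and x: "x \<in> carrier (sp (semisimple K (rep_dim K X)) a)"
    have v: "a \<in> vertices Q" "b \<in> vertices Q" using arrow[OF ab] by auto
    have "\<phi> b \<zero>\<^bsub>coord_space K (rep_dim K X b)\<^esub> = \<zero>\<^bsub>sp X b\<^esub>"
      by (rule module_hom_zero[OF coord_space(1)[OF K] D(1)[OF v(2)] \<phi>(1)[OF v(2)]])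
    moreover have "\<phi> a x \<in> carrier (sp X a)"
      using module_hom_carrier[OF \<phi>(1)[OF v(1)]] x by (simp add: semisimple_def)
    ultimately show "\<phi> b (ar (semisimple K (rep_dim K X)) a b x) = ar X a b (\<phi> a x)"
      using z[OF ab] by (simp add: semisimple_def coord_space_def)
  qed (use \<phi> in \<open>simp add: semisimple_def\<close>)
  then show ?thesis using \<phi>(2) unfolding rep_iso_def by (intro exI[of _ \<phi>]) (simp add: semisimple_def)
qed

text \<open>The arrows of the copy are obtained by conjugation with coordinate maps. This gives meaning to the
class of a module over an arbitrary carrier type.\<close>

lemma universe_iso:
  fixes X :: "('v, 'k, 'u) rep"
  assumes X: "fd_rep K Q X"
  obtains Y :: "('v, 'k, nat \<Rightarrow> 'k) rep" where "fd_rep K Q Y" "rep_iso K Q Y X"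
proof -
  note D = fd_repD[OF X]
  let ?C = "\<lambda>a. coord_space K (rep_dim K X a)"
  have "\<exists>\<phi>. \<phi> \<in> module_hom K (?C a) (sp X a) \<and>
      bij_betw \<phi> (carrier (?C a)) (carrier (sp X a))" if "a \<in> vertices Q" for a
    using coord_space_iso[OF D(1)[OF that] D(2)[OF that]] by metis
  then obtain \<phi> where \<phi>: "\<And>a. a \<in> vertices Q \<Longrightarrow> \<phi> a \<in> module_hom K (?C a) (sp X a)"
    "\<And>a. a \<in> vertices Q \<Longrightarrow> bij_betw (\<phi> a) (carrier (?C a)) (carrier (sp X a))"
    by metis
  define \<psi> where "\<psi> a = inv_into (carrier (?C a)) (\<phi> a)" for a
  have \<psi>: "\<psi> a \<in> module_hom K (sp X a) (?C a)" if "a \<in> vertices Q" for a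
    unfolding \<psi>_def by (rule module_hom_inv[OF coord_space(1)[OF K] \<phi>(1)[OF that] \<phi>(2)[OF that]])
  have \<phi>\<psi>: "\<phi> a (\<psi> a x) = x" if "a \<in> vertices Q" "x \<in> carrier (sp X a)" for a x
    unfolding \<psi>_def using \<phi>(2)[OF that(1)] that(2) by (auto simp: bij_betw_def f_inv_into_f)
  define Y where "Y = \<lparr>sp = ?C, ar = (\<lambda>a b x. \<psi> b (ar X a b (\<phi> a x)))\<rparr>"
  have Y: "fd_rep K Q Y"
  proof (rule fd_repI)
    show "vectorspace K (sp Y a)" "vectorspace.fin_dim K (sp Y a)" for a
      using coord_space[OF K] by (simp_all add: Y_def)
    fix a b assume ab: "(a, b) \<in> arrows Q"
    then show "ar Y a b \<in> module_hom K (sp Y a) (sp Y b)"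
      using module_hom_comp[OF module_hom_comp[OF \<phi>(1) D(3)[OF ab]] \<psi>] arrow[OF ab] by (simp add: Y_def)
  next
    fix a b c d x assume sq: "(a, b, c, d) \<in> squares Q" and "x \<in> carrier (sp Y a)"
    note s = square[OF sq]
    have v: "a \<in> vertices Q" "b \<in> vertices Q" "c \<in> vertices Q" "d \<in> vertices Q"
      using s arrow by blast+
    have x: "\<phi> a x \<in> carrier (sp X a)"
      using module_hom_carrier[OF \<phi>(1)[OF v(1)]] \<open>x \<in> carrier (sp Y a)\<close> by (simp add: Y_def)
    have "ar X a b (\<phi> a x) \<in> carrier (sp X b)" "ar X a c (\<phi> a x) \<in> carrier (sp X c)"
      using module_hom_carrier[OF D(3)] s x by blast+
    then show "ar Y b d (ar Y a b x) = ar Y c d (ar Y a c x)"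
      using D(4)[OF sq x] v by (simp add: Y_def \<phi>\<psi>)
  qed
  have "rep_hom K Q Y X \<phi>"
  proof (rule rep_homI)
    fix a b x assume ab: "(a, b) \<in> arrows Q" and "x \<in> carrier (sp Y a)"
    have v: "a \<in> vertices Q" "b \<in> vertices Q" using arrow[OF ab] by auto
    have "\<phi> a x \<in> carrier (sp X a)"
      using module_hom_carrier[OF \<phi>(1)[OF v(1)]] \<open>x \<in> carrier (sp Y a)\<close> by (simp add: Y_def)
    then show "\<phi> b (ar Y a b x) = ar X a b (\<phi> a x)"
      using module_hom_carrier[OF D(3)[OF ab]] v by (simp add: Y_def \<phi>\<psi>)
  qed (use \<phi> in \<open>simp add: Y_def\<close>)
  then have "rep_iso K Q Y X" using \<phi>(2) unfolding rep_iso_def by (intro exI[of _ \<phi>]) (simp add: Y_def)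
  then show ?thesis using that Y by blast
qed

subsection \<open>Classes and dimension vectors\<close>

abbreviation cl :: "('v, 'k, nat \<Rightarrow> 'k) rep \<Rightarrow> (('v, 'k, nat \<Rightarrow> 'k) rep \<Rightarrow>\<^sub>0 int) set" where
  "cl \<equiv> pres_class (K0_gens K Q) (K0_rels K Q)"

lemma K0_rels_carrier: "K0_rels K Q \<subseteq> carrier (free_Abelian_group (K0_gens K Q))"
proof
  fix r assume "r \<in> K0_rels K Q"
  then obtain X Y Z f g where r: "r = frag_of Y - frag_of X - frag_of Z" and e: "short_exact K Q X Y Z f g"
    unfolding K0_rels_def by blast
  have "Poly_Mapping.keys r \<subseteq> {X, Y, Z}"
    unfolding r using keys_diff[of "frag_of Y - frag_of X" "frag_of Z"] keys_diff[of "frag_of Y" "frag_of X"] by auto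
  then show "r \<in> carrier (free_Abelian_group (K0_gens K Q))"
    using short_exactD(1-3)[OF e] by (auto simp: K0_gens_def)
qed

lemma K0_comm: "comm_group (K0 K Q)"
  unfolding K0_def by (rule pres_group_comm[OF K0_rels_carrier])

lemma cl_closed: "fd_rep K Q X \<Longrightarrow> cl X \<in> carrier (K0 K Q)"
  unfolding K0_def by (rule pres_class_closed[OF K0_rels_carrier]) (simp add: K0_gens_def)

lemma cl_exact:
  assumes "short_exact K Q X Y Z f g"
  shows "cl Y = cl X \<otimes>\<^bsub>K0 K Q\<^esub> cl Z"
  unfolding K0_def
proof (rule pres_class_add_rel[OF K0_rels_carrier])
  show "frag_of Y - frag_of X - frag_of Z \<in> K0_rels K Q"
    unfolding K0_rels_def using assms by blast
qed (use short_exactD(1-3)[OF assms] in \<open>simp add: K0_gens_def\<close>)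

text \<open>For a zero representation the sequence \<open>0 \<rightarrow> X \<rightarrow> X \<rightarrow> X \<rightarrow> 0\<close> is exact, whence \<open>[X] = [X] + [X]\<close>.\<close>

lemma cl_zero:
  assumes X: "fd_rep K Q X" and z: "\<And>a. a \<in> vertices Q \<Longrightarrow> carrier (sp X a) = {\<zero>\<^bsub>sp X a\<^esub>}"
  shows "cl X = \<one>\<^bsub>K0 K Q\<^esub>"
proof -
  interpret G: comm_group "K0 K Q" by (rule K0_comm)
  have "short_exact K Q X X X (\<lambda>a x. x) (\<lambda>a x. x)"
    unfolding short_exact_def using X z by (auto simp: rep_hom_def module_hom_def)
  then show ?thesis using cl_exact[of X X X] cl_closed[OF X] by simp
qed

text \<open>An isomorphism is a short exact sequence with zero quotient.\<close>

lemma cl_iso: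
  assumes X: "fd_rep K Q X" and Y: "fd_rep K Q Y" and i: "rep_iso K Q X Y"
  shows "cl X = cl Y"
proof -
  interpret G: comm_group "K0 K Q" by (rule K0_comm)
  obtain f where f: "rep_hom K Q X Y f"
    "\<And>a. a \<in> vertices Q \<Longrightarrow> bij_betw (f a) (carrier (sp X a)) (carrier (sp Y a))"
    using i by (auto simp: rep_iso_def)
  have Z: "fd_rep K Q (restr {} Y)" by (rule restr_fd[OF Y]) simp
  have h: "rep_hom K Q Y (restr {} Y) (\<lambda>a x. \<zero>\<^bsub>sp Y a\<^esub>)"
  proof (rule rep_homI)
    show "(\<lambda>x. \<zero>\<^bsub>sp Y a\<^esub>) \<in> module_hom K (sp Y a) (sp (restr {} Y) a)" if "a \<in> vertices Q" for a
    proof -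
      interpret A: vectorspace K "sp Y a" by (rule fd_repD(1)[OF Y that])
      show ?thesis by (intro module_homI) (auto simp: restr_def)
    qed
  qed (simp add: restr_def)
  have "short_exact K Q X Y (restr {} Y) f (\<lambda>a x. \<zero>\<^bsub>sp Y a\<^esub>)"
    unfolding short_exact_def
  proof (intro conjI ballI X Y Z f(1) h)
    fix a assume a: "a \<in> vertices Q"
    show "inj_on (f a) (carrier (sp X a))" "f a ` carrier (sp X a) =
        {y \<in> carrier (sp Y a). \<zero>\<^bsub>sp Y a\<^esub> = \<zero>\<^bsub>sp (restr {} Y) a\<^esub>}"
      using f(2)[OF a] by (auto simp: bij_betw_def restr_def)
    show "(\<lambda>x. \<zero>\<^bsub>sp Y a\<^esub>) ` carrier (sp Y a) = carrier (sp (restr {} Y) a)"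
      using vectorspaceD(2)[OF fd_repD(1)[OF Y a]] by (auto simp: restr_def)
  qed
  then have "cl Y = cl X \<otimes>\<^bsub>K0 K Q\<^esub> cl (restr {} Y)" by (rule cl_exact)
  also have "cl (restr {} Y) = \<one>\<^bsub>K0 K Q\<^esub>" by (rule cl_zero[OF Z]) (simp add: restr_def)
  finally show ?thesis using cl_closed[OF X] by simp
qed

text \<open>Dimension vectors as elements of the free abelian group on the vertices, so that \<open>lin_ext\<close> turns them
into combinations of classes.\<close>

definition dimvec :: "('v \<Rightarrow> nat) \<Rightarrow> ('v \<Rightarrow>\<^sub>0 int)" where
  "dimvec d = (\<Sum>a\<in>vertices Q. frag_cmul (int (d a)) (frag_of a))"

lemma dimvec_keys: "Poly_Mapping.keys (dimvec d) \<subseteq> vertices Q"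
proof -
  have "dimvec d \<in> carrier (free_Abelian_group (vertices Q))"
    unfolding dimvec_def
    by (rule sum_closed_free_Abelian_group) (auto dest!: subsetD[OF keys_cmul])
  then show ?thesis by simp
qed

lemma dimvec_add:
  assumes "\<And>a. a \<in> vertices Q \<Longrightarrow> d a = d' a + d'' a"
  shows "dimvec d = dimvec d' + dimvec d''"
  using assms by (simp add: dimvec_def frag_cmul_distrib sum.distrib)

lemma dimvec_cong: "(\<And>a. a \<in> vertices Q \<Longrightarrow> d a = d' a) \<Longrightarrow> dimvec d = dimvec d'"
  by (simp add: dimvec_def)

lemma dimvec_indicator:
  assumes "S \<subseteq> vertices Q"
  shows "dimvec (\<lambda>a. if a \<in> S then 1 else 0) = (\<Sum>a\<in>S. frag_of a)"
proof -
  have "dimvec (\<lambda>a. if a \<in> S then 1 else 0) = (\<Sum>a\<in>vertices Q. if a \<in> S then frag_of a else 0)"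
    unfolding dimvec_def by (rule sum.cong) auto
  also have "\<dots> = (\<Sum>a\<in>S. frag_of a)"
    using assms fin by (simp add: sum.inter_restrict[symmetric] Int_absorb1)
  finally show ?thesis .
qed

abbreviation unit_semisimple :: "'v \<Rightarrow> ('v, 'k, nat \<Rightarrow> 'k) rep" where
  "unit_semisimple v \<equiv> semisimple K (\<lambda>a. if a = v then 1 else 0)"

text \<open>One dimension is removed at a time: \<open>k\<^sup>(\<^sup>d\<^sup>-\<^sup>1\<^sup>)\<close> is the kernel of the last coordinate on \<open>k\<^sup>d\<close>.\<close>

lemma cl_semisimple: "cl (semisimple K d) = lin_ext (K0 K Q) (\<lambda>v. cl (unit_semisimple v)) (dimvec d)"
proof (induction "\<Sum>a\<in>vertices Q. d a" arbitrary: d)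
  case 0
  then have d: "d a = 0" if "a \<in> vertices Q" for a using fin that by simp
  then have "dimvec d = 0" by (simp add: dimvec_def)
  moreover have "cl (semisimple K d) = \<one>\<^bsub>K0 K Q\<^esub>"
    by (rule cl_zero[OF semisimple_fd]) (simp add: semisimple_def d coord_space_0)
  moreover have "lin_ext (K0 K Q) (\<lambda>v. cl (unit_semisimple v)) 0 = \<one>\<^bsub>K0 K Q\<^esub>"
  proof -
    interpret G: comm_group "K0 K Q" by (rule K0_comm)
    show ?thesis by (simp add: lin_ext_def)
  qed
  ultimately show ?case by simp
next
  case (Suc n)
  interpret K: field K by (rule K)
  have "(\<Sum>a\<in>vertices Q. d a) \<noteq> 0" using Suc.hyps(2) by simp
  then obtain v where v: "v \<in> vertices Q" "d v \<noteq> 0" by (meson sum.neutral)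
  define d' where "d' = d(v := d v - 1)"
  define e where "e = (\<lambda>a. if a = v then 1 else 0 :: nat)"
  have de: "d a = d' a + e a" for a using v by (simp add: d'_def e_def)
  have "(\<Sum>a\<in>vertices Q. d a) = (\<Sum>a\<in>vertices Q. d' a) + (\<Sum>a\<in>vertices Q. e a)"
    by (simp add: de sum.distrib)
  also have "(\<Sum>a\<in>vertices Q. e a) = 1" using v fin by (simp add: e_def)
  finally have n: "n = (\<Sum>a\<in>vertices Q. d' a)" using Suc.hyps(2) by simp
  \<comment> \<open>The last coordinate at \<open>v\<close>, regarded as a vector with a single entry.\<close>
  let ?g = "\<lambda>a x i. if a = v \<and> i = (0::nat) then x (d v - 1) else \<zero>\<^bsub>K\<^esub>"
  have n': "x i \<in> carrier K" if "x \<in> carrier (coord_space K k)" for x i k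
    by (rule coord_space_nth[OF K that])
  have 1: "rep_hom K Q (semisimple K d') (semisimple K d) (\<lambda>a x. x)"
  proof (rule rep_homI)
    show "(\<lambda>x. x) \<in> module_hom K (sp (semisimple K d') a) (sp (semisimple K d) a)" for a
    proof (rule module_homI)
      fix x assume x: "x \<in> carrier (sp (semisimple K d') a)"
      have "d' a \<le> d a" by (simp add: de)
      then have "x i \<in> carrier K" "i \<ge> d a \<Longrightarrow> x i = \<zero>\<^bsub>K\<^esub>" for i
        using x n'[of x "d' a" i] by (auto simp: semisimple_def coord_space_def)
      then show "x \<in> carrier (sp (semisimple K d) a)" by (auto simp: semisimple_def coord_space_def)
    qed (auto simp: semisimple_def coord_space_def)
  qed (auto simp: semisimple_def)
  have 2: "rep_hom K Q (semisimple K d) (semisimple K e) ?g"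
  proof (rule rep_homI)
    show "?g a \<in> module_hom K (sp (semisimple K d) a) (sp (semisimple K e) a)" for a
    proof (rule module_homI)
      fix x assume x: "x \<in> carrier (sp (semisimple K d) a)"
      have "x i \<in> carrier K" for i using x n'[of x "d a" i] by (simp add: semisimple_def)
      then show "?g a x \<in> carrier (sp (semisimple K e) a)" by (simp add: semisimple_def coord_space_def e_def)
    qed (auto simp: semisimple_def coord_space_def fun_eq_iff)
  qed (auto simp: semisimple_def)
  have 3: "short_exact K Q (semisimple K d') (semisimple K d) (semisimple K e) (\<lambda>a x. x) ?g"
    unfolding short_exact_def
  proof (intro conjI ballI semisimple_fd 1 2)
    fix a
    show "inj_on (\<lambda>x. x) (carrier (sp (semisimple K d') a))" by simp
    show "(\<lambda>x. x) ` carrier (sp (semisimple K d') a) =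
        {y \<in> carrier (sp (semisimple K d) a). ?g a y = \<zero>\<^bsub>sp (semisimple K e) a\<^esub>}"
    proof (cases "a = v")
      case False
      then have "d' a = d a" "\<And>y. ?g a y = \<zero>\<^bsub>sp (semisimple K e) a\<^esub>"
        by (auto simp: d'_def semisimple_def coord_space_def)
      then show ?thesis by (simp add: semisimple_def)
    next
      case True
      have g: "?g a y = \<zero>\<^bsub>sp (semisimple K e) a\<^esub> \<longleftrightarrow> y (d v - 1) = \<zero>\<^bsub>K\<^esub>" for y
        using True by (auto simp: semisimple_def coord_space_def fun_eq_iff)
      have da: "d v = Suc (d' a)" using v True by (simp add: d'_def)
      have "d a = Suc (d' a)" "d v - 1 = d' a" using da True by simp_all
      then have "carrier (coord_space K (d' a)) =
          {y \<in> carrier (coord_space K (d a)). y (d v - 1) = \<zero>\<^bsub>K\<^esub>}"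
        using coord_space_Suc[OF K, of "d' a"] by (simp only:)
      then show ?thesis unfolding g by (simp add: semisimple_def)
    qed
    show "?g a ` carrier (sp (semisimple K d) a) = carrier (sp (semisimple K e) a)"
    proof
      show "?g a ` carrier (sp (semisimple K d) a) \<subseteq> carrier (sp (semisimple K e) a)"
        using n' by (auto simp: semisimple_def coord_space_def e_def)
      show "carrier (sp (semisimple K e) a) \<subseteq> ?g a ` carrier (sp (semisimple K d) a)"
      proof
        fix y assume y: "y \<in> carrier (sp (semisimple K e) a)"
        let ?x = "\<lambda>i. if a = v \<and> i = d v - 1 then y 0 else \<zero>\<^bsub>K\<^esub>"
        have "y = ?g a ?x" using y by (auto simp: semisimple_def coord_space_def e_def fun_eq_iff)
        moreover have "y 0 \<in> carrier K" using y n'[of y "e a" 0] by (simp add: semisimple_def)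
        then have "?x \<in> carrier (sp (semisimple K d) a)" using v by (auto simp: semisimple_def coord_space_def)
        ultimately show "y \<in> ?g a ` carrier (sp (semisimple K d) a)" by (rule image_eqI)
      qed
    qed
  qed
  have c: "(\<lambda>v. cl (unit_semisimple v)) \<in> vertices Q \<rightarrow> carrier (K0 K Q)" using cl_closed[OF semisimple_fd] by auto
  have "cl (semisimple K d) = cl (semisimple K d') \<otimes>\<^bsub>K0 K Q\<^esub> cl (unit_semisimple v)"
    using cl_exact[OF 3] by (simp add: e_def)
  also have "cl (semisimple K d') = lin_ext (K0 K Q) (\<lambda>v. cl (unit_semisimple v)) (dimvec d')"
    by (rule Suc.hyps(1)[OF n])
  also have "cl (unit_semisimple v) = lin_ext (K0 K Q) (\<lambda>v. cl (unit_semisimple v)) (dimvec e)"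
  proof -
    have "dimvec e = frag_of v" using dimvec_indicator[of "{v}"] v by (simp add: e_def)
    then show ?thesis using lin_ext_frag_of[OF K0_comm, of "\<lambda>v. cl (unit_semisimple v)" v] cl_closed[OF semisimple_fd] by simp
  qed
  also have "lin_ext (K0 K Q) (\<lambda>v. cl (unit_semisimple v)) (dimvec d') \<otimes>\<^bsub>K0 K Q\<^esub>
      lin_ext (K0 K Q) (\<lambda>v. cl (unit_semisimple v)) (dimvec e) =
      lin_ext (K0 K Q) (\<lambda>v. cl (unit_semisimple v)) (dimvec d' + dimvec e)"
    using hom_mult[OF lin_ext_hom[OF K0_comm c], of "dimvec d'" "dimvec e"] dimvec_keys by simp
  also have "dimvec d' + dimvec e = dimvec d" by (rule dimvec_add[symmetric]) (rule de)
  finally show ?case .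
qed

text \<open>Induction on the size of the support: a vertex of maximal rank in the support splits off by
\<open>split_vertex\<close>. Where all arrows act as zero the representation is semisimple.\<close>

lemma cl_dimvec:
  assumes "fd_rep K Q X"
  shows "cl X = lin_ext (K0 K Q) (\<lambda>v. cl (unit_semisimple v)) (dimvec (rep_dim K X))"
  using assms
proof (induction "card {a \<in> vertices Q. carrier (sp X a) \<noteq> {\<zero>\<^bsub>sp X a\<^esub>}}" arbitrary: X rule: less_induct)
  case (less X)
  note X = less.prems
  let ?N = "{a \<in> vertices Q. carrier (sp X a) \<noteq> {\<zero>\<^bsub>sp X a\<^esub>}}"
  have zero_arrows: "cl Y = lin_ext (K0 K Q) (\<lambda>v. cl (unit_semisimple v)) (dimvec (rep_dim K Y))"
    if Y: "fd_rep K Q Y" and z: "\<And>a b x. (a, b) \<in> arrows Q \<Longrightarrow> x \<in> carrier (sp Y a) \<Longrightarrow> ar Y a b x = \<zero>\<^bsub>sp Y b\<^esub>" for Y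
    by (rule trans[OF cl_iso[OF semisimple_fd Y semisimple_iso[OF Y z], symmetric] cl_semisimple])
  show ?case
  proof (cases "?N = {}")
    case True
    show ?thesis
    proof (rule zero_arrows[OF X])
      fix a b x assume ab: "(a, b) \<in> arrows Q" "x \<in> carrier (sp X a)"
      then have "carrier (sp X b) = {\<zero>\<^bsub>sp X b\<^esub>}" using True arrow by blast
      then show "ar X a b x = \<zero>\<^bsub>sp X b\<^esub>" using module_hom_carrier[OF fd_repD(3)[OF X ab(1)] ab(2)] by simp
    qed
  next
    case False
    have finN: "finite ?N" using fin by simp
    have "Max (rk ` ?N) \<in> rk ` ?N"
      by (rule Max_in) (use finN False in \<open>simp_all only: finite_imageI image_is_empty not_False_eq_True\<close>)
    then obtain v where v: "Max (rk ` ?N) = rk v" "v \<in> ?N" by (rule imageE)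
    have max: "rk b \<le> rk v" if "b \<in> ?N" for b
      unfolding v(1)[symmetric] by (rule Max_ge[OF finite_imageI[OF finN] imageI[OF that]])
    have top: "carrier (sp X b) = {\<zero>\<^bsub>sp X b\<^esub>}" if "(v, b) \<in> arrows Q" for b
      using arrow[OF that] max[of b] by auto
    note e = split_vertex[OF X top]
    note fd = short_exactD(1,3)[OF e]
    have sub: "{a \<in> vertices Q. carrier (sp (restr (- {v}) X) a) \<noteq> {\<zero>\<^bsub>sp (restr (- {v}) X) a\<^esub>}} \<subset> ?N"
    proof (rule psubsetI)
      show "{a \<in> vertices Q. carrier (sp (restr (- {v}) X) a) \<noteq> {\<zero>\<^bsub>sp (restr (- {v}) X) a\<^esub>}} \<subseteq> ?N"
        by (rule Collect_mono) (simp add: restr_def split: if_splits)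
      have "v \<notin> {a \<in> vertices Q. carrier (sp (restr (- {v}) X) a) \<noteq> {\<zero>\<^bsub>sp (restr (- {v}) X) a\<^esub>}}"
        by (simp add: restr_def)
      then show "{a \<in> vertices Q. carrier (sp (restr (- {v}) X) a) \<noteq> {\<zero>\<^bsub>sp (restr (- {v}) X) a\<^esub>}} \<noteq> ?N"
        using v(2) by metis
    qed
    have IH: "cl (restr (- {v}) X) = lin_ext (K0 K Q) (\<lambda>v. cl (unit_semisimple v)) (dimvec (rep_dim K (restr (- {v}) X)))"
      by (rule less.hyps[OF psubset_card_mono[OF finN sub] fd(2)])
    have S: "cl (restr {v} X) = lin_ext (K0 K Q) (\<lambda>v. cl (unit_semisimple v)) (dimvec (rep_dim K (restr {v} X)))"
    proof (rule zero_arrows[OF fd(1)])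
      fix a b x assume "(a, b) \<in> arrows Q"
      then have "\<not> (a \<in> {v} \<and> b \<in> {v})" using arrow by fastforce
      then show "ar (restr {v} X) a b x = \<zero>\<^bsub>sp (restr {v} X) b\<^esub>" by (auto simp: restr_def)
    qed
    have c: "(\<lambda>v. cl (unit_semisimple v)) \<in> vertices Q \<rightarrow> carrier (K0 K Q)" using cl_closed[OF semisimple_fd] by auto
    have d: "dimvec (rep_dim K X) = dimvec (rep_dim K (restr {v} X)) + dimvec (rep_dim K (restr (- {v}) X))"
      by (rule dimvec_add) (rule short_exact_dim[OF e])
    have "cl X = cl (restr {v} X) \<otimes>\<^bsub>K0 K Q\<^esub> cl (restr (- {v}) X)" by (rule cl_exact[OF e])
    also have "\<dots> = lin_ext (K0 K Q) (\<lambda>v. cl (unit_semisimple v)) (dimvec (rep_dim K X))"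
      unfolding d S IH
      using hom_mult[OF lin_ext_hom[OF K0_comm c], of "dimvec (rep_dim K (restr {v} X))"
          "dimvec (rep_dim K (restr (- {v}) X))"]
      by (simp only: carrier_free_Abelian_group_iff dimvec_keys mult_free_Abelian_group)
    finally show ?thesis .
  qed
qed

text \<open>The chosen representative is only known up to isomorphism, and only through this lemma is it used.\<close>

lemma K0_class_obtain:
  fixes X :: "('v, 'k, 'u) rep"
  assumes X: "fd_rep K Q X"
  obtains Y where "fd_rep K Q Y" "rep_iso K Q Y X" "K0_class K Q X = cl Y"
proof -
  have "\<exists>Y :: ('v, 'k, nat \<Rightarrow> 'k) rep. fd_rep K Q Y \<and> rep_iso K Q Y X"
    by (rule universe_iso[OF X]) (intro exI conjI)
  note Y = someI_ex[OF this]
  show ?thesis by (rule that[OF conjunct1[OF Y] conjunct2[OF Y]]) (simp add: K0_class_def)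
qed

abbreviation simple_class :: "'v \<Rightarrow> (('v, 'k, nat \<Rightarrow> 'k) rep \<Rightarrow>\<^sub>0 int) set" where
  "simple_class v \<equiv> K0_class K Q (standard_rep K {v})"

lemma simple_fd: "fd_rep K Q (standard_rep K {v})"
  by (rule standard_rep_fd[OF K]) (use no_square_on_a_cycle in blast)

lemma K0_class_dimvec_unit:
  fixes X :: "('v, 'k, 'u) rep"
  assumes X: "fd_rep K Q X"
  shows "K0_class K Q X = lin_ext (K0 K Q) (\<lambda>v. cl (unit_semisimple v)) (dimvec (rep_dim K X))"
proof -
  obtain Y where Y: "fd_rep K Q Y" "rep_iso K Q Y X" "K0_class K Q X = cl Y" by (rule K0_class_obtain[OF X])
  have "dimvec (rep_dim K Y) = dimvec (rep_dim K X)"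
    by (rule dimvec_cong) (rule rep_iso_dim[OF Y(1) X Y(2)])
  then show ?thesis using Y(3) cl_dimvec[OF Y(1)] by simp
qed

lemma simple_class_unit:
  assumes "v \<in> vertices Q" shows "simple_class v = cl (unit_semisimple v)"
proof -
  have "dimvec (rep_dim K (standard_rep K {v})) = frag_of v"
    using dimvec_indicator[of "{v}"] assms by (simp add: standard_rep_dim[OF K])
  then show ?thesis
    using K0_class_dimvec_unit[OF simple_fd[of v]]
      lin_ext_frag_of[OF K0_comm, of "\<lambda>v. cl (unit_semisimple v)" v] cl_closed[OF semisimple_fd] by simp
qed

lemma simple_class_closed: "v \<in> vertices Q \<Longrightarrow> simple_class v \<in> carrier (K0 K Q)"
  using cl_closed[OF semisimple_fd] by (simp add: simple_class_unit)

text \<open>The class depends on the dimension vector alone, so that computations in the Grothendieck group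
become computations with dimensions.\<close>

lemma K0_class_dimvec:
  fixes X :: "('v, 'k, 'u) rep"
  assumes X: "fd_rep K Q X"
  shows "K0_class K Q X = lin_ext (K0 K Q) simple_class (dimvec (rep_dim K X))"
proof -
  interpret G: comm_group "K0 K Q" by (rule K0_comm)
  have "lin_ext (K0 K Q) simple_class (dimvec (rep_dim K X)) = lin_ext (K0 K Q) (\<lambda>v. cl (unit_semisimple v)) (dimvec (rep_dim K X))"
    unfolding lin_ext_def
  proof (rule G.finprod_cong'[OF refl])
    show "(\<lambda>v. cl (unit_semisimple v) [^]\<^bsub>K0 K Q\<^esub> Poly_Mapping.lookup (dimvec (rep_dim K X)) v)
        \<in> Poly_Mapping.keys (dimvec (rep_dim K X)) \<rightarrow> carrier (K0 K Q)"
      by (rule Pi_I) (rule G.int_pow_closed[OF cl_closed[OF semisimple_fd]])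
    fix v assume "v \<in> Poly_Mapping.keys (dimvec (rep_dim K X))"
    then have "v \<in> vertices Q" using dimvec_keys by blast
    then show "simple_class v [^]\<^bsub>K0 K Q\<^esub> Poly_Mapping.lookup (dimvec (rep_dim K X)) v =
        cl (unit_semisimple v) [^]\<^bsub>K0 K Q\<^esub> Poly_Mapping.lookup (dimvec (rep_dim K X)) v"
      by (simp only: simple_class_unit)
  qed
  then show ?thesis using K0_class_dimvec_unit[OF X] by simp
qed

lemma K0_class_cl: "fd_rep K Q X \<Longrightarrow> K0_class K Q X = cl X"
  by (simp add: K0_class_dimvec_unit cl_dimvec)

text \<open>Dimensions are additive on short exact sequences. These homomorphisms are the coordinates that
show the simple classes to be independent.\<close>

lemma dim_hom:
  assumes "v \<in> vertices Q"
  shows "\<exists>c\<in>hom (K0 K Q) integer_group. \<forall>X. fd_rep K Q X \<longrightarrow> c (cl X) = int (rep_dim K X v)"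
proof -
  let ?f = "\<lambda>X. int (rep_dim K X v)"
  have f: "?f \<in> K0_gens K Q \<rightarrow> carrier integer_group" by simp
  have r: "lin_ext integer_group ?f r = \<one>\<^bsub>integer_group\<^esub>" if "r \<in> K0_rels K Q" for r
  proof -
    obtain X Y Z f g where r: "r = frag_of Y - frag_of X - frag_of Z" and e: "short_exact K Q X Y Z f g"
      using \<open>r \<in> K0_rels K Q\<close> unfolding K0_rels_def by blast
    show ?thesis
      unfolding r
      by (rule lin_ext_add_rel[OF integer_group_comm f])
         (use short_exactD(1-3)[OF e] short_exact_dim[OF e assms] in \<open>auto simp: K0_gens_def\<close>)
  qed
  show ?thesis
  proof (rule bexI[OF _ pres_lift_hom[OF K0_rels_carrier integer_group_comm f r, folded K0_def]], intro allI impI)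
    fix X :: "('v, 'k, nat \<Rightarrow> 'k) rep" assume "fd_rep K Q X"
    then have X: "X \<in> K0_gens K Q" by (simp add: K0_gens_def)
    show "pres_lift integer_group ?f (cl X) = int (rep_dim K X v)"
      using pres_lift_class[OF K0_rels_carrier integer_group_comm f r X] by simp
  qed
qed

lemma Z_basis_K0: "Z_basis (K0 K Q) simple_class (vertices Q)"
proof (rule Z_basisI[OF K0_comm])
  show b: "simple_class \<in> vertices Q \<rightarrow> carrier (K0 K Q)" using simple_class_closed by auto
  let ?I = "lin_ext (K0 K Q) simple_class ` carrier (free_Abelian_group (vertices Q))"
  show "carrier (K0 K Q) \<subseteq> ?I"
  proof
    fix x assume x: "x \<in> carrier (K0 K Q)"
    show "x \<in> ?I"
    proof (rule pres_subgroup[OF K0_rels_carrier, folded K0_def])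
      show "subgroup ?I (K0 K Q)" by (rule lin_ext_image_subgroup[OF K0_comm b])
      fix X assume "X \<in> K0_gens K Q"
      then have X: "fd_rep K Q X" by (simp add: K0_gens_def)
      have "lin_ext (K0 K Q) simple_class (dimvec (rep_dim K X)) \<in> ?I"
        by (rule imageI) (simp add: dimvec_keys)
      then show "cl X \<in> ?I" using K0_class_dimvec[OF X] K0_class_cl[OF X] by simp
    qed (rule x)
  qed
  fix v assume v: "v \<in> vertices Q"
  from dim_hom[OF v] obtain c where c: "c \<in> hom (K0 K Q) integer_group"
    "\<forall>X. fd_rep K Q X \<longrightarrow> c (cl X) = int (rep_dim K X v)" ..
  have "c (simple_class w) = (if w = v then 1 else 0)" for w
  proof -
    obtain Y where Y: "fd_rep K Q Y" "rep_iso K Q Y (standard_rep K {w})" "simple_class w = cl Y"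
      by (rule K0_class_obtain[OF simple_fd[of w]])
    show ?thesis
      using rep_iso_dim[OF Y(1) simple_fd Y(2) v] c(2)[rule_format, OF Y(1)] Y(3) by (simp add: standard_rep_dim[OF K])
  qed
  then show "\<exists>c\<in>hom (K0 K Q) integer_group. \<forall>w\<in>vertices Q. c (simple_class w) = (if w = v then 1 else 0)"
    using c(1) by blast
qed

end

lemma (in ranked_quiver) K0_class_closed:
  assumes "fd_rep K Q X" shows "K0_class K Q X \<in> carrier (K0 K Q)"
proof -
  have "simple_class \<in> vertices Q \<rightarrow> carrier (K0 K Q)" using simple_class_closed by auto
  from hom_in_carrier[OF lin_ext_hom[OF K0_comm this], of "dimvec (rep_dim K X)"]
  show ?thesis unfolding K0_class_dimvec[OF assms] by (simp add: dimvec_keys)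
qed

lemma (in ranked_quiver) K0_class_add:
  assumes "fd_rep K Q X" "fd_rep K Q Y" "fd_rep K Q Z"
    and "\<And>a. a \<in> vertices Q \<Longrightarrow> rep_dim K Y a = rep_dim K X a + rep_dim K Z a"
  shows "K0_class K Q Y = K0_class K Q X \<otimes>\<^bsub>K0 K Q\<^esub> K0_class K Q Z"
proof -
  have s: "simple_class \<in> vertices Q \<rightarrow> carrier (K0 K Q)" using simple_class_closed by auto
  have d: "dimvec (rep_dim K Y) = dimvec (rep_dim K X) + dimvec (rep_dim K Z)"
    by (rule dimvec_add) (rule assms(4))
  show ?thesis
    unfolding K0_class_dimvec[OF assms(1)] K0_class_dimvec[OF assms(2)] K0_class_dimvec[OF assms(3)] d
    using hom_mult[OF lin_ext_hom[OF K0_comm s], of "dimvec (rep_dim K X)" "dimvec (rep_dim K Z)"]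
    by (simp add: dimvec_keys)
qed

lemma (in ranked_quiver) K0_class_cong_dim:
  assumes "fd_rep K Q X" "fd_rep K Q Y" "\<And>a. a \<in> vertices Q \<Longrightarrow> rep_dim K X a = rep_dim K Y a"
  shows "K0_class K Q X = K0_class K Q Y"
proof -
  have "dimvec (rep_dim K X) = dimvec (rep_dim K Y)" by (rule dimvec_cong) (rule assms(3))
  then show ?thesis unfolding K0_class_dimvec[OF assms(1)] K0_class_dimvec[OF assms(2)] by simp
qed

text \<open>As the dimensions of \<open>F X\<close> are among those of \<open>X\<close>, they are additive on short exact sequences, and
therefore so are the classes of the \<open>F X\<close>.\<close>

lemma K0_map_hom:
  fixes F :: "('v, 'k, nat \<Rightarrow> 'k) rep \<Rightarrow> ('w, 'k, 'u) rep"
  assumes Q: "ranked_quiver K Q rk" and R: "ranked_quiver K R rk'"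
    and F: "\<And>X. fd_rep K Q X \<Longrightarrow> fd_rep K R (F X)"
    and dim: "\<And>X w. fd_rep K Q X \<Longrightarrow> w \<in> vertices R \<Longrightarrow> rep_dim K (F X) w = rep_dim K X (g w)"
    and g: "\<And>w. w \<in> vertices R \<Longrightarrow> g w \<in> vertices Q"
  shows "K0_map K R F \<in> hom (K0 K Q) (K0 K R)"
    and "fd_rep K Q X \<Longrightarrow> K0_map K R F (pres_class (K0_gens K Q) (K0_rels K Q) X) = K0_class K R (F X)"
proof -
  interpret Q: ranked_quiver K Q rk by (rule Q)
  interpret R: ranked_quiver K R rk' by (rule R)
  let ?f = "\<lambda>X. K0_class K R (F X)"
  have f: "?f \<in> K0_gens K Q \<rightarrow> carrier (K0 K R)"
    using R.K0_class_closed[OF F] by (auto simp: K0_gens_def)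
  have r: "lin_ext (K0 K R) ?f r = \<one>\<^bsub>K0 K R\<^esub>" if "r \<in> K0_rels K Q" for r
  proof -
    obtain X Y Z h k where r: "r = frag_of Y - frag_of X - frag_of Z" and e: "short_exact K Q X Y Z h k"
      using \<open>r \<in> K0_rels K Q\<close> unfolding K0_rels_def by blast
    note E = short_exactD(1-3)[OF e]
    have "?f Y = ?f X \<otimes>\<^bsub>K0 K R\<^esub> ?f Z"
      by (rule R.K0_class_add[OF F[OF E(1)] F[OF E(2)] F[OF E(3)]])
         (simp add: dim[OF E(1)] dim[OF E(2)] dim[OF E(3)] short_exact_dim[OF e g])
    then show ?thesis unfolding r
      by (intro lin_ext_add_rel[OF R.K0_comm f]) (use E in \<open>simp_all add: K0_gens_def\<close>)
  qed
  show "K0_map K R F \<in> hom (K0 K Q) (K0 K R)"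
    unfolding K0_map_def K0_def[of K Q] by (rule pres_lift_hom[OF Q.K0_rels_carrier R.K0_comm f r])
  assume "fd_rep K Q X"
  then have X: "X \<in> K0_gens K Q" by (simp add: K0_gens_def)
  show "K0_map K R F (pres_class (K0_gens K Q) (K0_rels K Q) X) = K0_class K R (F X)"
    unfolding K0_map_def using pres_lift_class[OF Q.K0_rels_carrier R.K0_comm f r X] by simp
qed

section \<open>Tensor products with bimodules\<close>

text \<open>A right \<open>R\<close>-module \<open>M\<close> with a commuting left action of \<open>Q\<close>. In a component \<open>(a, w)\<close> the first index
belongs to the left action, whose arrows are reversed.\<close>

locale bimodule =
  fixes K :: "('k, 'r) ring_scheme" and Q :: "'v quiver" and R :: "'w quiver"
    and M :: "('v \<times> 'w, 'k, 'b) rep"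
  assumes arrowQ: "(a, b) \<in> arrows Q \<Longrightarrow> a \<in> vertices Q \<and> b \<in> vertices Q"
    and arrowR: "(u, w) \<in> arrows R \<Longrightarrow> u \<in> vertices R \<and> w \<in> vertices R"
    and M: "fd_rep K (prod_quiver (op_quiver Q) R) M"
begin

abbreviation T :: "('v, 'k, 'u) rep \<Rightarrow> 'w \<Rightarrow> ('v \<times> 'u \<times> 'b \<Rightarrow>\<^sub>0 int) set monoid" where
  "T X w \<equiv> rep_tensor_group K Q X M w"

abbreviation tns :: "('v, 'k, 'u) rep \<Rightarrow> 'w \<Rightarrow> 'v \<Rightarrow> 'u \<Rightarrow> 'b \<Rightarrow> ('v \<times> 'u \<times> 'b \<Rightarrow>\<^sub>0 int) set" where
  "tns X w a x y \<equiv> rep_tens K Q X M w (a, x, y)"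

lemma M_space:
  assumes "a \<in> vertices Q" "w \<in> vertices R"
  shows "vectorspace K (sp M (a, w))"
  using fd_repD(1)[OF M, of "(a, w)"] assms by (simp add: prod_quiver_def op_quiver_def)

lemma M_left:
  assumes "(a, b) \<in> arrows Q" "w \<in> vertices R"
  shows "ar M (b, w) (a, w) \<in> module_hom K (sp M (b, w)) (sp M (a, w))"
  using fd_repD(3)[OF M, of "(b, w)" "(a, w)"] assms by (simp add: prod_quiver_def op_quiver_def)

lemma M_right:
  assumes "a \<in> vertices Q" "(u, w) \<in> arrows R"
  shows "ar M (a, u) (a, w) \<in> module_hom K (sp M (a, u)) (sp M (a, w))"
  using fd_repD(3)[OF M, of "(a, u)" "(a, w)"] assms by (simp add: prod_quiver_def op_quiver_def)

text \<open>The mixed squares of the product quiver say that the two actions commute. This is what makes the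
right action on the tensor product well defined.\<close>

lemma M_commute:
  assumes "(a, b) \<in> arrows Q" "(u, w) \<in> arrows R" "y \<in> carrier (sp M (b, u))"
  shows "ar M (a, u) (a, w) (ar M (b, u) (a, u) y) = ar M (b, w) (a, w) (ar M (b, u) (b, w) y)"
proof -
  have "((b, u), (a, u), (b, w), (a, w)) \<in> squares (prod_quiver (op_quiver Q) R)"
    using assms(1,2) by (auto simp: prod_quiver_def op_quiver_def)
  from fd_repD(4)[OF M this assms(3)] show ?thesis .
qed

lemma rels_closed:
  assumes X: "fd_rep K Q X" and w: "w \<in> vertices R"
  shows "rep_tensor_rels K Q X M w \<subseteq> carrier (free_Abelian_group (rep_tensor_gens Q X M w))"
proof
  let ?G = "rep_tensor_gens Q X M w"
  note XV = vectorspaceD[OF fd_repD(1)[OF X]] and MV = vectorspaceD[OF M_space[OF _ w]]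
  have 3: "frag_of p - frag_of q - frag_of s \<in> carrier (free_Abelian_group ?G)"
    if "p \<in> ?G" "q \<in> ?G" "s \<in> ?G" for p q s
    using keys_diff[of "frag_of p - frag_of q" "frag_of s"] keys_diff[of "frag_of p" "frag_of q"] that by auto
  have 2: "frag_of p - frag_of q \<in> carrier (free_Abelian_group ?G)" if "p \<in> ?G" "q \<in> ?G" for p q
    using keys_diff[of "frag_of p" "frag_of q"] that by auto
  have G: "(a, x, y) \<in> ?G \<longleftrightarrow> a \<in> vertices Q \<and> x \<in> carrier (sp X a) \<and> y \<in> carrier (sp M (a, w))" for a x y
    by (simp add: rep_tensor_gens_def)
  have al: "ar X a b x \<in> carrier (sp X b)" if "(a, b) \<in> arrows Q" "x \<in> carrier (sp X a)" for a b x
    using module_hom_carrier[OF fd_repD(3)[OF X that(1)] that(2)] .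
  have am: "ar M (b, w) (a, w) y \<in> carrier (sp M (a, w))" if "(a, b) \<in> arrows Q" "y \<in> carrier (sp M (b, w))" for a b y
    using module_hom_carrier[OF M_left[OF that(1) w] that(2)] .
  fix r assume "r \<in> rep_tensor_rels K Q X M w"
  then show "r \<in> carrier (free_Abelian_group ?G)"
    unfolding rep_tensor_rels_def
  proof (elim UnE CollectE exE conjE)
    fix a x x' y
    assume r: "r = frag_of (a, x \<oplus>\<^bsub>sp X a\<^esub> x', y) - frag_of (a, x, y) - frag_of (a, x', y)"
      "a \<in> vertices Q" "x \<in> carrier (sp X a)" "x' \<in> carrier (sp X a)" "y \<in> carrier (sp M (a, w))"
    show ?thesis unfolding r(1) by (rule 3) (use r XV(3) in \<open>simp_all add: G\<close>)
  next
    fix a x y y'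
    assume r: "r = frag_of (a, x, y \<oplus>\<^bsub>sp M (a, w)\<^esub> y') - frag_of (a, x, y) - frag_of (a, x, y')"
      "a \<in> vertices Q" "x \<in> carrier (sp X a)" "y \<in> carrier (sp M (a, w))" "y' \<in> carrier (sp M (a, w))"
    show ?thesis unfolding r(1) by (rule 3) (use r MV(3) in \<open>simp_all add: G\<close>)
  next
    fix a c x y
    assume r: "r = frag_of (a, c \<odot>\<^bsub>sp X a\<^esub> x, y) - frag_of (a, x, c \<odot>\<^bsub>sp M (a, w)\<^esub> y)"
      "a \<in> vertices Q" "c \<in> carrier K" "x \<in> carrier (sp X a)" "y \<in> carrier (sp M (a, w))"
    show ?thesis unfolding r(1) by (rule 2) (use r XV(4) MV(4) in \<open>simp_all add: G\<close>)
  next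
    fix a b x y
    assume r: "r = frag_of (b, ar X a b x, y) - frag_of (a, x, ar M (b, w) (a, w) y)"
      "(a, b) \<in> arrows Q" "x \<in> carrier (sp X a)" "y \<in> carrier (sp M (b, w))"
    show ?thesis unfolding r(1) by (rule 2) (use r al am arrowQ[OF r(2)] in \<open>simp_all add: G\<close>)
  qed
qed

lemma T_comm:
  assumes "fd_rep K Q X" "w \<in> vertices R"
  shows "comm_group (T X w)"
  unfolding rep_tensor_group_def by (rule pres_group_comm[OF rels_closed[OF assms]])

lemma tns_closed:
  assumes "fd_rep K Q X" "w \<in> vertices R" "a \<in> vertices Q" "x \<in> carrier (sp X a)" "y \<in> carrier (sp M (a, w))"
  shows "tns X w a x y \<in> carrier (T X w)"
  unfolding rep_tensor_group_def rep_tens_def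
  by (rule pres_class_closed[OF rels_closed[OF assms(1,2)]]) (use assms in \<open>simp add: rep_tensor_gens_def\<close>)

lemma tns_add_left:
  assumes X: "fd_rep K Q X" "w \<in> vertices R"
    and a: "a \<in> vertices Q" "x \<in> carrier (sp X a)" "x' \<in> carrier (sp X a)" "y \<in> carrier (sp M (a, w))"
  shows "tns X w a (x \<oplus>\<^bsub>sp X a\<^esub> x') y = tns X w a x y \<otimes>\<^bsub>T X w\<^esub> tns X w a x' y"
  unfolding rep_tensor_group_def rep_tens_def
proof (rule pres_class_add_rel[OF rels_closed[OF X]])
  show "frag_of (a, x \<oplus>\<^bsub>sp X a\<^esub> x', y) - frag_of (a, x, y) - frag_of (a, x', y) \<in> rep_tensor_rels K Q X M w"
    unfolding rep_tensor_rels_def by (rule UnI1, rule UnI1, rule UnI1) (use a in blast)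
qed (use a vectorspaceD(3)[OF fd_repD(1)[OF X(1)]] in \<open>simp add: rep_tensor_gens_def\<close>)

lemma tns_add_right:
  assumes X: "fd_rep K Q X" "w \<in> vertices R"
    and a: "a \<in> vertices Q" "x \<in> carrier (sp X a)" "y \<in> carrier (sp M (a, w))" "y' \<in> carrier (sp M (a, w))"
  shows "tns X w a x (y \<oplus>\<^bsub>sp M (a, w)\<^esub> y') = tns X w a x y \<otimes>\<^bsub>T X w\<^esub> tns X w a x y'"
  unfolding rep_tensor_group_def rep_tens_def
proof (rule pres_class_add_rel[OF rels_closed[OF X]])
  show "frag_of (a, x, y \<oplus>\<^bsub>sp M (a, w)\<^esub> y') - frag_of (a, x, y) - frag_of (a, x, y') \<in> rep_tensor_rels K Q X M w"
    unfolding rep_tensor_rels_def by (rule UnI1, rule UnI1, rule UnI2) (use a in blast)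
qed (use a vectorspaceD(3)[OF M_space[OF a(1) X(2)]] in \<open>simp add: rep_tensor_gens_def\<close>)

lemma tns_smult:
  assumes X: "fd_rep K Q X" "w \<in> vertices R"
    and a: "a \<in> vertices Q" "c \<in> carrier K" "x \<in> carrier (sp X a)" "y \<in> carrier (sp M (a, w))"
  shows "tns X w a (c \<odot>\<^bsub>sp X a\<^esub> x) y = tns X w a x (c \<odot>\<^bsub>sp M (a, w)\<^esub> y)"
  unfolding rep_tens_def
proof (rule pres_class_eq_rel[OF rels_closed[OF X]])
  show "frag_of (a, c \<odot>\<^bsub>sp X a\<^esub> x, y) - frag_of (a, x, c \<odot>\<^bsub>sp M (a, w)\<^esub> y) \<in> rep_tensor_rels K Q X M w"
    unfolding rep_tensor_rels_def by (rule UnI1, rule UnI2) (use a in blast)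
qed (use a vectorspaceD(4)[OF fd_repD(1)[OF X(1)]] vectorspaceD(4)[OF M_space[OF a(1) X(2)]] in
      \<open>simp add: rep_tensor_gens_def\<close>)

lemma tns_arrow:
  assumes X: "fd_rep K Q X" "w \<in> vertices R"
    and a: "(a, b) \<in> arrows Q" "x \<in> carrier (sp X a)" "y \<in> carrier (sp M (b, w))"
  shows "tns X w b (ar X a b x) y = tns X w a x (ar M (b, w) (a, w) y)"
  unfolding rep_tens_def
proof (rule pres_class_eq_rel[OF rels_closed[OF X]])
  show "frag_of (b, ar X a b x, y) - frag_of (a, x, ar M (b, w) (a, w) y) \<in> rep_tensor_rels K Q X M w"
    unfolding rep_tensor_rels_def by (rule UnI2) (use a in blast)
  show "{(b, ar X a b x, y), (a, x, ar M (b, w) (a, w) y)} \<subseteq> rep_tensor_gens Q X M w"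
    using a arrowQ[OF a(1)] module_hom_carrier[OF fd_repD(3)[OF X(1) a(1)] a(2)]
      module_hom_carrier[OF M_left[OF a(1) X(2)] a(3)] by (simp add: rep_tensor_gens_def)
qed

lemma tns_hom_eq:
  assumes X: "fd_rep K Q X" "w \<in> vertices R" and H: "group H"
    and h: "h \<in> hom (T X w) H" "h' \<in> hom (T X w) H"
    and e: "\<And>a x y. a \<in> vertices Q \<Longrightarrow> x \<in> carrier (sp X a) \<Longrightarrow> y \<in> carrier (sp M (a, w)) \<Longrightarrow>
      h (tns X w a x y) = h' (tns X w a x y)"
    and t: "t \<in> carrier (T X w)"
  shows "h t = h' t"
proof (rule pres_hom_eq[OF rels_closed[OF X] H, folded rep_tensor_group_def, OF h _ t])
  fix s assume "s \<in> rep_tensor_gens Q X M w"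
  then show "h (pres_class (rep_tensor_gens Q X M w) (rep_tensor_rels K Q X M w) s) =
      h' (pres_class (rep_tensor_gens Q X M w) (rep_tensor_rels K Q X M w) s)"
    using e by (auto simp: rep_tensor_gens_def rep_tens_def)
qed

text \<open>The universal property of the tensor product, from which scalar multiplication, the action of
arrows, the action on morphisms and the contraction below are all obtained.\<close>

lemma tensor_lift_balanced:
  assumes X: "fd_rep K Q X" and w: "w \<in> vertices R" and H: "comm_group H"
    and c: "\<And>a x y. a \<in> vertices Q \<Longrightarrow> x \<in> carrier (sp X a) \<Longrightarrow> y \<in> carrier (sp M (a, w)) \<Longrightarrow>
      f (a, x, y) \<in> carrier H"
    and l: "\<And>a x x' y. a \<in> vertices Q \<Longrightarrow> x \<in> carrier (sp X a) \<Longrightarrow> x' \<in> carrier (sp X a) \<Longrightarrow>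
      y \<in> carrier (sp M (a, w)) \<Longrightarrow> f (a, x \<oplus>\<^bsub>sp X a\<^esub> x', y) = f (a, x, y) \<otimes>\<^bsub>H\<^esub> f (a, x', y)"
    and r: "\<And>a x y y'. a \<in> vertices Q \<Longrightarrow> x \<in> carrier (sp X a) \<Longrightarrow> y \<in> carrier (sp M (a, w)) \<Longrightarrow>
      y' \<in> carrier (sp M (a, w)) \<Longrightarrow> f (a, x, y \<oplus>\<^bsub>sp M (a, w)\<^esub> y') = f (a, x, y) \<otimes>\<^bsub>H\<^esub> f (a, x, y')"
    and s: "\<And>a c x y. a \<in> vertices Q \<Longrightarrow> c \<in> carrier K \<Longrightarrow> x \<in> carrier (sp X a) \<Longrightarrow>
      y \<in> carrier (sp M (a, w)) \<Longrightarrow> f (a, c \<odot>\<^bsub>sp X a\<^esub> x, y) = f (a, x, c \<odot>\<^bsub>sp M (a, w)\<^esub> y)"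
    and t: "\<And>a b x y. (a, b) \<in> arrows Q \<Longrightarrow> x \<in> carrier (sp X a) \<Longrightarrow> y \<in> carrier (sp M (b, w)) \<Longrightarrow>
      f (b, ar X a b x, y) = f (a, x, ar M (b, w) (a, w) y)"
  shows "pres_lift H f \<in> hom (T X w) H"
    and "a \<in> vertices Q \<Longrightarrow> x \<in> carrier (sp X a) \<Longrightarrow> y \<in> carrier (sp M (a, w)) \<Longrightarrow>
      pres_lift H f (tns X w a x y) = f (a, x, y)"
proof -
  let ?G = "rep_tensor_gens Q X M w"
  have G: "(a, x, y) \<in> ?G \<longleftrightarrow> a \<in> vertices Q \<and> x \<in> carrier (sp X a) \<and> y \<in> carrier (sp M (a, w))" for a x y
    by (simp add: rep_tensor_gens_def)
  have f: "f \<in> ?G \<rightarrow> carrier H" using c by (auto simp: rep_tensor_gens_def)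
  note XV = vectorspaceD[OF fd_repD(1)[OF X]] and MV = vectorspaceD[OF M_space[OF _ w]]
  note al = module_hom_carrier[OF fd_repD(3)[OF X]] and am = module_hom_carrier[OF M_left[OF _ w]]
  have rel: "lin_ext H f q = \<one>\<^bsub>H\<^esub>" if "q \<in> rep_tensor_rels K Q X M w" for q
    using that unfolding rep_tensor_rels_def
  proof (elim UnE CollectE exE conjE)
    fix a x x' y
    assume q: "q = frag_of (a, x \<oplus>\<^bsub>sp X a\<^esub> x', y) - frag_of (a, x, y) - frag_of (a, x', y)"
      "a \<in> vertices Q" "x \<in> carrier (sp X a)" "x' \<in> carrier (sp X a)" "y \<in> carrier (sp M (a, w))"
    show ?thesis unfolding q(1)
      by (rule lin_ext_add_rel[OF H f]) (use q XV(3) l in \<open>simp_all add: G\<close>)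
  next
    fix a x y y'
    assume q: "q = frag_of (a, x, y \<oplus>\<^bsub>sp M (a, w)\<^esub> y') - frag_of (a, x, y) - frag_of (a, x, y')"
      "a \<in> vertices Q" "x \<in> carrier (sp X a)" "y \<in> carrier (sp M (a, w))" "y' \<in> carrier (sp M (a, w))"
    show ?thesis unfolding q(1)
      by (rule lin_ext_add_rel[OF H f]) (use q MV(3) r in \<open>simp_all add: G\<close>)
  next
    fix a c x y
    assume q: "q = frag_of (a, c \<odot>\<^bsub>sp X a\<^esub> x, y) - frag_of (a, x, c \<odot>\<^bsub>sp M (a, w)\<^esub> y)"
      "a \<in> vertices Q" "c \<in> carrier K" "x \<in> carrier (sp X a)" "y \<in> carrier (sp M (a, w))"
    show ?thesis unfolding q(1)
      by (rule lin_ext_eq_rel[OF H f]) (use q XV(4) MV(4) s in \<open>simp_all add: G\<close>)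
  next
    fix a b x y
    assume q: "q = frag_of (b, ar X a b x, y) - frag_of (a, x, ar M (b, w) (a, w) y)"
      "(a, b) \<in> arrows Q" "x \<in> carrier (sp X a)" "y \<in> carrier (sp M (b, w))"
    show ?thesis unfolding q(1)
      by (rule lin_ext_eq_rel[OF H f]) (use q al am arrowQ[OF q(2)] t in \<open>simp_all add: G\<close>)
  qed
  show "pres_lift H f \<in> hom (T X w) H"
    unfolding rep_tensor_group_def by (rule pres_lift_hom[OF rels_closed[OF X w] H f rel])
  show "pres_lift H f (tns X w a x y) = f (a, x, y)"
    if "a \<in> vertices Q" "x \<in> carrier (sp X a)" "y \<in> carrier (sp M (a, w))"
    unfolding rep_tens_def
    by (rule pres_lift_class[OF rels_closed[OF X w] H f rel]) (use that in \<open>simp_all add: G\<close>)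
qed

abbreviation tensor :: "('v, 'k, 'u) rep \<Rightarrow> ('w, 'k, ('v \<times> 'u \<times> 'b \<Rightarrow>\<^sub>0 int) set) rep" where
  "tensor X \<equiv> rep_tensor K Q M X"

lemma tensor_simps:
  "carrier (sp (tensor X) w) = carrier (T X w)" "\<zero>\<^bsub>sp (tensor X) w\<^esub> = \<one>\<^bsub>T X w\<^esub>"
  "s \<oplus>\<^bsub>sp (tensor X) w\<^esub> t = s \<otimes>\<^bsub>T X w\<^esub> t"
  by (simp_all add: rep_tensor_def)

lemma tensor_smult:
  assumes X: "fd_rep K Q X" and w: "w \<in> vertices R" and c: "c \<in> carrier K"
  shows "(\<lambda>t. c \<odot>\<^bsub>sp (tensor X) w\<^esub> t) \<in> hom (T X w) (T X w)"
    and "a \<in> vertices Q \<Longrightarrow> x \<in> carrier (sp X a) \<Longrightarrow> y \<in> carrier (sp M (a, w)) \<Longrightarrow>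
      c \<odot>\<^bsub>sp (tensor X) w\<^esub> tns X w a x y = tns X w a (c \<odot>\<^bsub>sp X a\<^esub> x) y"
proof -
  note V = vectorspace_smult[OF fd_repD(1)[OF X]] and C = vectorspaceD(3,4)[OF fd_repD(1)[OF X]]
  note al = module_hom_carrier[OF fd_repD(3)[OF X]]
  let ?f = "\<lambda>(a, x, y). tns X w a (c \<odot>\<^bsub>sp X a\<^esub> x) y"
  have e: "(\<lambda>t. c \<odot>\<^bsub>sp (tensor X) w\<^esub> t) = pres_lift (T X w) ?f"
    by (simp add: rep_tensor_def)
  have t: "?f (b, ar X a b x, y) = ?f (a, x, ar M (b, w) (a, w) y)"
    if "(a, b) \<in> arrows Q" "x \<in> carrier (sp X a)" "y \<in> carrier (sp M (b, w))" for a b x y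
    using tns_arrow[OF X w that(1) C(2)[OF _ c that(2)] that(3)] arrowQ[OF that(1)]
      module_hom_smult[OF fd_repD(3)[OF X that(1)] c that(2)] by simp
  have s: "?f (a, k \<odot>\<^bsub>sp X a\<^esub> x, y) = ?f (a, x, k \<odot>\<^bsub>sp M (a, w)\<^esub> y)"
    if "a \<in> vertices Q" "k \<in> carrier K" "x \<in> carrier (sp X a)" "y \<in> carrier (sp M (a, w))" for a k x y
    using tns_smult[OF X w that(1,2) C(2)[OF that(1) c that(3)] that(4)] V(2)[OF that(1) c that(2,3)] by simp
  have c': "?f (a, x, y) \<in> carrier (T X w)"
    if "a \<in> vertices Q" "x \<in> carrier (sp X a)" "y \<in> carrier (sp M (a, w))" for a x y
    using tns_closed[OF X w that(1) C(2)[OF that(1) c that(2)] that(3)] by simp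
  have l: "?f (a, x \<oplus>\<^bsub>sp X a\<^esub> x', y) = ?f (a, x, y) \<otimes>\<^bsub>T X w\<^esub> ?f (a, x', y)"
    if "a \<in> vertices Q" "x \<in> carrier (sp X a)" "x' \<in> carrier (sp X a)" "y \<in> carrier (sp M (a, w))" for a x x' y
    using tns_add_left[OF X w that(1) C(2)[OF that(1) c that(2)] C(2)[OF that(1) c that(3)] that(4)]
      V(1)[OF that(1) c that(2,3)] by simp
  have r: "?f (a, x, y \<oplus>\<^bsub>sp M (a, w)\<^esub> y') = ?f (a, x, y) \<otimes>\<^bsub>T X w\<^esub> ?f (a, x, y')"
    if "a \<in> vertices Q" "x \<in> carrier (sp X a)" "y \<in> carrier (sp M (a, w))" "y' \<in> carrier (sp M (a, w))" for a x y y'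
    using tns_add_right[OF X w that(1) C(2)[OF that(1) c that(2)] that(3,4)] by simp
  note L = tensor_lift_balanced[OF X w T_comm[OF X w], of ?f, OF c' l r s t]
  show "(\<lambda>t. c \<odot>\<^bsub>sp (tensor X) w\<^esub> t) \<in> hom (T X w) (T X w)" unfolding e by (rule L(1))
  show "c \<odot>\<^bsub>sp (tensor X) w\<^esub> tns X w a x y = tns X w a (c \<odot>\<^bsub>sp X a\<^esub> x) y"
    if "a \<in> vertices Q" "x \<in> carrier (sp X a)" "y \<in> carrier (sp M (a, w))"
  proof -
    have "pres_lift (T X w) ?f (tns X w a x y) = ?f (a, x, y)" by (rule L(2)) (use that in simp_all)
    then show ?thesis using fun_cong[OF e, of "tns X w a x y"] by simp
  qed
qed

lemma tensor_ar:
  assumes X: "fd_rep K Q X" and uw: "(u, w) \<in> arrows R"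
  shows "ar (tensor X) u w \<in> hom (T X u) (T X w)"
    and "a \<in> vertices Q \<Longrightarrow> x \<in> carrier (sp X a) \<Longrightarrow> y \<in> carrier (sp M (a, u)) \<Longrightarrow>
      ar (tensor X) u w (tns X u a x y) = tns X w a x (ar M (a, u) (a, w) y)"
proof -
  have u: "u \<in> vertices R" and w: "w \<in> vertices R" using arrowR[OF uw] by auto
  let ?f = "\<lambda>(a, x, y). tns X w a x (ar M (a, u) (a, w) y)"
  have e: "ar (tensor X) u w = pres_lift (T X w) ?f" by (simp add: rep_tensor_def)
  note m = module_hom_carrier[OF M_right[OF _ uw]]
  have c': "?f (a, x, y) \<in> carrier (T X w)"
    if "a \<in> vertices Q" "x \<in> carrier (sp X a)" "y \<in> carrier (sp M (a, u))" for a x y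
    using tns_closed[OF X w that(1,2) m[OF that(1,3)]] by simp
  have l: "?f (a, x \<oplus>\<^bsub>sp X a\<^esub> x', y) = ?f (a, x, y) \<otimes>\<^bsub>T X w\<^esub> ?f (a, x', y)"
    if "a \<in> vertices Q" "x \<in> carrier (sp X a)" "x' \<in> carrier (sp X a)" "y \<in> carrier (sp M (a, u))" for a x x' y
    using tns_add_left[OF X w that(1,2,3) m[OF that(1,4)]] by simp
  have r: "?f (a, x, y \<oplus>\<^bsub>sp M (a, u)\<^esub> y') = ?f (a, x, y) \<otimes>\<^bsub>T X w\<^esub> ?f (a, x, y')"
    if "a \<in> vertices Q" "x \<in> carrier (sp X a)" "y \<in> carrier (sp M (a, u))" "y' \<in> carrier (sp M (a, u))" for a x y y'
    using tns_add_right[OF X w that(1,2) m[OF that(1,3)] m[OF that(1,4)]]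
      module_hom_add[OF M_right[OF that(1) uw] that(3,4)] by simp
  have s: "?f (a, k \<odot>\<^bsub>sp X a\<^esub> x, y) = ?f (a, x, k \<odot>\<^bsub>sp M (a, u)\<^esub> y)"
    if "a \<in> vertices Q" "k \<in> carrier K" "x \<in> carrier (sp X a)" "y \<in> carrier (sp M (a, u))" for a k x y
    using tns_smult[OF X w that(1,2,3) m[OF that(1,4)]]
      module_hom_smult[OF M_right[OF that(1) uw] that(2,4)] by simp
  have t: "?f (b, ar X a b x, y) = ?f (a, x, ar M (b, u) (a, u) y)"
    if "(a, b) \<in> arrows Q" "x \<in> carrier (sp X a)" "y \<in> carrier (sp M (b, u))" for a b x y
    using tns_arrow[OF X w that(1,2) m[OF _ that(3)]] arrowQ[OF that(1)] M_commute[OF that(1) uw that(3)] by simp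
  note L = tensor_lift_balanced[OF X u T_comm[OF X w], of ?f, OF c' l r s t]
  show "ar (tensor X) u w \<in> hom (T X u) (T X w)" unfolding e by (rule L(1))
  show "ar (tensor X) u w (tns X u a x y) = tns X w a x (ar M (a, u) (a, w) y)"
    if "a \<in> vertices Q" "x \<in> carrier (sp X a)" "y \<in> carrier (sp M (a, u))"
  proof -
    have "pres_lift (T X w) ?f (tns X u a x y) = ?f (a, x, y)" by (rule L(2)) (use that in simp_all)
    then show ?thesis unfolding e by simp
  qed
qed

abbreviation tmap where "tmap \<equiv> rep_tensor_map K Q M"

lemma tensor_map:
  assumes X: "fd_rep K Q X" and Y: "fd_rep K Q Y" and f: "rep_hom K Q X Y f" and w: "w \<in> vertices R"
  shows "tmap X Y f w \<in> hom (T X w) (T Y w)"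
    and "a \<in> vertices Q \<Longrightarrow> x \<in> carrier (sp X a) \<Longrightarrow> y \<in> carrier (sp M (a, w)) \<Longrightarrow>
      tmap X Y f w (tns X w a x y) = tns Y w a (f a x) y"
proof -
  let ?f = "\<lambda>(a, x, y). tns Y w a (f a x) y"
  note F = rep_homD[OF f]
  note m = module_hom_carrier[OF F(1)]
  have c': "?f (a, x, y) \<in> carrier (T Y w)"
    if "a \<in> vertices Q" "x \<in> carrier (sp X a)" "y \<in> carrier (sp M (a, w))" for a x y
    using tns_closed[OF Y w that(1) m[OF that(1,2)] that(3)] by simp
  have l: "?f (a, x \<oplus>\<^bsub>sp X a\<^esub> x', y) = ?f (a, x, y) \<otimes>\<^bsub>T Y w\<^esub> ?f (a, x', y)"
    if "a \<in> vertices Q" "x \<in> carrier (sp X a)" "x' \<in> carrier (sp X a)" "y \<in> carrier (sp M (a, w))" for a x x' y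
    using tns_add_left[OF Y w that(1) m[OF that(1,2)] m[OF that(1,3)] that(4)]
      module_hom_add[OF F(1)[OF that(1)] that(2,3)] by simp
  have r: "?f (a, x, y \<oplus>\<^bsub>sp M (a, w)\<^esub> y') = ?f (a, x, y) \<otimes>\<^bsub>T Y w\<^esub> ?f (a, x, y')"
    if "a \<in> vertices Q" "x \<in> carrier (sp X a)" "y \<in> carrier (sp M (a, w))" "y' \<in> carrier (sp M (a, w))" for a x y y'
    using tns_add_right[OF Y w that(1) m[OF that(1,2)] that(3,4)] by simp
  have s: "?f (a, k \<odot>\<^bsub>sp X a\<^esub> x, y) = ?f (a, x, k \<odot>\<^bsub>sp M (a, w)\<^esub> y)"
    if "a \<in> vertices Q" "k \<in> carrier K" "x \<in> carrier (sp X a)" "y \<in> carrier (sp M (a, w))" for a k x y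
    using tns_smult[OF Y w that(1,2) m[OF that(1,3)] that(4)]
      module_hom_smult[OF F(1)[OF that(1)] that(2,3)] by simp
  have t: "?f (b, ar X a b x, y) = ?f (a, x, ar M (b, w) (a, w) y)"
    if "(a, b) \<in> arrows Q" "x \<in> carrier (sp X a)" "y \<in> carrier (sp M (b, w))" for a b x y
    using tns_arrow[OF Y w that(1) m[OF _ that(2)] that(3)] arrowQ[OF that(1)] F(2)[OF that(1,2)] by simp
  note L = tensor_lift_balanced[OF X w T_comm[OF Y w], of ?f, OF c' l r s t]
  have e: "tmap X Y f w = pres_lift (T Y w) ?f" by (simp add: rep_tensor_map_def)
  show "tmap X Y f w \<in> hom (T X w) (T Y w)" unfolding e by (rule L(1))
  show "tmap X Y f w (tns X w a x y) = tns Y w a (f a x) y"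
    if "a \<in> vertices Q" "x \<in> carrier (sp X a)" "y \<in> carrier (sp M (a, w))"
  proof -
    have "pres_lift (T Y w) ?f (tns X w a x y) = ?f (a, x, y)" by (rule L(2)) (use that in simp_all)
    then show ?thesis unfolding e by simp
  qed
qed

end

section \<open>Pulling back along a monotone map\<close>

lemma path_vertices: "a \<in> vertices (path_quiver n) \<longleftrightarrow> 1 \<le> a \<and> a \<le> n"
  by (simp add: path_quiver_def)

lemma path_arrows: "(a, b) \<in> arrows (path_quiver n) \<longleftrightarrow> 1 \<le> a \<and> a < n \<and> b = Suc a"
  by (auto simp: path_quiver_def)

text \<open>The action of the path of length \<open>k\<close> that starts at \<open>a\<close>.\<close>

primrec transit :: "(nat, 'k, 'u) rep \<Rightarrow> nat \<Rightarrow> nat \<Rightarrow> 'u \<Rightarrow> 'u" where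
  "transit X a 0 x = x"
| "transit X a (Suc k) x = ar X (a + k) (Suc (a + k)) (transit X a k x)"

lemma transit_front: "transit X a (Suc k) x = transit X (Suc a) k (ar X a (Suc a) x)"
  by (induction k) simp_all

lemma transit_add: "transit X a (j + k) x = transit X (a + j) k (transit X a j x)"
  by (induction k) (simp_all add: add.assoc)

definition path_map :: "(nat, 'k, 'u) rep \<Rightarrow> nat \<Rightarrow> nat \<Rightarrow> 'u \<Rightarrow> 'u" where
  "path_map X a b = transit X a (b - a)"

lemma path_map_refl: "path_map X a a x = x"
  by (simp add: path_map_def)

lemma path_map_comp: "a \<le> b \<Longrightarrow> b \<le> c \<Longrightarrow> path_map X b c (path_map X a b x) = path_map X a c x"
  using transit_add[of X a "b - a" "c - b" x] by (simp add: path_map_def)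

lemma path_map_front: "a < b \<Longrightarrow> path_map X (Suc a) b (ar X a (Suc a) x) = path_map X a b x"
  using transit_front[of X a "b - Suc a" x] by (simp add: path_map_def Suc_diff_Suc)

lemma transit_hom:
  assumes X: "fd_rep K (path_quiver n) X" and "1 \<le> a" "a + k \<le> n"
  shows "transit X a k \<in> module_hom K (sp X a) (sp X (a + k))"
  using assms(3)
proof (induction k)
  case 0
  then show ?case by (simp add: module_hom_def)
next
  case (Suc k)
  have "ar X (a + k) (Suc (a + k)) \<in> module_hom K (sp X (a + k)) (sp X (Suc (a + k)))"
    by (rule fd_repD(3)[OF X]) (use assms(2) Suc.prems in \<open>simp add: path_arrows\<close>)
  from module_hom_comp[OF Suc.IH this] Suc.prems show ?case by simp
qed

lemma path_map_hom:
  assumes X: "fd_rep K (path_quiver n) X" and "1 \<le> a" "a \<le> b" "b \<le> n"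
  shows "path_map X a b \<in> module_hom K (sp X a) (sp X b)"
  using transit_hom[OF X assms(2), of "b - a"] assms by (simp add: path_map_def)

lemma transit_natural:
  assumes X: "fd_rep K (path_quiver n) X" and f: "rep_hom K (path_quiver n) X Y f"
    and "1 \<le> a" "a + k \<le> n" and x: "x \<in> carrier (sp X a)"
  shows "f (a + k) (transit X a k x) = transit Y a k (f a x)"
  using assms(4)
proof (induction k)
  case (Suc k)
  have arr: "(a + k, Suc (a + k)) \<in> arrows (path_quiver n)"
    using Suc.prems assms(3) by (simp add: path_arrows)
  have "transit X a k x \<in> carrier (sp X (a + k))"
    using module_hom_carrier[OF transit_hom[OF X assms(3)] x] Suc.prems by simp
  from rep_homD(2)[OF f arr this] Suc show ?case by simp
qed simp

lemma path_map_natural: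
  assumes X: "fd_rep K (path_quiver n) X" and f: "rep_hom K (path_quiver n) X Y f"
    and "1 \<le> a" "a \<le> b" "b \<le> n" and x: "x \<in> carrier (sp X a)"
  shows "f b (path_map X a b x) = path_map Y a b (f a x)"
  using transit_natural[OF X f assms(3) _ x, of "b - a"] assms by (simp add: path_map_def)

text \<open>The region under the graph of \<open>g\<close>. The standard module on it has as its column over \<open>w\<close> the left
module that is one-dimensional at the vertices \<open>1, \<dots>, g w\<close>, which is projective and generated at \<open>g w\<close>.\<close>

definition below :: "'w quiver \<Rightarrow> ('w \<Rightarrow> nat) \<Rightarrow> (nat \<times> 'w) set" where
  "below R g = {(a, w). w \<in> vertices R \<and> 1 \<le> a \<and> a \<le> g w}"

locale monotone_map =
  fixes K :: "('k, 'r) ring_scheme" and N :: nat and R :: "'w quiver" and g :: "'w \<Rightarrow> nat"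
  assumes K: "field K"
    and arrowR: "(u, w) \<in> arrows R \<Longrightarrow> u \<in> vertices R \<and> w \<in> vertices R"
    and squareR: "(a, b, c, d) \<in> squares R \<Longrightarrow>
      (a, b) \<in> arrows R \<and> (b, d) \<in> arrows R \<and> (a, c) \<in> arrows R \<and> (c, d) \<in> arrows R"
    and range: "w \<in> vertices R \<Longrightarrow> 1 \<le> g w \<and> g w \<le> N"
    and mono: "(u, w) \<in> arrows R \<Longrightarrow> g u \<le> g w"
begin

abbreviation "Q \<equiv> path_quiver N"
abbreviation "M \<equiv> standard_rep K (below R g)"

text \<open>Left arrows lower \<open>a\<close> and right arrows raise \<open>g w\<close>, so that the support is closed under all arrows and
no square of the product quiver leaves it and comes back.\<close>

lemma M_fd: "fd_rep K (prod_quiver (op_quiver Q) R) M"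
proof (rule standard_rep_fd[OF K])
  fix p q r s assume "(p, q, r, s) \<in> squares (prod_quiver (op_quiver Q) R)"
    and ps: "p \<in> below R g" "s \<in> below R g"
  then consider a u v w z where "p = (a, u)" "q = (a, v)" "r = (a, w)" "s = (a, z)" "(u, v, w, z) \<in> squares R"
    | a b u v where "p = (b, u)" "q = (a, u)" "r = (b, v)" "s = (a, v)" "(a, b) \<in> arrows Q" "(u, v) \<in> arrows R"
    by (auto simp: prod_quiver_def op_quiver_def path_quiver_def)
  then show "q \<in> below R g \<and> r \<in> below R g"
  proof cases
    case 1
    then show ?thesis using squareR[OF 1(5)] arrowR[of u v] arrowR[of u w] mono[of u v] mono[of u w] ps
      by (auto simp: below_def)
  next
    case 2
    then show ?thesis using arrowR[OF 2(6)] mono[OF 2(6)] ps by (auto simp: below_def path_arrows)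
  qed
qed

sublocale bimodule K Q R M
proof
  show "a \<in> vertices Q \<and> b \<in> vertices Q" if "(a, b) \<in> arrows Q" for a b
    using that by (auto simp: path_arrows path_vertices)
  show "u \<in> vertices R \<and> w \<in> vertices R" if "(u, w) \<in> arrows R" for u w
    using arrowR[OF that] .
qed (rule M_fd)

lemma M_simps:
  assumes "a \<in> vertices Q" "w \<in> vertices R"
  shows "carrier (sp M (a, w)) = (if a \<le> g w then carrier K else {\<zero>\<^bsub>K\<^esub>})"
    and "y \<oplus>\<^bsub>sp M (a, w)\<^esub> y' = y \<oplus>\<^bsub>K\<^esub> y'" and "c \<odot>\<^bsub>sp M (a, w)\<^esub> y = c \<otimes>\<^bsub>K\<^esub> y"
  using assms by (simp_all add: standard_rep_def line_space_def below_def path_vertices)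

lemma M_carrier:
  assumes "a \<in> vertices Q" "w \<in> vertices R" "y \<in> carrier (sp M (a, w))"
  shows "y \<in> carrier K"
proof -
  interpret K: field K by (rule K)
  show ?thesis using assms(3) by (auto simp: M_simps(1)[OF assms(1,2)] split: if_splits)
qed

lemma M_left_val:
  assumes "(a, b) \<in> arrows Q" "w \<in> vertices R" "y \<in> carrier (sp M (b, w))"
  shows "ar M (b, w) (a, w) y = y"
proof -
  have b: "b \<in> vertices Q" using assms(1) by (simp add: path_arrows path_vertices)
  show ?thesis using assms M_simps(1)[OF b assms(2)]
    by (auto simp: standard_rep_def below_def path_arrows split: if_splits)
qed

lemma M_right_val:
  assumes "a \<in> vertices Q" "(u, w) \<in> arrows R" "y \<in> carrier (sp M (a, u))"
  shows "ar M (a, u) (a, w) y = y"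
proof -
  note v = arrowR[OF assms(2)]
  show ?thesis using assms v M_simps(1)[OF assms(1), of u] mono[OF assms(2)]
    by (auto simp: standard_rep_def below_def path_vertices split: if_splits)
qed

text \<open>The isomorphism from the tensor product at \<open>w\<close> to \<open>X\<close> at \<open>g w\<close>, on generators: since the column over \<open>w\<close>
is generated at \<open>g w\<close>, the symbol \<open>x \<otimes> y\<close> can be moved to that vertex along the path from \<open>a\<close>. The value
for \<open>a > g w\<close> is zero because the bimodule vanishes there.\<close>

definition contract_gen :: "(nat, 'k, 'u) rep \<Rightarrow> 'w \<Rightarrow> nat \<times> 'u \<times> 'k \<Rightarrow> 'u" where
  "contract_gen X w = (\<lambda>(a, x, y).
     if a \<le> g w then y \<odot>\<^bsub>sp X (g w)\<^esub> path_map X a (g w) x else \<zero>\<^bsub>sp X (g w)\<^esub>)"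

definition contract :: "(nat, 'k, 'u) rep \<Rightarrow> 'w \<Rightarrow> (nat \<times> 'u \<times> 'k \<Rightarrow>\<^sub>0 int) set \<Rightarrow> 'u" where
  "contract X w = pres_lift (add_monoid (sp X (g w))) (contract_gen X w)"

context
  fixes X :: "(nat, 'k, 'u) rep"
  assumes X: "fd_rep K Q X"
begin

lemma target_vertex: "w \<in> vertices R \<Longrightarrow> g w \<in> vertices Q"
  using range by (simp add: path_vertices)

lemma target_space: "w \<in> vertices R \<Longrightarrow> vectorspace K (sp X (g w))"
  using fd_repD(1)[OF X] target_vertex by blast

lemma add_group: "w \<in> vertices R \<Longrightarrow> comm_group (add_monoid (sp X (g w)))"
  using vectorspaceD(1)[OF target_space] by (simp add: abelian_group.a_comm_group)

lemma path_map_target_closed: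
  assumes "a \<in> vertices Q" "a \<le> g w" "w \<in> vertices R" "x \<in> carrier (sp X a)"
  shows "path_map X a (g w) x \<in> carrier (sp X (g w))"
  using module_hom_carrier[OF path_map_hom[OF X] assms(4)] assms range by (simp add: path_vertices)

lemma path_map_target_hom:
  assumes "a \<in> vertices Q" "a \<le> g w" "w \<in> vertices R"
  shows "path_map X a (g w) \<in> module_hom K (sp X a) (sp X (g w))"
  using path_map_hom[OF X] assms range by (simp add: path_vertices)

lemma contract_hom_val:
  assumes w: "w \<in> vertices R"
  shows "contract X w \<in> hom (T X w) (add_monoid (sp X (g w)))"
    and "a \<in> vertices Q \<Longrightarrow> x \<in> carrier (sp X a) \<Longrightarrow> y \<in> carrier (sp M (a, w)) \<Longrightarrow>
      contract X w (tns X w a x y) = contract_gen X w (a, x, y)"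
proof -
  interpret V: vectorspace K "sp X (g w)" by (rule target_space[OF w])
  let ?V = "sp X (g w)"
  have c: "contract_gen X w (a, x, y) \<in> carrier (add_monoid ?V)"
    if "a \<in> vertices Q" "x \<in> carrier (sp X a)" "y \<in> carrier (sp M (a, w))" for a x y
    using path_map_target_closed[OF that(1) _ w that(2)] M_carrier[OF that(1) w that(3)] by (simp add: contract_gen_def)
  have l: "contract_gen X w (a, x \<oplus>\<^bsub>sp X a\<^esub> x', y) = contract_gen X w (a, x, y) \<otimes>\<^bsub>add_monoid ?V\<^esub> contract_gen X w (a, x', y)"
    if "a \<in> vertices Q" "x \<in> carrier (sp X a)" "x' \<in> carrier (sp X a)" "y \<in> carrier (sp M (a, w))" for a x x' y
    using module_hom_add[OF path_map_target_hom[OF that(1) _ w] that(2,3)] path_map_target_closed[OF that(1) _ w that(2)]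
      path_map_target_closed[OF that(1) _ w that(3)] M_carrier[OF that(1) w that(4)]
    by (simp add: contract_gen_def V.smult_r_distr)
  have r: "contract_gen X w (a, x, y \<oplus>\<^bsub>sp M (a, w)\<^esub> y') = contract_gen X w (a, x, y) \<otimes>\<^bsub>add_monoid ?V\<^esub> contract_gen X w (a, x, y')"
    if "a \<in> vertices Q" "x \<in> carrier (sp X a)" "y \<in> carrier (sp M (a, w))" "y' \<in> carrier (sp M (a, w))" for a x y y'
    using path_map_target_closed[OF that(1) _ w that(2)] M_carrier[OF that(1) w that(3)] M_carrier[OF that(1) w that(4)]
    by (simp add: contract_gen_def M_simps(2)[OF that(1) w] V.smult_l_distr)
  have s: "contract_gen X w (a, k \<odot>\<^bsub>sp X a\<^esub> x, y) = contract_gen X w (a, x, k \<odot>\<^bsub>sp M (a, w)\<^esub> y)"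
    if "a \<in> vertices Q" "k \<in> carrier K" "x \<in> carrier (sp X a)" "y \<in> carrier (sp M (a, w))" for a k x y
    using module_hom_smult[OF path_map_target_hom[OF that(1) _ w] that(2,3)] path_map_target_closed[OF that(1) _ w that(3)]
      M_carrier[OF that(1) w that(4)] that(2)
      vectorspace_smult(2,3)[OF target_space[OF w], of y k "path_map X a (g w) x"]
      vectorspace_smult(3)[OF target_space[OF w], of k y "path_map X a (g w) x"]
    by (simp add: contract_gen_def M_simps(3)[OF that(1) w])
  have t: "contract_gen X w (b, ar X a b x, y) = contract_gen X w (a, x, ar M (b, w) (a, w) y)"
    if "(a, b) \<in> arrows Q" "x \<in> carrier (sp X a)" "y \<in> carrier (sp M (b, w))" for a b x y
  proof -
    have ab: "b = Suc a" "a \<in> vertices Q" "b \<in> vertices Q" using that(1) by (auto simp: path_arrows path_vertices)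
    have "contract_gen X w (b, ar X a b x, y) = contract_gen X w (a, x, y)"
    proof (cases "b \<le> g w")
      case True
      then show ?thesis
        using path_map_front[of a "g w" X x] ab(1) by (simp add: contract_gen_def)
    next
      case False
      then have "y = \<zero>\<^bsub>K\<^esub>" using that(3) M_simps(1)[OF ab(3) w] by simp
      then show ?thesis
        using False path_map_target_closed[OF ab(2) _ w that(2)] by (simp add: contract_gen_def)
    qed
    then show ?thesis by (simp only: M_left_val[OF that(1) w that(3)])
  qed
  note L = tensor_lift_balanced[OF X w add_group[OF w], of "contract_gen X w", OF c l r s t]
  show "contract X w \<in> hom (T X w) (add_monoid ?V)" unfolding contract_def by (rule L(1))
  show "contract X w (tns X w a x y) = contract_gen X w (a, x, y)"
    if "a \<in> vertices Q" "x \<in> carrier (sp X a)" "y \<in> carrier (sp M (a, w))"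
    unfolding contract_def by (rule L(2)) (use that in simp_all)
qed

text \<open>Balancedness over arrows, iterated along a path that stays inside the support.\<close>

lemma slide:
  assumes w: "w \<in> vertices R" and a: "a \<in> vertices Q" and x: "x \<in> carrier (sp X a)" and y: "y \<in> carrier K"
    and "a + k \<le> g w"
  shows "tns X w (a + k) (transit X a k x) y = tns X w a x y"
  using assms(5)
proof (induction k)
  case (Suc k)
  have gN: "g w \<le> N" using range[OF w] by simp
  have arr: "(a + k, Suc (a + k)) \<in> arrows Q" using a Suc.prems gN by (simp add: path_arrows path_vertices)
  have z: "transit X a k x \<in> carrier (sp X (a + k))"
    using module_hom_carrier[OF transit_hom[OF X] x] a Suc.prems gN by (simp add: path_vertices)
  have y': "y \<in> carrier (sp M (Suc (a + k), w))"
    using M_simps(1)[of "Suc (a + k)" w] arr w y Suc.prems by (simp add: path_arrows path_vertices)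
  have "tns X w (Suc (a + k)) (ar X (a + k) (Suc (a + k)) (transit X a k x)) y = tns X w (a + k) (transit X a k x) y"
    using tns_arrow[OF X w arr z y'] M_left_val[OF arr w y'] by simp
  then show ?case using Suc by simp
qed simp

text \<open>The inverse of the contraction.\<close>

definition expand :: "'w \<Rightarrow> 'u \<Rightarrow> (nat \<times> 'u \<times> 'k \<Rightarrow>\<^sub>0 int) set" where
  "expand w x = tns X w (g w) x \<one>\<^bsub>K\<^esub>"

lemma one_in_M: "w \<in> vertices R \<Longrightarrow> \<one>\<^bsub>K\<^esub> \<in> carrier (sp M (g w, w))"
proof -
  interpret K: field K by (rule K)
  show "w \<in> vertices R \<Longrightarrow> \<one>\<^bsub>K\<^esub> \<in> carrier (sp M (g w, w))" using M_simps(1)[OF target_vertex] by simp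
qed

lemma expand_hom:
  assumes w: "w \<in> vertices R"
  shows "expand w \<in> hom (add_monoid (sp X (g w))) (T X w)"
  by (rule homI)
     (use tns_closed[OF X w target_vertex[OF w] _ one_in_M[OF w]] tns_add_left[OF X w target_vertex[OF w] _ _ one_in_M[OF w]] in
       \<open>simp_all add: expand_def\<close>)

text \<open>It suffices to compare generators. Those with \<open>a \<le> g w\<close> are slid to \<open>g w\<close>; the others vanish, as their
second factor is zero.\<close>

lemma expand_contract:
  assumes w: "w \<in> vertices R" and t: "t \<in> carrier (T X w)"
  shows "expand w (contract X w t) = t"
proof -
  interpret K: field K by (rule K)
  interpret G: comm_group "T X w" by (rule T_comm[OF X w])
  have "(expand w \<circ> contract X w) t = (\<lambda>t. t) t"
  proof (rule tns_hom_eq[OF X w G.is_group hom_compose[OF contract_hom_val(1)[OF w] expand_hom[OF w]] _ _ t])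
    show "(\<lambda>t. t) \<in> hom (T X w) (T X w)" by (simp add: hom_def)
    fix a x y assume a: "a \<in> vertices Q" and x: "x \<in> carrier (sp X a)" and y: "y \<in> carrier (sp M (a, w))"
    have e: "(expand w \<circ> contract X w) (tns X w a x y) = tns X w (g w) (contract_gen X w (a, x, y)) \<one>\<^bsub>K\<^esub>"
      using contract_hom_val(2)[OF w a x y] by (simp add: expand_def)
    show "(expand w \<circ> contract X w) (tns X w a x y) = tns X w a x y"
    proof (cases "a \<le> g w")
      case True
      have yK: "y \<in> carrier K" by (rule M_carrier[OF a w y])
      have p: "path_map X a (g w) x \<in> carrier (sp X (g w))" by (rule path_map_target_closed[OF a True w x])
      have "tns X w (g w) (y \<odot>\<^bsub>sp X (g w)\<^esub> path_map X a (g w) x) \<one>\<^bsub>K\<^esub> =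
          tns X w (g w) (path_map X a (g w) x) y"
        using tns_smult[OF X w target_vertex[OF w] yK p one_in_M[OF w]] yK by (simp add: M_simps(3)[OF target_vertex[OF w] w])
      also have "\<dots> = tns X w a x y"
        using slide[OF w a x yK, of "g w - a"] True by (simp add: path_map_def)
      finally show ?thesis unfolding e using True by (simp add: contract_gen_def)
    next
      case False
      have y0: "y = \<zero>\<^bsub>K\<^esub>" using y M_simps(1)[OF a w] False by simp
      have "tns X w a x y = tns X w a x y \<otimes>\<^bsub>T X w\<^esub> tns X w a x y"
        using tns_add_right[OF X w a x y y] y0 by (simp add: M_simps(2)[OF a w])
      then have 1: "tns X w a x y = \<one>\<^bsub>T X w\<^esub>" using tns_closed[OF X w a x y] by simp
      interpret A: comm_group "add_monoid (sp X (g w))" by (rule add_group[OF w])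
      interpret h: group_hom "add_monoid (sp X (g w))" "T X w" "expand w"
        by (intro group_hom.intro group_hom_axioms.intro expand_hom[OF w] A.is_group G.is_group)
      have "expand w \<zero>\<^bsub>sp X (g w)\<^esub> = \<one>\<^bsub>T X w\<^esub>" using h.hom_one by simp
      then show ?thesis unfolding e using 1 False by (simp add: contract_gen_def expand_def)
    qed
  qed
  then show ?thesis by simp
qed

lemma contract_expand:
  assumes w: "w \<in> vertices R" and x: "x \<in> carrier (sp X (g w))"
  shows "contract X w (expand w x) = x"
  using contract_hom_val(2)[OF w target_vertex[OF w] x one_in_M[OF w]] vectorspace_smult(5)[OF target_space[OF w] x]
  by (simp add: expand_def contract_gen_def path_map_refl)

lemma contract_bij:
  assumes w: "w \<in> vertices R"
  shows "bij_betw (contract X w) (carrier (T X w)) (carrier (sp X (g w)))"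
proof (rule bij_betwI[where g = "expand w"])
  show "contract X w \<in> carrier (T X w) \<rightarrow> carrier (sp X (g w))"
    using hom_in_carrier[OF contract_hom_val(1)[OF w]] by auto
  show "expand w \<in> carrier (sp X (g w)) \<rightarrow> carrier (T X w)"
    using hom_in_carrier[OF expand_hom[OF w]] by auto
qed (use expand_contract[OF w] contract_expand[OF w] in auto)

lemma contract_add:
  assumes "w \<in> vertices R" "s \<in> carrier (T X w)" "t \<in> carrier (T X w)"
  shows "contract X w (s \<otimes>\<^bsub>T X w\<^esub> t) = contract X w s \<oplus>\<^bsub>sp X (g w)\<^esub> contract X w t"
  using hom_mult[OF contract_hom_val(1)[OF assms(1)] assms(2,3)] by simp

lemma contract_closed: "w \<in> vertices R \<Longrightarrow> t \<in> carrier (T X w) \<Longrightarrow> contract X w t \<in> carrier (sp X (g w))"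
  using hom_in_carrier[OF contract_hom_val(1)] by simp

lemma smult_hom:
  assumes w: "w \<in> vertices R" and c: "c \<in> carrier K"
  shows "(\<lambda>x. c \<odot>\<^bsub>sp X (g w)\<^esub> x) \<in> hom (add_monoid (sp X (g w))) (add_monoid (sp X (g w)))"
  by (rule homI) (use vectorspaceD(4)[OF target_space[OF w]] vectorspace_smult(1)[OF target_space[OF w]] c in simp_all)

lemma contract_smult:
  assumes w: "w \<in> vertices R" and c: "c \<in> carrier K" and t: "t \<in> carrier (T X w)"
  shows "contract X w (c \<odot>\<^bsub>sp (tensor X) w\<^esub> t) = c \<odot>\<^bsub>sp X (g w)\<^esub> contract X w t"
proof -
  interpret A: comm_group "add_monoid (sp X (g w))" by (rule add_group[OF w])
  interpret V: vectorspace K "sp X (g w)" by (rule target_space[OF w])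
  have "(contract X w \<circ> (\<lambda>t. c \<odot>\<^bsub>sp (tensor X) w\<^esub> t)) t = ((\<lambda>x. c \<odot>\<^bsub>sp X (g w)\<^esub> x) \<circ> contract X w) t"
  proof (rule tns_hom_eq[OF X w A.is_group hom_compose[OF tensor_smult(1)[OF X w c] contract_hom_val(1)[OF w]]
        hom_compose[OF contract_hom_val(1)[OF w] smult_hom[OF w c]] _ t])
    fix a x y assume a: "a \<in> vertices Q" and x: "x \<in> carrier (sp X a)" and y: "y \<in> carrier (sp M (a, w))"
    have cx: "c \<odot>\<^bsub>sp X a\<^esub> x \<in> carrier (sp X a)" by (rule vectorspaceD(4)[OF fd_repD(1)[OF X a] c x])
    have "contract_gen X w (a, c \<odot>\<^bsub>sp X a\<^esub> x, y) = c \<odot>\<^bsub>sp X (g w)\<^esub> contract_gen X w (a, x, y)"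
      using module_hom_smult[OF path_map_target_hom[OF a _ w] c x] path_map_target_closed[OF a _ w x] M_carrier[OF a w y] c
        vectorspace_smult(2)[OF target_space[OF w], of y c "path_map X a (g w) x"]
      by (simp add: contract_gen_def)
    then show "(contract X w \<circ> (\<lambda>t. c \<odot>\<^bsub>sp (tensor X) w\<^esub> t)) (tns X w a x y) =
        ((\<lambda>x. c \<odot>\<^bsub>sp X (g w)\<^esub> x) \<circ> contract X w) (tns X w a x y)"
      using contract_hom_val(2)[OF w a x y] contract_hom_val(2)[OF w a cx y] tensor_smult(2)[OF X w c a x y] by simp
  qed
  then show ?thesis by simp
qed

text \<open>Naturality in the vertex: under contraction the arrows of the tensor product become the path
actions of \<open>X\<close>, as in the pullback of \<open>X\<close> along \<open>g\<close>.\<close>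

lemma contract_ar:
  assumes uw: "(u, w) \<in> arrows R" and t: "t \<in> carrier (T X u)"
  shows "contract X w (ar (tensor X) u w t) = path_map X (g u) (g w) (contract X u t)"
proof -
  have u: "u \<in> vertices R" and w: "w \<in> vertices R" using arrowR[OF uw] by auto
  note le = mono[OF uw]
  have h: "path_map X (g u) (g w) \<in> module_hom K (sp X (g u)) (sp X (g w))"
    by (rule path_map_target_hom[OF target_vertex[OF u] le w])
  have h': "path_map X (g u) (g w) \<in> hom (add_monoid (sp X (g u))) (add_monoid (sp X (g w)))"
    by (rule homI) (use module_hom_carrier[OF h] module_hom_add[OF h] in simp_all)
  interpret A: comm_group "add_monoid (sp X (g w))" by (rule add_group[OF w])
  have "(contract X w \<circ> ar (tensor X) u w) t = (path_map X (g u) (g w) \<circ> contract X u) t"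
  proof (rule tns_hom_eq[OF X u A.is_group hom_compose[OF tensor_ar(1)[OF X uw] contract_hom_val(1)[OF w]]
        hom_compose[OF contract_hom_val(1)[OF u] h'] _ t])
    fix a x y assume a: "a \<in> vertices Q" and x: "x \<in> carrier (sp X a)" and y: "y \<in> carrier (sp M (a, u))"
    have y': "y \<in> carrier (sp M (a, w))"
      using module_hom_carrier[OF M_right[OF a uw] y] M_right_val[OF a uw y] by simp
    have "contract_gen X w (a, x, y) = path_map X (g u) (g w) (contract_gen X u (a, x, y))"
    proof (cases "a \<le> g u")
      case True
      then show ?thesis
        using module_hom_smult[OF h M_carrier[OF a u y] path_map_target_closed[OF a True u x]]
          path_map_comp[OF True le, of X x] le by (simp add: contract_gen_def)
    next
      case False
      then have "y = \<zero>\<^bsub>K\<^esub>" using y M_simps(1)[OF a u] by simp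
      then show ?thesis
        using False module_hom_zero[OF target_space[OF u] target_space[OF w] h] path_map_target_closed[OF a _ w x]
          vectorspace_smult(6)[OF target_space[OF w]] by (simp add: contract_gen_def)
    qed
    then show "(contract X w \<circ> ar (tensor X) u w) (tns X u a x y) = (path_map X (g u) (g w) \<circ> contract X u) (tns X u a x y)"
      using contract_hom_val(2)[OF u a x y] contract_hom_val(2)[OF w a x y'] tensor_ar(2)[OF X uw a x y]
        M_right_val[OF a uw y] by simp
  qed
  then show ?thesis by simp
qed

lemma contract_inj:
  "w \<in> vertices R \<Longrightarrow> s \<in> carrier (T X w) \<Longrightarrow> t \<in> carrier (T X w) \<Longrightarrow> contract X w s = contract X w t \<Longrightarrow> s = t"
  using contract_bij by (auto simp: bij_betw_def inj_on_def)

lemma tensor_space: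
  assumes w: "w \<in> vertices R"
  shows "vectorspace K (sp (tensor X) w)"
proof -
  interpret G: comm_group "T X w" by (rule T_comm[OF X w])
  interpret A: comm_group "add_monoid (sp X (g w))" by (rule add_group[OF w])
  interpret h: group_hom "T X w" "add_monoid (sp X (g w))" "contract X w"
    by (intro group_hom.intro group_hom_axioms.intro contract_hom_val(1)[OF w] A.is_group G.is_group)
  show ?thesis
    by (rule vectorspace_transport[OF target_space[OF w], of "contract X w"])
       (use contract_bij[OF w] contract_add[OF w] contract_smult[OF w] h.hom_one hom_in_carrier[OF tensor_smult(1)[OF X w]] in
         \<open>simp_all add: tensor_simps\<close>)
qed

lemma contract_module_hom:
  assumes w: "w \<in> vertices R"
  shows "contract X w \<in> module_hom K (sp (tensor X) w) (sp X (g w))"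
  by (rule module_homI)
     (use contract_closed[OF w] contract_add[OF w] contract_smult[OF w] in \<open>simp_all add: tensor_simps\<close>)

lemma tensor_fin_dim:
  assumes w: "w \<in> vertices R"
  shows "vectorspace.fin_dim K (sp (tensor X) w)"
    and "rep_dim K (tensor X) w = rep_dim K X (g w)"
proof -
  note b = contract_bij[OF w, folded tensor_simps(1)]
  note inv = module_hom_inv[OF tensor_space[OF w] contract_module_hom[OF w] b]
  show fd: "vectorspace.fin_dim K (sp (tensor X) w)"
    by (rule module_hom_surj_fin_dim[OF target_space[OF w] tensor_space[OF w] inv _ fd_repD(2)[OF X target_vertex[OF w]]])
       (use bij_betw_inv_into[OF b] in \<open>simp add: bij_betw_def\<close>)
  show "rep_dim K (tensor X) w = rep_dim K X (g w)"
    by (rule module_iso_dim[OF tensor_space[OF w] target_space[OF w] contract_module_hom[OF w] b fd])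
qed

text \<open>Linearity of the arrows and the commutation relations are checked after contraction, where they
become statements about paths in \<open>X\<close>.\<close>

lemma tensor_fd: "fd_rep K R (tensor X)"
proof (rule fd_repI)
  fix u w assume uw: "(u, w) \<in> arrows R"
  have u: "u \<in> vertices R" and w: "w \<in> vertices R" using arrowR[OF uw] by auto
  note h = tensor_ar(1)[OF X uw]
  show "ar (tensor X) u w \<in> module_hom K (sp (tensor X) u) (sp (tensor X) w)"
  proof (rule module_homI)
    fix c t assume c: "c \<in> carrier K" and "t \<in> carrier (sp (tensor X) u)"
    then have t: "t \<in> carrier (T X u)" by (simp add: tensor_simps)
    have ct: "c \<odot>\<^bsub>sp (tensor X) u\<^esub> t \<in> carrier (T X u)"
      by (rule hom_in_carrier[OF tensor_smult(1)[OF X u c] t])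
    have at: "ar (tensor X) u w t \<in> carrier (T X w)" by (rule hom_in_carrier[OF h t])
    show "ar (tensor X) u w (c \<odot>\<^bsub>sp (tensor X) u\<^esub> t) = c \<odot>\<^bsub>sp (tensor X) w\<^esub> ar (tensor X) u w t"
    proof (rule contract_inj[OF w hom_in_carrier[OF h ct] hom_in_carrier[OF tensor_smult(1)[OF X w c] at]])
      show "contract X w (ar (tensor X) u w (c \<odot>\<^bsub>sp (tensor X) u\<^esub> t)) = contract X w (c \<odot>\<^bsub>sp (tensor X) w\<^esub> ar (tensor X) u w t)"
        using module_hom_smult[OF path_map_target_hom[OF target_vertex[OF u] mono[OF uw] w] c contract_closed[OF u t]]
        by (simp add: contract_ar[OF uw ct] contract_smult[OF u c t] contract_smult[OF w c at] contract_ar[OF uw t])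
    qed
  qed (use hom_in_carrier[OF h] hom_mult[OF h] in \<open>simp_all add: tensor_simps\<close>)
next
  fix a b c d t assume sq: "(a, b, c, d) \<in> squares R" and "t \<in> carrier (sp (tensor X) a)"
  then have t: "t \<in> carrier (T X a)" by (simp add: tensor_simps)
  have s: "(a, b) \<in> arrows R" "(b, d) \<in> arrows R" "(a, c) \<in> arrows R" "(c, d) \<in> arrows R"
    using squareR[OF sq] by auto
  note b = hom_in_carrier[OF tensor_ar(1)[OF X s(1)] t] and c = hom_in_carrier[OF tensor_ar(1)[OF X s(3)] t]
  have d: "d \<in> vertices R" using arrowR[OF s(2)] by simp
  show "ar (tensor X) b d (ar (tensor X) a b t) = ar (tensor X) c d (ar (tensor X) a c t)"
  proof (rule contract_inj[OF d hom_in_carrier[OF tensor_ar(1)[OF X s(2)] b] hom_in_carrier[OF tensor_ar(1)[OF X s(4)] c]])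
    show "contract X d (ar (tensor X) b d (ar (tensor X) a b t)) = contract X d (ar (tensor X) c d (ar (tensor X) a c t))"
      by (simp add: contract_ar[OF s(2) b] contract_ar[OF s(1) t] contract_ar[OF s(4) c] contract_ar[OF s(3) t]
          path_map_comp[OF mono[OF s(1)] mono[OF s(2)]] path_map_comp[OF mono[OF s(3)] mono[OF s(4)]])
  qed
qed (use tensor_space tensor_fin_dim(1) in auto)

end

text \<open>Naturality in the module.\<close>

lemma contract_map:
  assumes X: "fd_rep K Q X" and Y: "fd_rep K Q Y" and f: "rep_hom K Q X Y f"
    and w: "w \<in> vertices R" and t: "t \<in> carrier (T X w)"
  shows "contract Y w (tmap X Y f w t) = f (g w) (contract X w t)"
proof -
  note F = rep_homD(1)[OF f target_vertex[OF X w]]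
  have h: "f (g w) \<in> hom (add_monoid (sp X (g w))) (add_monoid (sp Y (g w)))"
    by (rule homI) (use module_hom_carrier[OF F] module_hom_add[OF F] in simp_all)
  interpret A: comm_group "add_monoid (sp Y (g w))" by (rule add_group[OF Y w])
  have "(contract Y w \<circ> tmap X Y f w) t = (f (g w) \<circ> contract X w) t"
  proof (rule tns_hom_eq[OF X w A.is_group hom_compose[OF tensor_map(1)[OF X Y f w] contract_hom_val(1)[OF Y w]]
        hom_compose[OF contract_hom_val(1)[OF X w] h] _ t])
    fix a x y assume a: "a \<in> vertices Q" and x: "x \<in> carrier (sp X a)" and y: "y \<in> carrier (sp M (a, w))"
    have fx: "f a x \<in> carrier (sp Y a)" by (rule module_hom_carrier[OF rep_homD(1)[OF f a] x])
    have "contract_gen Y w (a, f a x, y) = f (g w) (contract_gen X w (a, x, y))"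
      using path_map_natural[OF X f _ _ _ x, of "g w"] a range[OF w] module_hom_zero[OF target_space[OF X w] target_space[OF Y w] F]
        module_hom_smult[OF F M_carrier[OF a w y] path_map_target_closed[OF X a _ w x]]
      by (simp add: contract_gen_def path_vertices)
    then show "(contract Y w \<circ> tmap X Y f w) (tns X w a x y) = (f (g w) \<circ> contract X w) (tns X w a x y)"
      using contract_hom_val(2)[OF X w a x y] contract_hom_val(2)[OF Y w a fx y] tensor_map(2)[OF X Y f w a x y] by simp
  qed
  then show ?thesis by simp
qed

lemma tmap_rep_hom:
  assumes X: "fd_rep K Q X" and Y: "fd_rep K Q Y" and f: "rep_hom K Q X Y f"
  shows "rep_hom K R (tensor X) (tensor Y) (tmap X Y f)"
proof (rule rep_homI)
  fix w assume w: "w \<in> vertices R"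
  note h = tensor_map(1)[OF X Y f w]
  note F = rep_homD(1)[OF f target_vertex[OF X w]]
  show "tmap X Y f w \<in> module_hom K (sp (tensor X) w) (sp (tensor Y) w)"
  proof (rule module_homI)
    fix c t assume c: "c \<in> carrier K" and "t \<in> carrier (sp (tensor X) w)"
    then have t: "t \<in> carrier (T X w)" by (simp add: tensor_simps)
    have ct: "c \<odot>\<^bsub>sp (tensor X) w\<^esub> t \<in> carrier (T X w)" by (rule hom_in_carrier[OF tensor_smult(1)[OF X w c] t])
    note mt = hom_in_carrier[OF h t]
    show "tmap X Y f w (c \<odot>\<^bsub>sp (tensor X) w\<^esub> t) = c \<odot>\<^bsub>sp (tensor Y) w\<^esub> tmap X Y f w t"
    proof (rule contract_inj[OF Y w hom_in_carrier[OF h ct] hom_in_carrier[OF tensor_smult(1)[OF Y w c] mt]])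
      show "contract Y w (tmap X Y f w (c \<odot>\<^bsub>sp (tensor X) w\<^esub> t)) = contract Y w (c \<odot>\<^bsub>sp (tensor Y) w\<^esub> tmap X Y f w t)"
        using module_hom_smult[OF F c contract_closed[OF X w t]]
        by (simp add: contract_map[OF X Y f w ct] contract_smult[OF X w c t] contract_smult[OF Y w c mt] contract_map[OF X Y f w t])
    qed
  qed (use hom_in_carrier[OF h] hom_mult[OF h] in \<open>simp_all add: tensor_simps\<close>)
next
  fix u w t assume uw: "(u, w) \<in> arrows R" and "t \<in> carrier (sp (tensor X) u)"
  then have t: "t \<in> carrier (T X u)" by (simp add: tensor_simps)
  have u: "u \<in> vertices R" and w: "w \<in> vertices R" using arrowR[OF uw] by auto
  note at = hom_in_carrier[OF tensor_ar(1)[OF X uw] t] and mt = hom_in_carrier[OF tensor_map(1)[OF X Y f u] t]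
  show "tmap X Y f w (ar (tensor X) u w t) = ar (tensor Y) u w (tmap X Y f u t)"
  proof (rule contract_inj[OF Y w hom_in_carrier[OF tensor_map(1)[OF X Y f w] at] hom_in_carrier[OF tensor_ar(1)[OF Y uw] mt]])
    show "contract Y w (tmap X Y f w (ar (tensor X) u w t)) = contract Y w (ar (tensor Y) u w (tmap X Y f u t))"
      using path_map_natural[OF X f _ mono[OF uw] _ contract_closed[OF X u t]] range[OF u] range[OF w]
      by (simp add: contract_map[OF X Y f w at] contract_ar[OF X uw t] contract_ar[OF Y uw mt] contract_map[OF X Y f u t])
  qed
qed

text \<open>Contraction identifies the functor with evaluation at the vertices \<open>g w\<close>, and evaluation at a vertex
preserves identities, composites and exact sequences.\<close>

lemma tensor_exact: "exact_functor K Q R (tensor :: (nat, 'k, 'u) rep \<Rightarrow> _) tmap"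
  unfolding exact_functor_def
proof (intro conjI allI impI ballI)
  show "fd_rep K R (tensor X)" if "fd_rep K Q X" for X :: "(nat, 'k, 'u) rep"
    by (rule tensor_fd[OF that])
next
  fix X Y :: "(nat, 'k, 'u) rep" and f
  assume "fd_rep K Q X \<and> fd_rep K Q Y \<and> rep_hom K Q X Y f"
  then show "rep_hom K R (tensor X) (tensor Y) (tmap X Y f)" using tmap_rep_hom by blast
next
  fix X :: "(nat, 'k, 'u) rep" and f w t
  assume a: "fd_rep K Q X \<and> rep_hom K Q X X f \<and> (\<forall>a\<in>vertices Q. \<forall>x\<in>carrier (sp X a). f a x = x)"
    and w: "w \<in> vertices R" and "t \<in> carrier (sp (tensor X) w)"
  then have X: "fd_rep K Q X" and f: "rep_hom K Q X X f" and t: "t \<in> carrier (T X w)"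
    by (simp_all add: tensor_simps)
  show "tmap X X f w t = t"
    by (rule contract_inj[OF X w hom_in_carrier[OF tensor_map(1)[OF X X f w] t] t])
       (use a target_vertex[OF X w] contract_closed[OF X w t] in \<open>simp add: contract_map[OF X X f w t]\<close>)
next
  fix X Y Z :: "(nat, 'k, 'u) rep" and f h k w t
  assume a: "fd_rep K Q X \<and> fd_rep K Q Y \<and> fd_rep K Q Z \<and> rep_hom K Q X Y f \<and> rep_hom K Q Y Z h \<and>
      rep_hom K Q X Z k \<and> (\<forall>a\<in>vertices Q. \<forall>x\<in>carrier (sp X a). k a x = h a (f a x))"
    and w: "w \<in> vertices R" and "t \<in> carrier (sp (tensor X) w)"
  then have X: "fd_rep K Q X" and Y: "fd_rep K Q Y" and Z: "fd_rep K Q Z" and f: "rep_hom K Q X Y f"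
    and h: "rep_hom K Q Y Z h" and k: "rep_hom K Q X Z k" and t: "t \<in> carrier (T X w)"
    by (simp_all add: tensor_simps)
  note ft = hom_in_carrier[OF tensor_map(1)[OF X Y f w] t]
  show "tmap X Z k w t = tmap Y Z h w (tmap X Y f w t)"
    by (rule contract_inj[OF Z w hom_in_carrier[OF tensor_map(1)[OF X Z k w] t]
          hom_in_carrier[OF tensor_map(1)[OF Y Z h w] ft]])
       (use a target_vertex[OF X w] contract_closed[OF X w t] in
         \<open>simp add: contract_map[OF X Z k w t] contract_map[OF Y Z h w ft] contract_map[OF X Y f w t]\<close>)
next
  fix X Y Z :: "(nat, 'k, 'u) rep" and f h
  assume e: "short_exact K Q X Y Z f h"
  note E = short_exactD[OF e]
  note X = E(1) and Y = E(2) and Z = E(3) and f = E(4) and h = E(5)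
  show "short_exact K R (tensor X) (tensor Y) (tensor Z) (tmap X Y f) (tmap Y Z h)"
    unfolding short_exact_def
  proof (intro conjI ballI tensor_fd tmap_rep_hom X Y Z f h)
    fix w assume w: "w \<in> vertices R"
    have g: "g w \<in> vertices Q" by (rule target_vertex[OF X w])
    have lift: "\<exists>t\<in>carrier (T X' w). contract X' w t = x" if "fd_rep K Q X'" "x \<in> carrier (sp X' (g w))"
      for x and X' :: "(nat, 'k, 'u) rep"
      using that(2)[folded bij_betw_imp_surj_on[OF contract_bij[OF that(1) w]]] by blast
    note mf = hom_in_carrier[OF tensor_map(1)[OF X Y f w]] and mh = hom_in_carrier[OF tensor_map(1)[OF Y Z h w]]
    interpret GZ: comm_group "T Z w" by (rule T_comm[OF Z w])
    interpret AZ: comm_group "add_monoid (sp Z (g w))" by (rule add_group[OF Z w])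
    interpret hZ: group_hom "T Z w" "add_monoid (sp Z (g w))" "contract Z w"
      by (intro group_hom.intro group_hom_axioms.intro contract_hom_val(1)[OF Z w] AZ.is_group GZ.is_group)
    have z: "contract Z w \<one>\<^bsub>T Z w\<^esub> = \<zero>\<^bsub>sp Z (g w)\<^esub>" using hZ.hom_one by simp
    show "inj_on (tmap X Y f w) (carrier (sp (tensor X) w))"
    proof (rule inj_onI)
      fix s t assume "s \<in> carrier (sp (tensor X) w)" "t \<in> carrier (sp (tensor X) w)"
        and eq: "tmap X Y f w s = tmap X Y f w t"
      then have s: "s \<in> carrier (T X w)" and t: "t \<in> carrier (T X w)" by (simp_all add: tensor_simps)
      have "f (g w) (contract X w s) = f (g w) (contract X w t)"
        using eq contract_map[OF X Y f w s] contract_map[OF X Y f w t] by simp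
      then have "contract X w s = contract X w t"
        using E(6)[OF g] contract_closed[OF X w s] contract_closed[OF X w t] by (simp add: inj_on_def)
      then show "s = t" by (rule contract_inj[OF X w s t])
    qed
    show "tmap X Y f w ` carrier (sp (tensor X) w) =
        {y \<in> carrier (sp (tensor Y) w). tmap Y Z h w y = \<zero>\<^bsub>sp (tensor Z) w\<^esub>}"
      unfolding tensor_simps
    proof (intro equalityI subsetI)
      fix y assume "y \<in> tmap X Y f w ` carrier (T X w)"
      then obtain t where t: "t \<in> carrier (T X w)" "y = tmap X Y f w t" by auto
      have y: "y \<in> carrier (T Y w)" using mf[OF t(1)] t(2) by simp
      have "f (g w) (contract X w t) \<in> f (g w) ` carrier (sp X (g w))" using contract_closed[OF X w t(1)] by (rule imageI)
      then have "h (g w) (f (g w) (contract X w t)) = \<zero>\<^bsub>sp Z (g w)\<^esub>" unfolding E(7)[OF g] by simp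
      then have "contract Z w (tmap Y Z h w y) = contract Z w \<one>\<^bsub>T Z w\<^esub>"
        using contract_map[OF Y Z h w y] contract_map[OF X Y f w t(1)] t(2) z by simp
      then have "tmap Y Z h w y = \<one>\<^bsub>T Z w\<^esub>" by (rule contract_inj[OF Z w mh[OF y] GZ.one_closed])
      then show "y \<in> {y \<in> carrier (T Y w). tmap Y Z h w y = \<one>\<^bsub>T Z w\<^esub>}" using y by simp
    next
      fix y assume "y \<in> {y \<in> carrier (T Y w). tmap Y Z h w y = \<one>\<^bsub>T Z w\<^esub>}"
      then have y: "y \<in> carrier (T Y w)" "tmap Y Z h w y = \<one>\<^bsub>T Z w\<^esub>" by auto
      have "h (g w) (contract Y w y) = \<zero>\<^bsub>sp Z (g w)\<^esub>" using contract_map[OF Y Z h w y(1)] y(2) z by simp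
      then have "contract Y w y \<in> f (g w) ` carrier (sp X (g w))"
        unfolding E(7)[OF g] using contract_closed[OF Y w y(1)] by simp
      then obtain x where x: "x \<in> carrier (sp X (g w))" "contract Y w y = f (g w) x" by auto
      obtain t where t: "t \<in> carrier (T X w)" "contract X w t = x" using lift[OF X x(1)] by auto
      have "y = tmap X Y f w t"
        by (rule contract_inj[OF Y w y(1) mf[OF t(1)]]) (simp add: contract_map[OF X Y f w t(1)] t(2) x(2))
      then show "y \<in> tmap X Y f w ` carrier (T X w)" using t(1) by (rule image_eqI)
    qed
    show "tmap Y Z h w ` carrier (sp (tensor Y) w) = carrier (sp (tensor Z) w)"
      unfolding tensor_simps
    proof (intro equalityI subsetI)
      fix t assume "t \<in> tmap Y Z h w ` carrier (T Y w)"
      then show "t \<in> carrier (T Z w)" using mh by auto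
    next
      fix t assume t: "t \<in> carrier (T Z w)"
      have "contract Z w t \<in> h (g w) ` carrier (sp Y (g w))" unfolding E(8)[OF g] by (rule contract_closed[OF Z w t])
      then obtain x where x: "x \<in> carrier (sp Y (g w))" "contract Z w t = h (g w) x" by auto
      obtain s where s: "s \<in> carrier (T Y w)" "contract Y w s = x" using lift[OF Y x(1)] by auto
      have "t = tmap Y Z h w s"
        by (rule contract_inj[OF Z w t mh[OF s(1)]]) (simp add: contract_map[OF Y Z h w s(1)] s(2) x(2))
      then show "t \<in> tmap Y Z h w ` carrier (T Y w)" using s(1) by (rule image_eqI)
    qed
  qed
qed

end

section \<open>The nabla functors\<close>

text \<open>The largest \<open>\<gamma>\<close> such that \<open>(\<gamma>, j, k)\<close> belongs to the support of the bimodule. This is at the same time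
the index rule of the diassociative composition.\<close>

definition nabla_index :: "nat \<Rightarrow> nat \<Rightarrow> nat \<times> nat \<Rightarrow> nat" where
  "nabla_index n i = (\<lambda>(j, k). if i > j then j else if i = j then i + k - 1 else j + n - 1)"

lemma grid_vertices: "vertices (grid_quiver m n) = {1..m} \<times> {1..n}"
  by (simp add: prod_quiver_def path_quiver_def)

lemma Dias_comp_basis_index: "Dias_comp_basis n i j k = frag_of (nabla_index n i (j, k))"
  by (simp add: Dias_comp_basis_def nabla_index_def)

lemma path_ranked: "field K \<Longrightarrow> ranked_quiver K (path_quiver n) (\<lambda>a. a)"
  by (rule ranked_quiver.intro) (auto simp: path_quiver_def)

lemma grid_ranked: "field K \<Longrightarrow> ranked_quiver K (grid_quiver m n) (\<lambda>(a, b). a + b)"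
  by (rule ranked_quiver.intro) (auto simp: prod_quiver_def path_quiver_def)

lemma nabla_support_below:
  assumes "1 \<le> i" "i \<le> m" "1 \<le> n"
  shows "nabla_support m n i = below (grid_quiver m n) (nabla_index n i)"
  unfolding nabla_support_def below_def grid_vertices nabla_index_def using assms
  by (auto split: if_splits)

lemma nabla_monotone:
  assumes "field K" "1 \<le> i" "i \<le> m" "1 \<le> n"
  shows "monotone_map K (m + n - 1) (grid_quiver m n) (nabla_index n i)"
proof -
  interpret R: ranked_quiver K "grid_quiver m n" "\<lambda>(a, b). a + b" by (rule grid_ranked[OF assms(1)])
  show ?thesis
  proof (rule monotone_map.intro)
    fix u w assume uw: "(u, w) \<in> arrows (grid_quiver m n)"
    then show "nabla_index n i u \<le> nabla_index n i w"
      using assms by (auto simp: prod_quiver_def path_quiver_def nabla_index_def)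
  next
    fix w assume "w \<in> vertices (grid_quiver m n)"
    then show "1 \<le> nabla_index n i w \<and> nabla_index n i w \<le> m + n - 1"
      using assms by (auto simp: grid_vertices nabla_index_def)
  qed (use assms(1) R.arrow R.square in blast)+
qed

text \<open>The fibres are the rows of the grid, except that the row \<open>i\<close> is cut into single cells. Hence the three
cases for the images of the simple modules.\<close>

lemma nabla_fiber:
  assumes "1 \<le> i" "i \<le> m" "j \<in> {1..m + n - 1}"
  shows "{w \<in> {1..m} \<times> {1..n}. nabla_index n i w = j} =
    (if j \<le> i - 1 then Pair j ` {1..n}
     else if j \<le> i + n - 1 then {(i, j - i + 1)}
     else Pair (j - n + 1) ` {1..n})"
  using assms by (auto simp: nabla_index_def image_iff split: if_splits)

lemma path_class_basis:
  assumes "field K"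
  shows "Z_basis (K0_path K p) (simple_path_class K p) {1..p}"
proof -
  interpret P: ranked_quiver K "path_quiver p" "\<lambda>a. a" by (rule path_ranked[OF assms])
  show ?thesis using P.Z_basis_K0 by (simp add: path_quiver_def)
qed

lemma grid_class_basis:
  assumes "field K"
  shows "Z_basis (K0_grid K m n) (simple_grid_class K m n) ({1..m} \<times> {1..n})"
proof -
  interpret R: ranked_quiver K "grid_quiver m n" "\<lambda>(a, b). a + b" by (rule grid_ranked[OF assms])
  show ?thesis using R.Z_basis_K0 unfolding grid_vertices .
qed

lemma K0_path_comm: "field K \<Longrightarrow> comm_group (K0_path K p)"
  by (rule ranked_quiver.K0_comm[OF path_ranked])

lemma K0_grid_comm: "field K \<Longrightarrow> comm_group (K0_grid K m n)"
  by (rule ranked_quiver.K0_comm[OF grid_ranked])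

lemma dual_simple_basis:
  assumes "field K"
  shows "Z_basis (dual_group (K0_path K p)) (dual_simple K p) {1..p}"
  using Z_basis_dual[OF K0_path_comm[OF assms] path_class_basis[OF assms]]
  unfolding dual_simple_def by simp

lemma dual_simple_char:
  assumes "field K" "j \<in> {1..p}"
  shows "dual_simple K p j \<in> carrier (dual_group (K0_path K p))"
    and "l \<in> {1..p} \<Longrightarrow> dual_simple K p j (simple_path_class K p l) = (if l = j then 1 else 0)"
  unfolding dual_simple_def
  by (rule dual_basis_char[OF K0_path_comm[OF assms(1)] path_class_basis[OF assms(1)] assms(2)])+

lemma Dias_to_dual_iso:
  assumes "field K"
  shows "Dias_to_dual K p \<in> iso (Dias p) (dual_group (K0_path K p))"
  using dual_simple_basis[OF assms, of p] by (simp add: Z_basis_def Dias_to_dual_def Dias_def)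

lemma Dias_to_dual_frag_of:
  assumes "field K" "j \<in> {1..p}"
  shows "Dias_to_dual K p (frag_of j) = dual_simple K p j"
  unfolding Dias_to_dual_def
  by (rule lin_ext_frag_of[of "dual_group (K0_path K p)" "dual_simple K p",
        OF dual_group_comm[OF K0_path_comm[OF assms(1)]] dual_simple_char(1)[OF assms]])

text \<open>The defining conditions prescribe a homomorphism on a basis of the tensor product, which determines
it; as the prescribed values form a basis, it is an isomorphism.\<close>

lemma K0_tensor_ident_char:
  assumes "field K"
  shows "K0_tensor_ident K m n \<in> iso (tensor_group (K0_path K m) (K0_path K n)) (K0_grid K m n)"
    and "j \<in> {1..m} \<Longrightarrow> k \<in> {1..n} \<Longrightarrow>
      K0_tensor_ident K m n
        (tens (K0_path K m) (K0_path K n) (simple_path_class K m j) (simple_path_class K n k)) =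
      simple_grid_class K m n (j, k)"
proof -
  note G = K0_path_comm[OF assms, of m] and H = K0_path_comm[OF assms, of n] and L = K0_grid_comm[OF assms, of m n]
  note T = tensor_group_comm[OF G H]
  note B = Z_basis_tensor[OF G path_class_basis[OF assms, of m] H path_class_basis[OF assms, of n]]
  note C = grid_class_basis[OF assms, of m n]
  have Cc: "simple_grid_class K m n \<in> {1..m} \<times> {1..n} \<rightarrow> carrier (K0_grid K m n)"
    using C by (simp add: Z_basis_def)
  from Z_basis_unique_hom[OF T B L Cc]
  have "\<exists>!h. h \<in> hom (tensor_group (K0_path K m) (K0_path K n)) (K0_grid K m n) \<and>
        h \<in> extensional (carrier (tensor_group (K0_path K m) (K0_path K n))) \<and>
        (\<forall>j\<in>{1..m}. \<forall>k\<in>{1..n}.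
           h (tens (K0_path K m) (K0_path K n) (simple_path_class K m j) (simple_path_class K n k)) =
           simple_grid_class K m n (j, k))" by (simp only: split_paired_Ball_Sigma split_conv)
  note h = theI'[OF this, folded K0_tensor_ident_def]
  show v: "K0_tensor_ident K m n
        (tens (K0_path K m) (K0_path K n) (simple_path_class K m j) (simple_path_class K n k)) =
      simple_grid_class K m n (j, k)" if "j \<in> {1..m}" "k \<in> {1..n}" for j k
    using h that by blast
  show "K0_tensor_ident K m n \<in> iso (tensor_group (K0_path K m) (K0_path K n)) (K0_grid K m n)"
    by (rule Z_basis_iso[OF T B L C]) (use h v in auto)
qed

lemma dual_tensor_ident_char:
  assumes "field K"
  shows "dual_tensor_ident K m n \<in>
       iso (tensor_group (dual_group (K0_path K m)) (dual_group (K0_path K n)))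
         (dual_group (K0_grid K m n))"
    and "j \<in> {1..m} \<Longrightarrow> k \<in> {1..n} \<Longrightarrow>
      dual_tensor_ident K m n
        (tens (dual_group (K0_path K m)) (dual_group (K0_path K n)) (dual_simple K m j) (dual_simple K n k)) =
      dual_basis (K0_grid K m n) (simple_grid_class K m n) ({1..m} \<times> {1..n}) (j, k)"
proof -
  note L = dual_tensor_iso[OF K0_path_comm[OF assms, of m] path_class_basis[OF assms, of m] finite_atLeastAtMost
      K0_path_comm[OF assms, of n] path_class_basis[OF assms, of n] finite_atLeastAtMost
      K0_grid_comm[OF assms, of m n] grid_class_basis[OF assms, of m n]
      K0_tensor_ident_char(1)[OF assms, of m n] K0_tensor_ident_char(2)[OF assms],
      folded dual_tensor_ident_def dual_simple_def]
  show "dual_tensor_ident K m n \<in>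
       iso (tensor_group (dual_group (K0_path K m)) (dual_group (K0_path K n)))
         (dual_group (K0_grid K m n))" by (rule L(1))
  show "dual_tensor_ident K m n
        (tens (dual_group (K0_path K m)) (dual_group (K0_path K n)) (dual_simple K m j) (dual_simple K n k)) =
      dual_basis (K0_grid K m n) (simple_grid_class K m n) ({1..m} \<times> {1..n}) (j, k)"
    if "j \<in> {1..m}" "k \<in> {1..n}"
    unfolding dual_simple_def by (rule L(2)[unfolded dual_simple_def]) (use that in simp_all)
qed

locale nabla_setting =
  fixes K :: "('k, 'r) ring_scheme" and m n i :: nat
  assumes K: "field K" and m: "1 \<le> m" and n: "1 \<le> n" and i: "1 \<le> i" "i \<le> m"
begin

abbreviation "V \<equiv> {1..m} \<times> {1..n}"

sublocale Pb: monotone_map K "m + n - 1" "grid_quiver m n" "nabla_index n i"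
  by (rule nabla_monotone[OF K i n])

sublocale P: ranked_quiver K "path_quiver (m + n - 1)" "\<lambda>a. a" by (rule path_ranked[OF K])
sublocale R: ranked_quiver K "grid_quiver m n" "\<lambda>(a, b). a + b" by (rule grid_ranked[OF K])

lemma nabla_bimodule_eq: "nabla_bimodule K m n i = standard_rep K (below (grid_quiver m n) (nabla_index n i))"
  unfolding nabla_bimodule_def nabla_support_below[OF i n] ..

lemma nabla_eq: "nabla K m n i = Pb.tensor" and nabla_map_eq: "nabla_map K m n i = Pb.tmap"
  unfolding nabla_def nabla_map_def nabla_bimodule_eq by (rule refl)+

lemma nabla_fd: "fd_rep K (path_quiver (m + n - 1)) X \<Longrightarrow> fd_rep K (grid_quiver m n) (nabla K m n i X)"
  unfolding nabla_eq by (rule Pb.tensor_fd)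

lemma nabla_dim:
  assumes "fd_rep K (path_quiver (m + n - 1)) X" "w \<in> vertices (grid_quiver m n)"
  shows "rep_dim K (nabla K m n i X) w = rep_dim K X (nabla_index n i w)"
  unfolding nabla_eq by (rule Pb.tensor_fin_dim(2)[OF assms])

lemma index_vertex: "w \<in> vertices (grid_quiver m n) \<Longrightarrow> nabla_index n i w \<in> vertices (path_quiver (m + n - 1))"
  using Pb.range by (simp add: path_vertices)

lemmas nabla_K0_pres = K0_map_hom[OF P.ranked_quiver_axioms R.ranked_quiver_axioms
    nabla_fd nabla_dim index_vertex]

lemma nabla_K0_hom: "nabla_K0 K m n i \<in> hom (K0_path K (m + n - 1)) (K0_grid K m n)"
  by (rule nabla_K0_pres(1))

text \<open>The induced map is defined on representatives in the universe of the Grothendieck group. The passage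
to other carrier types only needs that the representative has the same dimensions.\<close>

lemma nabla_K0_class:
  assumes X: "fd_rep K (path_quiver (m + n - 1)) X"
  shows "nabla_K0 K m n i (K0_class K (path_quiver (m + n - 1)) X) = K0_class K (grid_quiver m n) (nabla K m n i X)"
proof -
  obtain Y where Y: "fd_rep K (path_quiver (m + n - 1)) Y" "rep_iso K (path_quiver (m + n - 1)) Y X"
    "K0_class K (path_quiver (m + n - 1)) X = P.cl Y" by (rule P.K0_class_obtain[OF X])
  have "nabla_K0 K m n i (P.cl Y) = K0_class K (grid_quiver m n) (nabla K m n i Y)"
    by (rule nabla_K0_pres(2)) (assumption | rule Y(1))+
  also have "\<dots> = K0_class K (grid_quiver m n) (nabla K m n i X)"
    by (rule R.K0_class_cong_dim[OF nabla_fd[OF Y(1)] nabla_fd[OF X]])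
       (simp add: nabla_dim[OF Y(1)] nabla_dim[OF X] rep_iso_dim[OF Y(1) X Y(2) index_vertex])
  finally show ?thesis by (simp only: Y(3))
qed

text \<open>The dimension of the image of \<open>S\<^sub>j\<close> at \<open>w\<close> is 1 if \<open>nabla_index n i w = j\<close>, and 0 otherwise.\<close>

lemma nabla_simple:
  "K0_class K (grid_quiver m n) (nabla K m n i (standard_rep K {j})) =
   lin_ext (K0_grid K m n) (simple_grid_class K m n) (\<Sum>w | w \<in> V \<and> nabla_index n i w = j. frag_of w)"
proof -
  let ?S = "{w \<in> V. nabla_index n i w = j}"
  have "R.dimvec (rep_dim K (nabla K m n i (standard_rep K {j}))) = R.dimvec (\<lambda>w. if w \<in> ?S then 1 else 0)"
    by (rule R.dimvec_cong) (simp add: nabla_dim[OF P.simple_fd] standard_rep_dim[OF K] grid_vertices)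
  also have "\<dots> = (\<Sum>w\<in>?S. frag_of w)"
    by (rule R.dimvec_indicator) (auto simp: grid_vertices)
  finally show ?thesis
    using R.K0_class_dimvec[OF nabla_fd[OF P.simple_fd[of j]]] by simp
qed

lemma nabla_K0_simple:
  "nabla_K0 K m n i (simple_path_class K (m + n - 1) j) =
   lin_ext (K0_grid K m n) (simple_grid_class K m n) (\<Sum>w | w \<in> V \<and> nabla_index n i w = j. frag_of w)"
  by (simp only: nabla_K0_class[OF P.simple_fd] nabla_simple)

lemma nabla_simple_cases:
  assumes j: "j \<in> {1..m + n - 1}"
  shows "K0_class K (grid_quiver m n) (nabla K m n i (standard_rep K {j})) =
    (if j \<le> i - 1 then
       (\<Otimes>\<^bsub>K0_grid K m n\<^esub> k\<in>{1..n}. simple_grid_class K m n (j, k))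
     else if j \<le> i + n - 1 then
       simple_grid_class K m n (i, j - i + 1)
     else
       (\<Otimes>\<^bsub>K0_grid K m n\<^esub> k\<in>{1..n}. simple_grid_class K m n (j - n + 1, k)))"
proof -
  let ?S = "{w \<in> V. nabla_index n i w = j}" and ?s = "simple_grid_class K m n" and ?G = "K0_grid K m n"
  interpret G: comm_group ?G by (rule K0_grid_comm[OF K])
  have s: "?s \<in> V \<rightarrow> carrier ?G" using grid_class_basis[OF K] by (simp add: Z_basis_def)
  then have s': "?s \<in> ?S \<rightarrow> carrier ?G" by auto
  have "K0_class K (grid_quiver m n) (nabla K m n i (standard_rep K {j})) = finprod ?G ?s ?S"
    unfolding nabla_simple by (rule lin_ext_sum_frag_of[OF G.comm_group_axioms s']) simp
  moreover have row: "finprod ?G ?s (Pair l ` {1..n}) = (\<Otimes>\<^bsub>?G\<^esub> k\<in>{1..n}. ?s (l, k))"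
    if "?S = Pair l ` {1..n}" for l
    by (rule G.finprod_reindex) (use s' that in \<open>auto simp: inj_on_def\<close>)
  moreover have cell: "finprod ?G ?s {v} = ?s v" if "?S = {v}" for v
  proof -
    have "?s v \<in> carrier ?G" using funcset_mem[OF s', of v] that by blast
    then show ?thesis by simp
  qed
  moreover note S = nabla_fiber[OF i j]
  ultimately show ?thesis
    by (cases "j \<le> i - 1"; cases "j \<le> i + n - 1") (simp_all only: if_True if_False)
qed

lemma circ_hom:
  "circ K m n i \<in> hom (tensor_group (dual_group (K0_path K m)) (dual_group (K0_path K n)))
     (dual_group (K0_path K (m + n - 1)))"
proof -
  have "circ K m n i = dual_map (K0_path K (m + n - 1)) (nabla_K0 K m n i) \<circ> dual_tensor_ident K m n"
    by (rule ext) (simp add: circ_def)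
  also have "\<dots> \<in> hom (tensor_group (dual_group (K0_path K m)) (dual_group (K0_path K n)))
     (dual_group (K0_path K (m + n - 1)))"
    by (rule hom_compose[OF _ dual_map_hom[OF comm_group.axioms(2)[OF K0_path_comm[OF K]] nabla_K0_hom]])
       (use dual_tensor_ident_char(1)[OF K] in \<open>simp add: iso_def\<close>)
  finally show ?thesis .
qed

text \<open>The coefficient of \<open>[S\<^sub>(\<^sub>j\<^sub>,\<^sub>k\<^sub>)]\<close> in the image of \<open>[S\<^sub>l]\<close> is 1 exactly if \<open>l = nabla_index n i (j, k)\<close>. As a
function of \<open>l\<close> this is a dual basis vector.\<close>

lemma circ_basis:
  assumes j: "j \<in> {1..m}" and k: "k \<in> {1..n}"
  shows "circ K m n i
          (tens (dual_group (K0_path K m)) (dual_group (K0_path K n)) (dual_simple K m j) (dual_simple K n k)) =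
    dual_simple K (m + n - 1) (nabla_index n i (j, k))"
proof -
  let ?G = "K0_path K (m + n - 1)" and ?L = "K0_grid K m n" and ?s = "simple_grid_class K m n"
  let ?e = "dual_basis ?L ?s V (j, k)"
  have jk: "(j, k) \<in> V" using j k by simp
  have idx: "nabla_index n i (j, k) \<in> {1..m + n - 1}"
    using Pb.range[of "(j, k)"] jk by (simp add: grid_vertices)
  have e: "?e \<in> carrier (dual_group ?L)"
    by (rule dual_basis_char(1)[OF K0_grid_comm[OF K] grid_class_basis[OF K] jk])
  have c: "dual_map ?G (nabla_K0 K m n i) ?e \<in> carrier (dual_group ?G)"
    by (rule hom_in_carrier[OF dual_map_hom[OF comm_group.axioms(2)[OF K0_path_comm[OF K]] nabla_K0_hom] e])
  have "dual_map ?G (nabla_K0 K m n i) ?e = dual_simple K (m + n - 1) (nabla_index n i (j, k))"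
  proof (rule dual_eqI[OF c dual_simple_char(1)[OF K idx] K0_path_comm[OF K] path_class_basis[OF K]])
    fix l assume l: "l \<in> {1..m + n - 1}"
    let ?S = "{w. w \<in> V \<and> nabla_index n i w = l}"
    have sl: "simple_path_class K (m + n - 1) l \<in> carrier ?G"
      using path_class_basis[OF K, of "m + n - 1"] l by (auto simp: Z_basis_def)
    have keys: "Poly_Mapping.keys (\<Sum>w\<in>?S. frag_of w) \<subseteq> V"
      using keys_sum[of frag_of ?S] by auto
    have fS: "finite ?S" by simp
    have "dual_map ?G (nabla_K0 K m n i) ?e (simple_path_class K (m + n - 1) l) =
        ?e (lin_ext ?L ?s (\<Sum>w\<in>?S. frag_of w))"
      by (simp only: dual_map_def restrict_apply'[OF sl] nabla_K0_simple)
    also have "\<dots> = (if (j, k) \<in> ?S then 1 else 0)"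
      unfolding dual_basis_lin_ext[OF K0_grid_comm[OF K] grid_class_basis[OF K] jk keys]
      by (rule lookup_sum_frag_of[OF fS])
    also have "\<dots> = dual_simple K (m + n - 1) (nabla_index n i (j, k)) (simple_path_class K (m + n - 1) l)"
      using jk dual_simple_char(2)[OF K idx l] by auto
    finally show "dual_map ?G (nabla_K0 K m n i) ?e (simple_path_class K (m + n - 1) l) =
        dual_simple K (m + n - 1) (nabla_index n i (j, k)) (simple_path_class K (m + n - 1) l)" .
  qed
  then show ?thesis
    by (simp add: circ_def dual_tensor_ident_char(2)[OF K j k])
qed

lemma Dias_comp_char:
  shows "Dias_comp m n i \<in> hom (tensor_group (Dias m) (Dias n)) (Dias (m + n - 1))"
    and "j \<in> {1..m} \<Longrightarrow> k \<in> {1..n} \<Longrightarrow>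
      Dias_comp m n i (tens (Dias m) (Dias n) (frag_of j) (frag_of k)) = frag_of (nabla_index n i (j, k))"
proof -
  let ?D = "Dias (m + n - 1)"
  have cD: "comm_group (Dias p)" for p unfolding Dias_def by (rule abelian_free_Abelian_group)
  let ?B = "Dias_comp_basis n i"
  have Bc: "?B j k \<in> carrier ?D" if "j \<in> {1..m}" "k \<in> {1..n}" for j k
    using Pb.range[of "(j, k)"] that by (simp add: Dias_comp_basis_index Dias_def grid_vertices)
  have B: "?B j \<in> {1..n} \<rightarrow> carrier ?D" if "j \<in> {1..m}" for j using Bc[OF that] by auto
  have inner: "lin_ext ?D (?B j) y \<in> carrier ?D" if "j \<in> {1..m}" "y \<in> carrier (Dias n)" for j y
    using hom_in_carrier[OF lin_ext_hom[OF cD B[OF that(1)]]] that(2) by (simp add: Dias_def)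
  have outer: "(\<lambda>j. lin_ext ?D (?B j) y) \<in> {1..m} \<rightarrow> carrier ?D" if "y \<in> carrier (Dias n)" for y
    using inner that by auto
  let ?f = "\<lambda>(x, y). lin_ext ?D (\<lambda>j. lin_ext ?D (?B j) y) x"
  have bi: "biadditive (Dias m) (Dias n) ?D ?f"
    unfolding biadditive_def split_conv
  proof (intro conjI ballI)
    show "(\<lambda>x. lin_ext ?D (\<lambda>j. lin_ext ?D (?B j) y) x) \<in> hom (Dias m) ?D" if "y \<in> carrier (Dias n)" for y
      using lin_ext_hom[OF cD outer[OF that]] by (simp add: Dias_def)
    fix x assume x: "x \<in> carrier (Dias m)"
    then have kx: "Poly_Mapping.keys x \<subseteq> {1..m}" by (simp add: Dias_def)
    show "(\<lambda>y. lin_ext ?D (\<lambda>j. lin_ext ?D (?B j) y) x) \<in> hom (Dias n) ?D"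
    proof (rule homI)
      show "lin_ext ?D (\<lambda>j. lin_ext ?D (?B j) y) x \<in> carrier ?D" if "y \<in> carrier (Dias n)" for y
        using hom_in_carrier[OF lin_ext_hom[OF cD outer[OF that]]] x by (simp add: Dias_def)
      fix y z assume y: "y \<in> carrier (Dias n)" and z: "z \<in> carrier (Dias n)"
      interpret D: comm_group ?D by (rule cD)
      have yz: "y \<otimes>\<^bsub>Dias n\<^esub> z \<in> carrier (Dias n)"
        by (rule monoid.m_closed[OF comm_monoid.axioms(1)[OF comm_group.axioms(1)[OF cD]] y z])
      have "lin_ext ?D (\<lambda>j. lin_ext ?D (?B j) (y \<otimes>\<^bsub>Dias n\<^esub> z)) x =
          lin_ext ?D (\<lambda>j. lin_ext ?D (?B j) y \<otimes>\<^bsub>?D\<^esub> lin_ext ?D (?B j) z) x"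
        unfolding lin_ext_def[of ?D _ x]
      proof (rule D.finprod_cong'[OF refl])
        fix j assume "j \<in> Poly_Mapping.keys x"
        then have j: "j \<in> {1..m}" using kx by auto
        show "lin_ext ?D (?B j) (y \<otimes>\<^bsub>Dias n\<^esub> z) [^]\<^bsub>?D\<^esub> Poly_Mapping.lookup x j =
            (lin_ext ?D (?B j) y \<otimes>\<^bsub>?D\<^esub> lin_ext ?D (?B j) z) [^]\<^bsub>?D\<^esub> Poly_Mapping.lookup x j"
          using hom_mult[OF lin_ext_hom[OF cD B[OF j]], folded Dias_def, OF y z] by simp
      next
        show "(\<lambda>j. (lin_ext ?D (?B j) y \<otimes>\<^bsub>?D\<^esub> lin_ext ?D (?B j) z) [^]\<^bsub>?D\<^esub> Poly_Mapping.lookup x j)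
            \<in> Poly_Mapping.keys x \<rightarrow> carrier ?D"
        proof (rule Pi_I)
          fix j assume "j \<in> Poly_Mapping.keys x"
          then have j: "j \<in> {1..m}" using kx by auto
          show "(lin_ext ?D (?B j) y \<otimes>\<^bsub>?D\<^esub> lin_ext ?D (?B j) z) [^]\<^bsub>?D\<^esub> Poly_Mapping.lookup x j \<in> carrier ?D"
            by (rule D.int_pow_closed[OF D.m_closed[OF inner[OF j y] inner[OF j z]]])
        qed
      qed
      also have "\<dots> = lin_ext ?D (\<lambda>j. lin_ext ?D (?B j) y) x \<otimes>\<^bsub>?D\<^esub> lin_ext ?D (\<lambda>j. lin_ext ?D (?B j) z) x"
        by (rule lin_ext_mult[OF cD outer[OF y] outer[OF z] kx])
      finally show "lin_ext ?D (\<lambda>j. lin_ext ?D (?B j) (y \<otimes>\<^bsub>Dias n\<^esub> z)) x =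
          lin_ext ?D (\<lambda>j. lin_ext ?D (?B j) y) x \<otimes>\<^bsub>?D\<^esub> lin_ext ?D (\<lambda>j. lin_ext ?D (?B j) z) x" .
    qed
  qed
  note L = tensor_lift[OF cD cD cD bi, folded Dias_comp_def]
  show "Dias_comp m n i \<in> hom (tensor_group (Dias m) (Dias n)) ?D" by (rule L(1))
  assume j: "j \<in> {1..m}" and k: "k \<in> {1..n}"
  have "Dias_comp m n i (tens (Dias m) (Dias n) (frag_of j) (frag_of k)) =
      lin_ext ?D (\<lambda>j. lin_ext ?D (?B j) (frag_of k)) (frag_of j)"
    using L(2)[of "frag_of j" "frag_of k"] j k by (simp add: Dias_def)
  also have "\<dots> = lin_ext ?D (?B j) (frag_of k)"
    by (rule lin_ext_frag_of[OF cD]) (rule inner[OF j], use k in \<open>simp add: Dias_def\<close>)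
  also have "\<dots> = ?B j k" by (rule lin_ext_frag_of[of ?D "?B j", OF cD Bc[OF j k]])
  finally show "Dias_comp m n i (tens (Dias m) (Dias n) (frag_of j) (frag_of k)) = frag_of (nabla_index n i (j, k))"
    by (simp only: Dias_comp_basis_index)
qed

text \<open>Both sides are homomorphisms, and on the basis both are given by \<open>nabla_index\<close>.\<close>

lemma circ_Dias_comp:
  assumes t: "t \<in> carrier (tensor_group (Dias m) (Dias n))"
  shows "circ K m n i
          (tensor_group_map (dual_group (K0_path K m)) (dual_group (K0_path K n))
             (Dias_to_dual K m) (Dias_to_dual K n) t) =
        Dias_to_dual K (m + n - 1) (Dias_comp m n i t)"
proof -
  have cD: "comm_group (Dias p)" for p unfolding Dias_def by (rule abelian_free_Abelian_group)
  have bD: "Z_basis (Dias p) frag_of {1..p}" for p unfolding Dias_def by (rule Z_basis_free)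
  note dP = dual_group_comm[OF K0_path_comm[OF K]]
  have hD: "Dias_to_dual K p \<in> hom (Dias p) (dual_group (K0_path K p))" for p
    using Dias_to_dual_iso[OF K, of p] by (simp add: iso_def)
  note tm = tensor_group_map_hom[OF cD cD dP dP hD hD]
  have "(circ K m n i \<circ> tensor_group_map (dual_group (K0_path K m)) (dual_group (K0_path K n))
             (Dias_to_dual K m) (Dias_to_dual K n)) t =
        (Dias_to_dual K (m + n - 1) \<circ> Dias_comp m n i) t"
  proof (rule Z_basis_hom_eq[OF tensor_group_comm[OF cD cD] Z_basis_tensor[OF cD bD cD bD] dP
        hom_compose[OF tm(1) circ_hom] hom_compose[OF Dias_comp_char(1) hD] _ t])
    fix p assume "p \<in> V"
    then obtain j k where p: "p = (j, k)" and j: "j \<in> {1..m}" and k: "k \<in> {1..n}" by auto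
    have idx: "nabla_index n i (j, k) \<in> {1..m + n - 1}"
      using Pb.range[of "(j, k)"] j k by (simp add: grid_vertices)
    have "frag_of j \<in> carrier (Dias m)" "frag_of k \<in> carrier (Dias n)" using j k by (simp_all add: Dias_def)
    from tm(2)[OF this]
    have "tensor_group_map (dual_group (K0_path K m)) (dual_group (K0_path K n))
        (Dias_to_dual K m) (Dias_to_dual K n) (tens (Dias m) (Dias n) (frag_of j) (frag_of k)) =
      tens (dual_group (K0_path K m)) (dual_group (K0_path K n)) (dual_simple K m j) (dual_simple K n k)"
      by (simp only: Dias_to_dual_frag_of[OF K j] Dias_to_dual_frag_of[OF K k])
    then show "(circ K m n i \<circ> tensor_group_map (dual_group (K0_path K m)) (dual_group (K0_path K n))
             (Dias_to_dual K m) (Dias_to_dual K n)) (case p of (j, k) \<Rightarrow> tens (Dias m) (Dias n) (frag_of j) (frag_of k)) =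
        (Dias_to_dual K (m + n - 1) \<circ> Dias_comp m n i)
          (case p of (j, k) \<Rightarrow> tens (Dias m) (Dias n) (frag_of j) (frag_of k))"
      by (simp only: p split_conv comp_apply circ_basis[OF j k] Dias_comp_char(2)[OF j k]
          Dias_to_dual_frag_of[OF K idx])
  qed
  then show ?thesis by simp
qed

end

theorem mainTheorem5:
  fixes K :: "('k, 'r) ring_scheme" and m n i :: nat
  assumes "field K" and "1 \<le> m" and "1 \<le> n" and "1 \<le> i" and "i \<le> m"
  shows
    "fd_rep K (prod_quiver (op_quiver (path_quiver (m + n - 1))) (grid_quiver m n))
       (nabla_bimodule K m n i) \<and>
     exact_functor K (path_quiver (m + n - 1)) (grid_quiver m n)
       (nabla K m n i :: (nat, 'k, nat \<Rightarrow> 'k) rep \<Rightarrow> _) (nabla_map K m n i) \<and>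
     nabla_K0 K m n i \<in> hom (K0_path K (m + n - 1)) (K0_grid K m n) \<and>
     (\<forall>X :: (nat, 'k, nat \<Rightarrow> 'k) rep. fd_rep K (path_quiver (m + n - 1)) X \<longrightarrow>
        nabla_K0 K m n i (K0_class K (path_quiver (m + n - 1)) X) =
        K0_class K (grid_quiver m n) (nabla K m n i X)) \<and>
     (\<forall>j\<in>{1..m + n - 1}.
        nabla_K0 K m n i (simple_path_class K (m + n - 1) j) =
          K0_class K (grid_quiver m n) (nabla K m n i (standard_rep K {j})) \<and>
        K0_class K (grid_quiver m n) (nabla K m n i (standard_rep K {j})) =
          (if j \<le> i - 1 then
             (\<Otimes>\<^bsub>K0_grid K m n\<^esub> k\<in>{1..n}. simple_grid_class K m n (j, k))
           else if j \<le> i + n - 1 then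
             simple_grid_class K m n (i, j - i + 1)
           else
             (\<Otimes>\<^bsub>K0_grid K m n\<^esub> k\<in>{1..n}. simple_grid_class K m n (j - n + 1, k)))) \<and>
     (\<forall>p\<in>{m, n, m + n - 1}.
        Z_basis (K0_path K p) (simple_path_class K p) {1..p} \<and>
        Z_basis (dual_group (K0_path K p)) (dual_simple K p) {1..p} \<and>
        (\<forall>j\<in>{1..p}. \<forall>l\<in>{1..p}.
           dual_simple K p j (simple_path_class K p l) = (if l = j then 1 else 0))) \<and>
     K0_tensor_ident K m n \<in>
       iso (tensor_group (K0_path K m) (K0_path K n)) (K0_grid K m n) \<and>
     (\<forall>j\<in>{1..m}. \<forall>k\<in>{1..n}.
        K0_tensor_ident K m n
          (tens (K0_path K m) (K0_path K n) (simple_path_class K m j) (simple_path_class K n k)) =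
        simple_grid_class K m n (j, k)) \<and>
     dual_tensor_ident K m n \<in>
       iso (tensor_group (dual_group (K0_path K m)) (dual_group (K0_path K n)))
         (dual_group (K0_grid K m n)) \<and>
     (\<forall>j\<in>{1..m}. \<forall>k\<in>{1..n}.
        circ K m n i
          (tens (dual_group (K0_path K m)) (dual_group (K0_path K n))
             (dual_simple K m j) (dual_simple K n k)) =
        (if i > j then dual_simple K (m + n - 1) j
         else if i = j then dual_simple K (m + n - 1) (i + k - 1)
         else dual_simple K (m + n - 1) (j + n - 1))) \<and>
     (\<forall>p\<in>{m, n, m + n - 1}. Dias_to_dual K p \<in> iso (Dias p) (dual_group (K0_path K p))) \<and>
     (\<forall>t\<in>carrier (tensor_group (Dias m) (Dias n)).
        circ K m n i
          (tensor_group_map (dual_group (K0_path K m)) (dual_group (K0_path K n))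
             (Dias_to_dual K m) (Dias_to_dual K n) t) =
        Dias_to_dual K (m + n - 1) (Dias_comp m n i t))"
proof -
  interpret nabla_setting K m n i by (rule nabla_setting.intro[OF assms])
  show ?thesis
  proof (intro conjI ballI allI impI)
    show "fd_rep K (prod_quiver (op_quiver (path_quiver (m + n - 1))) (grid_quiver m n)) (nabla_bimodule K m n i)"
      unfolding nabla_bimodule_eq by (rule Pb.M_fd)
    show "exact_functor K (path_quiver (m + n - 1)) (grid_quiver m n)
       (nabla K m n i :: (nat, 'k, nat \<Rightarrow> 'k) rep \<Rightarrow> _) (nabla_map K m n i)"
      unfolding nabla_eq nabla_map_eq by (rule Pb.tensor_exact)
    show "nabla_K0 K m n i (simple_path_class K (m + n - 1) j) =
          K0_class K (grid_quiver m n) (nabla K m n i (standard_rep K {j}))" for j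
      by (rule nabla_K0_class[OF P.simple_fd])
    show "circ K m n i
          (tens (dual_group (K0_path K m)) (dual_group (K0_path K n)) (dual_simple K m j) (dual_simple K n k)) =
        (if i > j then dual_simple K (m + n - 1) j
         else if i = j then dual_simple K (m + n - 1) (i + k - 1)
         else dual_simple K (m + n - 1) (j + n - 1))" if "j \<in> {1..m}" "k \<in> {1..n}" for j k
      using circ_basis[OF that] by (simp add: nabla_index_def)
  qed (rule nabla_K0_hom nabla_K0_class nabla_simple_cases path_class_basis[OF assms(1)]
      dual_simple_basis[OF assms(1)] dual_simple_char(2)[OF assms(1)] K0_tensor_ident_char[OF assms(1)]
      dual_tensor_ident_char(1)[OF assms(1)] Dias_to_dual_iso[OF assms(1)] circ_Dias_comp; assumption)+
qed

end
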